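(* Let $a\in(0,1)$ and let $p>0$ be a real number that is not an even integer. For integers $m$ with $2m>p$, let $P_m(z,p,a)$ be the polynomial of degree at most $2m$ of best uniform approximation to $|x|^p$ on $[-1,-a]\cup[a,1]$, and let $E_{2m}(p,a)$ be the approximation error. Then the following limit exists and has the indicated value: $$\lim_{m\to\infty}\left(\frac{1+a}{1-a}\right)^{m+1}m^{\frac p2+1}E_{2m}(p,a)=a^{\frac p2-1}\,\frac{(1+a)^2}{2\left|\Gamma\left(-\frac p2\right)\right|}.$$ Moreover, uniformly for $\lambda$ in compact subsets of the positive half-axis $(0,\infty)$, $$\lim_{m\to\infty}\left\{\left(\frac ma\right)^{\frac p2}P_m\left(\sqrt{\frac am}\,\lambda,p,a\right)\right\}=\lambda^p+\frac{\sin\frac{\pi p}{2}}{\pi}\int_0^\infty\mu^p e^{-(\lambda^2+\mu^2)}\,\frac{2\mu\,d\mu}{\lambda^2+\mu^2}.$$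
   Context: The approximation error is $E_{2m}(p,a)=\min_{\deg P\le 2m}\ \max_{a\le|x|\le1}\bigl||x|^p-P(x)\bigr|$, and $P_m(\cdot,p,a)$ is the minimizing polynomial. *)

theory Defs
  imports "HOL-Analysis.Analysis" "HOL-Computational_Algebra.Polynomial"
begin

definition uniform_error :: "real set \<Rightarrow> (real \<Rightarrow> real) \<Rightarrow> real poly \<Rightarrow> real" where
  "uniform_error S f Q = (SUP x\<in>S. \<bar>f x - poly Q x\<bar>)"

definition min_uniform_error :: "real set \<Rightarrow> (real \<Rightarrow> real) \<Rightarrow> nat \<Rightarrow> real" where
  "min_uniform_error S f n = (INF Q\<in>{Q. degree Q \<le> n}. uniform_error S f Q)"

text \<open>A polynomial attaining the minimum exists and is unique when \<open>S\<close> is compact with more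
  than \<open>n\<close> points and \<open>f\<close> is continuous on \<open>S\<close>; only such cases are used below.\<close>

definition best_approx_poly :: "real set \<Rightarrow> (real \<Rightarrow> real) \<Rightarrow> nat \<Rightarrow> real poly" where
  "best_approx_poly S f n =
     (THE Q. degree Q \<le> n \<and> uniform_error S f Q = min_uniform_error S f n)"

definition approx_error :: "nat \<Rightarrow> real \<Rightarrow> real \<Rightarrow> real" where
  "approx_error n p a = min_uniform_error ({-1..-a} \<union> {a..1}) (\<lambda>x. \<bar>x\<bar> powr p) n"

text \<open>The index \<open>m\<close> is half the degree bound.\<close>

definition best_poly :: "nat \<Rightarrow> real \<Rightarrow> real \<Rightarrow> real poly" where
  "best_poly m p a = best_approx_poly ({-1..-a} \<union> {a..1}) (\<lambda>x. \<bar>x\<bar> powr p) (2 * m)"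

end

theory Submission imports Defs begin

text \<open>
  Put \<open>s = p / 2\<close> and \<open>y = x\<^sup>2\<close>. The two intervals are symmetric, so averaging a polynomial with its
  reflection turns the problem into the approximation of \<open>y powr s\<close> by polynomials of degree
  \<open>m\<close> on the single interval from \<open>a\<^sup>2\<close> to \<open>1\<close>, whose distance from the branch point \<open>0\<close> is
  \<open>a\<^sup>2\<close>. Everything then follows from one explicit interpolation formula.

  \<^bold>\<open>The model problem.\<close> For a simple pole \<open>1 / (x - c)\<close> off the interval \<open>[-1, 1]\<close> the best
  approximation is known in closed form. If \<open>\<rho> < 1\<close> and \<open>c = (\<rho> + 1 / \<rho>) / 2\<close>, the polynomial
  \<open>\<omega> = T\<^bsub>m+1\<^esub> - 2 \<rho> T\<^bsub>m\<^esub> + \<rho>\<^sup>2 T\<^bsub>m-1\<^esub>\<close> satisfies \<open>\<omega> (cos \<theta>) = 2 \<rho> (c - cos \<theta>) cos (\<phi> \<theta>)\<close> with a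
  phase \<open>\<phi>\<close> that runs from \<open>0\<close> to \<open>(m + 1) \<pi>\<close> (\<open>poly_alt_poly_cos\<close>). Hence \<open>\<omega> / (x - c)\<close>
  equioscillates at \<open>m + 2\<close> points. The nodes used below are the zeros of this \<open>\<omega>\<close>, transplanted so
  that the pole sits at the branch point \<open>y = 0\<close>.

  \<^bold>\<open>The interpolation error.\<close> Up to polynomials, \<open>y powr s\<close> is a superposition of the Cauchy kernels
  \<open>1 / (y + t)\<close> with density \<open>t powr s\<close>, and the interpolation error of a Cauchy kernel is explicit.
  With \<open>t = \<mu>\<^sup>2\<close> the interpolant \<open>L\<close> of \<open>y powr s\<close> at the nodes therefore satisfies
  (\<open>power_interpolation_error\<close>)
  \<open>y powr s - L y = - (sin (\<pi> s) / \<pi>) \<omega> y (\<integral> 2 \<mu> powr (2 s + 1) / (\<omega> (-\<mu>\<^sup>2) (y + \<mu>\<^sup>2)) d\<mu>)\<close>.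

  \<^bold>\<open>The first limit.\<close> Outside the interval \<open>\<omega>\<close> grows like the power \<open>m + 1\<close> of the exterior conformal
  map, so \<open>\<omega> 0 / \<omega> (-t)\<close> behaves like \<open>exp (- m t / a)\<close> and only \<open>t\<close> of order \<open>1 / m\<close> matters
  (\<open>node_poly_limit\<close>, \<open>kern_le\<close>). There \<open>y / (y + t)\<close> is nearly \<open>1\<close>, so the error is a constant times
  the equioscillating function \<open>\<omega> y / y\<close>, up to a factor tending to \<open>1\<close> uniformly on the interval. The maximal error
  bounds the approximation error from above, the errors at the alternation points bound it from
  below, and the two bounds have the same leading term. The constant is
  \<open>\<Gamma>(s + 1) \<bar>sin (\<pi> s)\<bar> / \<pi> = 1 / \<bar>\<Gamma>(-s)\<bar>\<close>.

  \<^bold>\<open>The second limit.\<close> At \<open>y = a \<lambda>\<^sup>2 / m\<close> the formula for \<open>L\<close> involves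
  \<open>\<omega> y / \<omega> (- a \<mu>\<^sup>2 / m)\<close>, which tends to \<open>exp (- (\<lambda>\<^sup>2 + \<mu>\<^sup>2))\<close>; this produces the stated integral. The best
  polynomial differs from \<open>L\<close> by at most twice the error bound on the interval, hence near \<open>0\<close> by at most
  this quantity times \<open>((1 + a) / (1 - a)) ^ m\<close> (\<open>bernstein_walsh_gap\<close>). After multiplication by
  \<open>(m / a) powr s\<close> the difference is of order \<open>1 / m\<close>, so any near-best polynomial has the same limit.
\<close>

section \<open>Lagrange interpolation and sign changes of polynomials\<close>

definition lagrange_basis :: "'a::field set \<Rightarrow> 'a \<Rightarrow> 'a poly" where
  "lagrange_basis Z z = smult (inverse (\<Prod>w\<in>Z - {z}. z - w)) (\<Prod>w\<in>Z - {z}. [:- w, 1:])"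

lemma degree_lagrange_basis:
  assumes "finite Z" "z \<in> Z"
  shows "degree (lagrange_basis Z z) < card Z"
proof -
  have "degree (\<Prod>w\<in>Z - {z}. [:- w, 1:]) \<le> sum (degree \<circ> (\<lambda>w. [:- w, 1:])) (Z - {z})"
    by (rule degree_prod_sum_le) (use assms in auto)
  also have "\<dots> = card Z - 1" using assms by simp
  finally show ?thesis
    using assms card_gt_0_iff[of Z] unfolding lagrange_basis_def
    by (metis One_nat_def Suc_pred degree_smult_le empty_iff le_imp_less_Suc le_trans)
qed

lemma poly_lagrange_basis:
  assumes "finite Z" "z \<in> Z" "w \<in> Z"
  shows "poly (lagrange_basis Z z) w = (if w = z then 1 else 0)"
  using assms by (auto simp: lagrange_basis_def poly_prod)

lemma degree_sum_lagrange_basis: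
  assumes "finite Z" "Z \<noteq> {}"
  shows "degree (\<Sum>z\<in>Z. smult (c z) (lagrange_basis Z z)) < card Z"
proof -
  have "degree (\<Sum>z\<in>Z. smult (c z) (lagrange_basis Z z)) \<le> card Z - 1"
  proof (rule degree_sum_le)
    fix z assume "z \<in> Z"
    then show "degree (smult (c z) (lagrange_basis Z z)) \<le> card Z - 1"
      using degree_lagrange_basis[OF assms(1), of z] degree_smult_le[of "c z" "lagrange_basis Z z"] by linarith
  qed (use assms in auto)
  moreover have "card Z > 0" using assms card_gt_0_iff by blast
  ultimately show ?thesis by linarith
qed

lemma poly_sum_lagrange_basis:
  assumes "finite Z" "w \<in> Z"
  shows "poly (\<Sum>z\<in>Z. smult (c z) (lagrange_basis Z z)) w = c w"
proof -
  have "poly (\<Sum>z\<in>Z. smult (c z) (lagrange_basis Z z)) w = (\<Sum>z\<in>Z. if w = z then c z else 0)"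
    unfolding poly_sum using assms by (intro sum.cong) (auto simp: poly_lagrange_basis)
  then show ?thesis using assms by simp
qed

lemma poly_eq_if_eq_on:
  fixes P Q :: "'a::idom poly"
  assumes "finite Z" "degree P < card Z" "degree Q < card Z" "\<And>z. z \<in> Z \<Longrightarrow> poly P z = poly Q z"
  shows "P = Q"
proof (rule ccontr)
  assume "P \<noteq> Q"
  then have nz: "P - Q \<noteq> 0" by simp
  have "Z \<subseteq> {x. poly (P - Q) x = 0}" using assms(4) by auto
  then have "card Z \<le> card {x. poly (P - Q) x = 0}"
    using poly_roots_finite[OF nz] card_mono by blast
  also have "\<dots> \<le> degree (P - Q)" using card_poly_roots_bound[OF nz] .
  also have "\<dots> < card Z" using assms(2,3) degree_diff_less by blast
  finally show False by simp
qed

lemma lagrange_interpolation: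
  fixes P :: "'a::field poly"
  assumes "finite Z" "degree P < card Z"
  shows "P = (\<Sum>z\<in>Z. smult (poly P z) (lagrange_basis Z z))"
proof (rule poly_eq_if_eq_on[OF assms])
  have "Z \<noteq> {}" using assms by auto
  then show "degree (\<Sum>z\<in>Z. smult (poly P z) (lagrange_basis Z z)) < card Z"
    by (rule degree_sum_lagrange_basis[OF assms(1)])
  show "poly P z = poly (\<Sum>z\<in>Z. smult (poly P z) (lagrange_basis Z z)) z" if "z \<in> Z" for z
    using poly_sum_lagrange_basis[OF assms(1) that, of "poly P"] by simp
qed

lemma sign_changes_imp_roots:
  fixes P :: "real poly" and x :: "nat \<Rightarrow> real"
  assumes incr: "\<And>j. j < N \<Longrightarrow> x j < x (Suc j)"
    and alt: "\<And>j. j \<le> N \<Longrightarrow> (-1) ^ j * poly P (x j) > 0"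
  shows "\<exists>Z. finite Z \<and> card Z = N \<and> (\<forall>z\<in>Z. x 0 < z \<and> z < x N \<and> poly P z = 0)"
proof -
  have "\<exists>z. x j < z \<and> z < x (Suc j) \<and> poly P z = 0" if j: "j < N" for j
  proof -
    have "((-1) ^ j * poly P (x j)) * ((-1) ^ Suc j * poly P (x (Suc j))) > 0"
      using mult_pos_pos[OF alt[of j] alt[of "Suc j"]] j by linarith
    moreover have "((-1) ^ j * poly P (x j)) * ((-1) ^ Suc j * poly P (x (Suc j)))
        = - (poly P (x j) * poly P (x (Suc j)))"
      by (cases "even j") simp_all
    ultimately have "poly P (x j) * poly P (x (Suc j)) < 0"
      by linarith
    then show ?thesis using poly_IVT[OF incr[OF j], of P] by blast
  qed
  then obtain z where z: "\<And>j. j < N \<Longrightarrow> x j < z j \<and> z j < x (Suc j) \<and> poly P (z j) = 0"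
    by metis
  have mono: "x i \<le> x j" if "i \<le> j" "j \<le> N" for i j
    using that
  proof (induction j rule: dec_induct)
    case base then show ?case by simp
  next
    case (step n) then show ?case using incr[of n] by fastforce
  qed
  have less: "z i < z j" if "i < j" "j < N" for i j
    using z[of i] z[of j] mono[of "Suc i" j] that by fastforce
  have "inj_on z {..<N}"
    by (rule inj_onI) (metis less less_irrefl linorder_neqE_nat lessThan_iff)
  then have "card (z ` {..<N}) = N" by (simp add: card_image)
  moreover have "x 0 < w \<and> w < x N \<and> poly P w = 0" if w: "w \<in> z ` {..<N}" for w
  proof -
    obtain j where j: "j < N" "w = z j" using w by auto
    show ?thesis using z[OF j(1)] mono[of 0 j] mono[of "Suc j" N] j by simp
  qed
  ultimately show ?thesis by (intro exI[of _ "z ` {..<N}"]) simp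
qed

lemma sign_changes_le_degree:
  fixes P :: "real poly" and x :: "nat \<Rightarrow> real"
  assumes "\<And>j. j < N \<Longrightarrow> x j < x (Suc j)"
    and alt: "\<And>j. j \<le> N \<Longrightarrow> (-1) ^ j * poly P (x j) > 0"
  shows "N \<le> degree P"
proof -
  have "\<exists>Z. finite Z \<and> card Z = N \<and> (\<forall>z\<in>Z. x 0 < z \<and> z < x N \<and> poly P z = 0)"
    using assms by (rule sign_changes_imp_roots)
  then obtain Z where Z: "finite Z" "card Z = N" "\<forall>z\<in>Z. poly P z = 0"
    by blast
  have nz: "P \<noteq> 0"
  proof
    assume "P = 0"
    then show False using alt[of 0] by simp
  qed
  have "Z \<subseteq> {x. poly P x = 0}" using Z by auto
  then have "card Z \<le> card {x. poly P x = 0}" by (intro card_mono poly_roots_finite nz)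
  also have "\<dots> \<le> degree P" by (rule card_poly_roots_bound[OF nz])
  finally show ?thesis using Z(2) by simp
qed

text \<open>The lower bound of de la Vallee Poussin: a polynomial \<open>P\<close> with a smaller error at all the points
would make \<open>P - L\<close> change sign \<open>m + 1\<close> times. The factor \<open>\<sigma>\<close> allows either orientation of the
alternation.\<close>

lemma alternation_imp_error_ge:
  fixes f :: "real \<Rightarrow> real" and x :: "nat \<Rightarrow> real"
  assumes P: "degree P \<le> m" and L: "degree L \<le> m"
    and incr: "\<And>j. j < Suc m \<Longrightarrow> x j < x (Suc j)"
    and alt: "\<And>j. j \<le> Suc m \<Longrightarrow> e \<le> (- 1) ^ j * (\<sigma> * (f (x j) - poly L (x j)))" and \<sigma>: "\<bar>\<sigma>\<bar> = 1"
  shows "\<exists>j\<le>Suc m. e \<le> \<bar>f (x j) - poly P (x j)\<bar>"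
proof (rule ccontr)
  assume "\<not> ?thesis"
  then have lt: "\<bar>f (x j) - poly P (x j)\<bar> < e" if "j \<le> Suc m" for j using that by force
  define D where "D = smult \<sigma> (P - L)"
  have "(- 1) ^ j * poly D (x j) > 0" if j: "j \<le> Suc m" for j
  proof -
    have "(- 1) ^ j * poly D (x j) = (- 1) ^ j * (\<sigma> * (f (x j) - poly L (x j)))
        - (- 1) ^ j * (\<sigma> * (f (x j) - poly P (x j)))"
      by (simp add: D_def algebra_simps)
    moreover have "\<bar>(- 1) ^ j * (\<sigma> * (f (x j) - poly P (x j)))\<bar> = \<bar>f (x j) - poly P (x j)\<bar>"
      by (simp add: abs_mult \<sigma> power_abs)
    ultimately show ?thesis using alt[OF j] lt[OF j] by linarith
  qed
  with incr have "Suc m \<le> degree D" by (rule sign_changes_le_degree)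
  moreover have "degree D \<le> m"
    unfolding D_def using P L degree_smult_le[of \<sigma> "P - L"] degree_diff_le[OF P L] by linarith
  ultimately show False by simp
qed

lemma even_part_of_poly:
  fixes Q :: "real poly"
  assumes "degree Q \<le> 2 * m"
  shows "\<exists>D. degree D \<le> m \<and> (\<forall>x. poly D (x\<^sup>2) = (poly Q x + poly Q (- x)) / 2)"
proof -
  define D where "D = (\<Sum>i\<le>m. monom (coeff Q (2 * i)) i)"
  have "degree D \<le> m" unfolding D_def
    by (rule degree_sum_le) (auto intro: order_trans[OF degree_monom_le])
  moreover have "poly D (x\<^sup>2) = (poly Q x + poly Q (- x)) / 2" for x
  proof -
    have Qx: "poly Q z = (\<Sum>i\<le>2 * m. coeff Q i * z ^ i)" for z
      unfolding poly_altdef using assms by (intro sum.mono_neutral_left) (auto simp: coeff_eq_0)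
    have "(poly Q x + poly Q (- x)) / 2 = (\<Sum>i\<le>2 * m. coeff Q i * ((x ^ i + (- x) ^ i) / 2))"
      unfolding Qx by (simp add: sum.distrib sum_divide_distrib add_divide_distrib distrib_left)
    also have "\<dots> = (\<Sum>i\<in>(\<lambda>i. 2 * i) ` {..m}. coeff Q i * ((x ^ i + (- x) ^ i) / 2))"
    proof (rule sum.mono_neutral_right)
      show "\<forall>i\<in>{..2 * m} - (\<lambda>i. 2 * i) ` {..m}. coeff Q i * ((x ^ i + (- x) ^ i) / 2) = 0"
      proof
        fix i assume i: "i \<in> {..2 * m} - (\<lambda>i. 2 * i) ` {..m}"
        have "odd i"
        proof
          assume "even i"
          then obtain j where "i = 2 * j" by (elim evenE)
          then show False using i by auto
        qed
        then show "coeff Q i * ((x ^ i + (- x) ^ i) / 2) = 0" by simp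
      qed
    qed auto
    also have "\<dots> = (\<Sum>i\<le>m. coeff Q (2 * i) * ((x ^ (2 * i) + (- x) ^ (2 * i)) / 2))"
      by (subst sum.reindex) (auto simp: inj_on_def)
    also have "\<dots> = poly D (x\<^sup>2)"
      by (simp add: D_def poly_sum poly_monom power_mult)
    finally show ?thesis by simp
  qed
  ultimately show ?thesis by blast
qed

section \<open>Existence and uniqueness of best uniform approximations\<close>

lemma bdd_above_error:
  fixes f :: "real \<Rightarrow> real"
  assumes "compact S" "continuous_on S f"
  shows "bdd_above ((\<lambda>x. \<bar>f x - poly Q x\<bar>) ` S)"
proof -
  have "compact ((\<lambda>x. \<bar>f x - poly Q x\<bar>) ` S)"
    using assms by (intro compact_continuous_image continuous_intros)
  then show ?thesis by (simp add: bounded_imp_bdd_above compact_imp_bounded)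
qed

lemma error_le_uniform_error:
  fixes f :: "real \<Rightarrow> real"
  assumes "compact S" "continuous_on S f" "x \<in> S"
  shows "\<bar>f x - poly Q x\<bar> \<le> uniform_error S f Q"
  unfolding uniform_error_def using bdd_above_error[OF assms(1,2)] assms(3) by (intro cSUP_upper)

lemma uniform_error_le:
  assumes "S \<noteq> {}" "\<And>x. x \<in> S \<Longrightarrow> \<bar>f x - poly Q x\<bar> \<le> M"
  shows "uniform_error S f Q \<le> M"
  unfolding uniform_error_def using assms by (intro cSUP_least)

lemma uniform_error_nonneg:
  fixes f :: "real \<Rightarrow> real"
  assumes "compact S" "continuous_on S f" "S \<noteq> {}"
  shows "0 \<le> uniform_error S f Q"
  using error_le_uniform_error[OF assms(1,2)] assms(3) by (meson abs_ge_zero all_not_in_conv order_trans)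

lemma uniform_error_attained:
  fixes f :: "real \<Rightarrow> real"
  assumes "compact S" "continuous_on S f" "S \<noteq> {}"
  shows "\<exists>x\<in>S. \<bar>f x - poly Q x\<bar> = uniform_error S f Q"
proof -
  have "continuous_on S (\<lambda>x. \<bar>f x - poly Q x\<bar>)"
    using assms by (intro continuous_intros)
  then obtain x where "x \<in> S" "\<And>y. y \<in> S \<Longrightarrow> \<bar>f y - poly Q y\<bar> \<le> \<bar>f x - poly Q x\<bar>"
    using continuous_attains_sup[OF assms(1,3)] by blast
  then show ?thesis
    using error_le_uniform_error[OF assms(1,2)] uniform_error_le[OF assms(3), of f Q]
    by (meson antisym)
qed

lemma min_uniform_error_le:
  fixes f :: "real \<Rightarrow> real"
  assumes "compact S" "continuous_on S f" "S \<noteq> {}" "degree Q \<le> n"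
  shows "min_uniform_error S f n \<le> uniform_error S f Q"
  unfolding min_uniform_error_def
  using assms uniform_error_nonneg[OF assms(1-3)] by (intro cINF_lower bdd_belowI2[where m = 0]) auto

lemma le_min_uniform_error:
  assumes "\<And>Q. degree Q \<le> n \<Longrightarrow> M \<le> uniform_error S f Q"
  shows "M \<le> min_uniform_error S f n"
  unfolding min_uniform_error_def
  by (rule cINF_greatest) (use assms degree_0[where 'a = real] in \<open>auto intro: exI[of _ 0]\<close>)

text \<open>Values at \<open>n + 1\<close> points of \<open>S\<close> are coordinates for the polynomials of degree at most \<open>n\<close>. Only
polynomials that are no worse than \<open>0\<close> compete, and their coordinates lie in a fixed box, which is
compact in the product topology; the error is a Lipschitz function of the coordinates.\<close>

lemma best_approximation_exists:
  fixes f :: "real \<Rightarrow> real"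
  assumes S: "compact S" "continuous_on S f" "infinite S"
  shows "\<exists>Q. degree Q \<le> n \<and> uniform_error S f Q = min_uniform_error S f n"
proof -
  have ne: "S \<noteq> {}" using S by auto
  obtain Z where Z: "finite Z" "card Z = Suc n" "Z \<subseteq> S"
    using infinite_arbitrarily_large[OF S(3)] by blast
  define V where "V v = (\<Sum>z\<in>Z. smult (v z) (lagrange_basis Z z))" for v :: "real \<Rightarrow> real"
  have Zne: "Z \<noteq> {}" using Z by auto
  have degV: "degree (V v) \<le> n" for v
    unfolding V_def using degree_sum_lagrange_basis[OF Z(1) Zne, of v] Z(2) by simp
  define M where "M = uniform_error S f 0"
  obtain F where F: "\<And>x. x \<in> S \<Longrightarrow> \<bar>f x\<bar> \<le> F"
    using error_le_uniform_error[OF S(1,2), of _ 0] by auto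
  define box where "box = PiE UNIV (\<lambda>z. if z \<in> Z then {-(F + M)..F + M} else {0})"
  have cbox: "compact box"
  proof -
    have "compactin (product_topology (\<lambda>i. euclidean) UNIV) box"
      unfolding box_def by (subst compactin_PiE) (auto simp: compactin_euclidean_iff)
    then show ?thesis
      by (simp add: euclidean_product_topology compactin_euclidean_iff)
  qed
  have M0: "M \<ge> 0" unfolding M_def by (rule uniform_error_nonneg[OF S(1,2) ne])
  have F0: "F \<ge> 0" using F ne by (meson abs_ge_zero all_not_in_conv order_trans)
  have boxne: "box \<noteq> {}" unfolding box_def using M0 F0 by (auto simp: PiE_eq_empty_iff split: if_splits)
  have "compact ((\<lambda>x. \<Sum>z\<in>Z. \<bar>poly (lagrange_basis Z z) x\<bar>) ` S)"
    using S by (intro compact_continuous_image continuous_intros)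
  then have "bdd_above ((\<lambda>x. \<Sum>z\<in>Z. \<bar>poly (lagrange_basis Z z) x\<bar>) ` S)"
    by (intro bounded_imp_bdd_above compact_imp_bounded)
  then obtain K where K': "\<And>x. x \<in> S \<Longrightarrow> (\<Sum>z\<in>Z. \<bar>poly (lagrange_basis Z z) x\<bar>) \<le> K"
    unfolding bdd_above_def by blast
  have K: "\<bar>poly (lagrange_basis Z z) x\<bar> \<le> K" if "x \<in> S" "z \<in> Z" for x z
    using K'[OF that(1)] member_le_sum[OF that(2), of "\<lambda>z. \<bar>poly (lagrange_basis Z z) x\<bar>"] Z(1) by fastforce
  have lip: "uniform_error S f (V v) \<le> uniform_error S f (V u) + (\<Sum>z\<in>Z. K * \<bar>v z - u z\<bar>)" for u v
  proof (rule uniform_error_le[OF ne])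
    fix x assume x: "x \<in> S"
    have "poly (V u) x - poly (V v) x = (\<Sum>z\<in>Z. (u z - v z) * poly (lagrange_basis Z z) x)"
      by (simp add: V_def poly_sum sum_subtractf left_diff_distrib)
    then have "\<bar>poly (V u) x - poly (V v) x\<bar> \<le> (\<Sum>z\<in>Z. \<bar>(u z - v z) * poly (lagrange_basis Z z) x\<bar>)"
      by simp
    also have "\<dots> \<le> (\<Sum>z\<in>Z. K * \<bar>v z - u z\<bar>)"
    proof (rule sum_mono)
      fix z assume "z \<in> Z"
      then have "\<bar>v z - u z\<bar> * \<bar>poly (lagrange_basis Z z) x\<bar> \<le> \<bar>v z - u z\<bar> * K"
        by (intro mult_left_mono K[OF x]) auto
      then show "\<bar>(u z - v z) * poly (lagrange_basis Z z) x\<bar> \<le> K * \<bar>v z - u z\<bar>"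
        by (simp add: abs_mult abs_minus_commute[of "v z"] mult.commute[of K])
    qed
    finally show "\<bar>f x - poly (V v) x\<bar> \<le> uniform_error S f (V u) + (\<Sum>z\<in>Z. K * \<bar>v z - u z\<bar>)"
      using error_le_uniform_error[OF S(1,2) x, of "V u"] by linarith
  qed
  have cont: "continuous_on UNIV (\<lambda>v. uniform_error S f (V v))"
    unfolding continuous_on_def
  proof (rule ballI)
    fix u :: "real \<Rightarrow> real"
    have cz: "((\<lambda>v. v z) \<longlongrightarrow> u z) (at u)" for z
      using continuous_on_product_coordinates[of z] unfolding continuous_on_def by blast
    have "((\<lambda>v. \<Sum>z\<in>Z. K * \<bar>v z - u z\<bar>) \<longlongrightarrow> (\<Sum>z\<in>Z. K * \<bar>u z - u z\<bar>)) (at u)"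
      by (intro tendsto_intros cz)
    then have lim0: "((\<lambda>v. \<Sum>z\<in>Z. K * \<bar>v z - u z\<bar>) \<longlongrightarrow> 0) (at u)" by simp
    show "((\<lambda>v. uniform_error S f (V v)) \<longlongrightarrow> uniform_error S f (V u)) (at u)"
    proof (rule Lim_null_comparison[OF _ lim0, THEN LIM_zero_cancel])
      show "\<forall>\<^sub>F v in at u. norm (uniform_error S f (V v) - uniform_error S f (V u)) \<le> (\<Sum>z\<in>Z. K * \<bar>v z - u z\<bar>)"
      proof (intro always_eventually allI)
        fix v show "norm (uniform_error S f (V v) - uniform_error S f (V u)) \<le> (\<Sum>z\<in>Z. K * \<bar>v z - u z\<bar>)"
          using lip[of v u] lip[of u v] by (simp add: abs_minus_commute abs_le_iff)
      qed
    qed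
  qed
  then obtain v0 where v0: "v0 \<in> box" "\<And>v. v \<in> box \<Longrightarrow> uniform_error S f (V v0) \<le> uniform_error S f (V v)"
    using continuous_attains_inf[OF cbox boxne continuous_on_subset[OF cont subset_UNIV]] by auto
  have V0: "V (\<lambda>z. 0) = 0" by (simp add: V_def)
  have "(\<lambda>z. 0) \<in> box" unfolding box_def using M0 F0 by auto
  then have leM: "uniform_error S f (V v0) \<le> M" using v0(2) V0 unfolding M_def by metis
  have least: "uniform_error S f (V v0) \<le> uniform_error S f Q" if Q: "degree Q \<le> n" for Q
  \<comment> \<open>Polynomials worse than \<open>0\<close>, whose error is \<open>M\<close>, need no coordinates in the box.\<close>
  proof (cases "uniform_error S f Q \<le> M")
    case True
    define v where "v z = (if z \<in> Z then poly Q z else 0)" for z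
    have "V v = (\<Sum>z\<in>Z. smult (poly Q z) (lagrange_basis Z z))" by (simp add: V_def v_def)
    then have "V v = Q" using lagrange_interpolation[OF Z(1), of Q] Q Z(2) by simp
    moreover have vb: "\<bar>v z\<bar> \<le> F + M" if "z \<in> Z" for z
      using error_le_uniform_error[OF S(1,2), of z Q] F[of z] True Z(3) that unfolding v_def
      by (simp add: subset_iff)
    have "- (F + M) \<le> v z \<and> v z \<le> F + M" if "z \<in> Z" for z
      using vb[OF that] by linarith
    then have "v \<in> box" unfolding box_def by (auto simp: v_def PiE_UNIV_domain)
    ultimately show ?thesis using v0(2) by metis
  next
    case False then show ?thesis using leM by simp
  qed
  have "uniform_error S f (V v0) = min_uniform_error S f n"
    using le_min_uniform_error[OF least] min_uniform_error_le[OF S(1,2) ne degV] by (meson antisym)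
  then show ?thesis using degV by blast
qed

text \<open>Let \<open>M\<close> be the mean of two best approximations; it is again best. Where its error is extremal, both
given polynomials have that same extremal error and hence agree. If there were at most \<open>n + 1\<close> extremal
points, a small multiple of the interpolant \<open>R\<close> of the error at these points could be added to \<open>M\<close> to
lower the error everywhere. So the two polynomials agree at \<open>n + 1\<close> points.\<close>

lemma best_approximation_unique:
  fixes f :: "real \<Rightarrow> real"
  assumes S: "compact S" "continuous_on S f" "infinite S"
    and P: "degree P \<le> n" "uniform_error S f P = min_uniform_error S f n"
    and Q: "degree Q \<le> n" "uniform_error S f Q = min_uniform_error S f n"
  shows "P = Q"
proof -
  have ne: "S \<noteq> {}" using S by auto
  define E where "E = min_uniform_error S f n"
  define M where "M = smult (1/2) (P + Q)"
  define e where "e x = f x - poly M x" for x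
  have degM: "degree M \<le> n" unfolding M_def using P Q degree_add_le by auto
  have eP: "\<bar>f x - poly P x\<bar> \<le> E" and eQ: "\<bar>f x - poly Q x\<bar> \<le> E" if "x \<in> S" for x
    using error_le_uniform_error[OF S(1,2) that] P Q unfolding E_def by metis+
  have e2: "2 * e x = (f x - poly P x) + (f x - poly Q x)" for x
    by (simp add: e_def M_def field_simps)
  have eE: "\<bar>e x\<bar> \<le> E" if "x \<in> S" for x
    using eP[OF that] eQ[OF that] e2[of x] by (simp add: abs_le_iff)
  define A where "A = {x \<in> S. \<bar>e x\<bar> = E}"
  have A: "poly P x = poly Q x" if "x \<in> A" for x
  proof -
    have "\<bar>e x\<bar> = E" "x \<in> S" using that by (auto simp: A_def)
    then show ?thesis using eP[of x] eQ[of x] e2[of x] by (auto simp: abs_le_iff abs_if split: if_splits)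
  qed
  have big: "\<not> (finite A \<and> card A \<le> Suc n)"
  proof
    assume "finite A \<and> card A \<le> Suc n"
    then have fA: "finite A" and cA: "card A \<le> Suc n" by auto
    have E0: "E > 0"
    proof (rule ccontr)
      assume "\<not> E > 0"
      then have "A = S" using eE unfolding A_def by (smt (verit) Collect_cong Collect_mem_eq abs_ge_zero)
      then show False using fA S by simp
    qed
    define R where "R = (\<Sum>z\<in>A. smult (e z) (lagrange_basis A z))"
    have R: "poly R x = e x" if "x \<in> A" for x
      unfolding R_def by (rule poly_sum_lagrange_basis[OF fA that])
    have degR: "degree R \<le> n"
    proof (cases "A = {}")
      case True then show ?thesis by (simp add: R_def)
    next
      case False
      then show ?thesis using degree_sum_lagrange_basis[OF fA False, of e] cA unfolding R_def by linarith
    qed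
    have "compact (poly R ` S)"
      by (intro compact_continuous_image S continuous_intros)
    then have "bounded (poly R ` S)" by (rule compact_imp_bounded)
    then obtain B where B: "B > 0" "\<And>x. x \<in> S \<Longrightarrow> \<bar>poly R x\<bar> \<le> B"
      unfolding bounded_pos by auto
    have conte: "continuous_on S e" unfolding e_def by (intro continuous_intros S)
    define C where "C = S \<inter> (\<lambda>x. e x * poly R x) -` {..0}"
    have "continuous_on S (\<lambda>x. e x * poly R x)" by (intro continuous_intros conte)
    then have "closed C" unfolding C_def
      by (rule continuous_closed_preimage) (use S in \<open>auto intro: compact_imp_closed\<close>)
    then have cC: "compact C" using compact_Int_closed[OF S(1), of C] by (simp add: C_def Int_absorb1)
    have ltE: "\<bar>e x\<bar> < E" if "x \<in> C" for x
    proof -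
      have "x \<notin> A"
      proof
        assume "x \<in> A"
        then have "e x * e x \<le> 0" "\<bar>e x\<bar> = E" using that R by (auto simp: C_def A_def)
        then show False using E0 by (smt (verit) mult_le_0_iff)
      qed
      then show ?thesis using that eE[of x] by (auto simp: A_def C_def)
    qed
    obtain E' where E': "E' < E" "\<And>x. x \<in> C \<Longrightarrow> \<bar>e x\<bar> \<le> E'"
    proof (cases "C = {}")
      case True then show ?thesis using that[of 0] E0 by auto
    next
      case False
      have "continuous_on C (\<lambda>x. \<bar>e x\<bar>)"
        using conte by (intro continuous_intros) (auto simp: C_def intro: continuous_on_subset)
      from continuous_attains_sup[OF cC False this] show ?thesis using that ltE by blast
    qed
    \<comment> \<open>Adding \<open>d R\<close> must not raise the error above \<open>E\<close> on \<open>C\<close>, where there is a margin \<open>E - E'\<close>,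
      nor overshoot off \<open>C\<close>, where the correction has the sign of the error.\<close>
    define d where "d = min ((E - E') / (2 * B)) (E / (2 * B))"
    have d: "d > 0" using E' E0 B by (simp add: d_def)
    have dB: "d * B < E - E'" "d * B < E"
    proof -
      have "d * B \<le> (E - E') / (2 * B) * B" using B by (intro mult_right_mono) (auto simp: d_def)
      also have "\<dots> < E - E'" using B E' by (simp add: field_simps)
      finally show "d * B < E - E'" .
      have "d * B \<le> E / (2 * B) * B" using B by (intro mult_right_mono) (auto simp: d_def)
      also have "\<dots> < E" using B E0 by (simp add: field_simps)
      finally show "d * B < E" .
    qed
    have lt: "\<bar>f x - poly (M + smult d R) x\<bar> < E" if x: "x \<in> S" for x
    proof -
      have eq: "f x - poly (M + smult d R) x = e x - d * poly R x" by (simp add: e_def)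
      have dR: "\<bar>d * poly R x\<bar> \<le> d * B" using B(2)[OF x] d by (simp add: abs_mult)
      show ?thesis
      proof (cases "x \<in> C")
        case True
        then show ?thesis unfolding eq using E'(2)[OF True] dR dB(1) by linarith
      next
        case False
        then have pos: "e x * poly R x > 0" using x by (auto simp: C_def)
        then have "e x > 0 \<and> d * poly R x > 0 \<or> e x < 0 \<and> d * poly R x < 0"
          using d by (auto simp: zero_less_mult_iff mult_less_0_iff)
        then show ?thesis unfolding eq using eE[OF x] dR dB(2) by linarith
      qed
    qed
    obtain x where "x \<in> S" "\<bar>f x - poly (M + smult d R) x\<bar> = uniform_error S f (M + smult d R)"
      using uniform_error_attained[OF S(1,2) ne] by blast
    moreover have "degree (M + smult d R) \<le> n"
      using degM degR degree_smult_le[of d R] by (intro degree_add_le) auto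
    then have "E \<le> uniform_error S f (M + smult d R)"
      unfolding E_def by (rule min_uniform_error_le[OF S(1,2) ne])
    ultimately show False using lt[of x] by linarith
  qed
  obtain Z where Z: "finite Z" "card Z = Suc n" "Z \<subseteq> A"
  proof (cases "finite A")
    case True
    then have "Suc n \<le> card A" using big by simp
    then show ?thesis using that obtain_subset_with_card_n by metis
  next
    case False
    then show ?thesis using that infinite_arbitrarily_large by metis
  qed
  show ?thesis
    by (rule poly_eq_if_eq_on[OF Z(1)]) (use Z P Q A in auto)
qed

lemma best_approx_poly_best:
  fixes f :: "real \<Rightarrow> real"
  assumes "compact S" "continuous_on S f" "infinite S"
  shows "degree (best_approx_poly S f n) \<le> n"
    and "uniform_error S f (best_approx_poly S f n) = min_uniform_error S f n"
proof -
  have "\<exists>!Q. degree Q \<le> n \<and> uniform_error S f Q = min_uniform_error S f n"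
    using best_approximation_exists[OF assms] best_approximation_unique[OF assms] by blast
  from theI'[OF this]
  show "degree (best_approx_poly S f n) \<le> n"
    and "uniform_error S f (best_approx_poly S f n) = min_uniform_error S f n"
    unfolding best_approx_poly_def by blast+
qed

lemma best_approx_poly_eqI:
  fixes f :: "real \<Rightarrow> real"
  assumes "compact S" "continuous_on S f" "infinite S"
    and "degree Q \<le> n" "uniform_error S f Q = min_uniform_error S f n"
  shows "best_approx_poly S f n = Q"
  using best_approximation_unique[OF assms(1-3) best_approx_poly_best[OF assms(1-3)] assms(4,5)] .

section \<open>Chebyshev polynomials and an equioscillating rational function\<close>

fun chebyshev_T :: "nat \<Rightarrow> real poly" where
  "chebyshev_T 0 = 1"
| "chebyshev_T (Suc 0) = [:0, 1:]"
| "chebyshev_T (Suc (Suc n)) = [:0, 2:] * chebyshev_T (Suc n) - chebyshev_T n"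

lemma degree_chebyshev_T: "degree (chebyshev_T n) \<le> n"
proof (induction n rule: chebyshev_T.induct)
  case (3 n)
  have "degree ([:0, 2:] * chebyshev_T (Suc n)) \<le> degree [:0, 2:: real:] + degree (chebyshev_T (Suc n))"
    by (rule degree_mult_le)
  also have "\<dots> \<le> Suc (Suc n)" using 3 by simp
  finally show ?case using 3 by (simp add: degree_diff_le)
qed auto

lemma poly_chebyshev_T_cos: "poly (chebyshev_T n) (cos t) = cos (real n * t)"
proof (induction n rule: chebyshev_T.induct)
  case (3 n)
  have "cos (real (Suc (Suc n)) * t) + cos (real n * t) = 2 * cos t * cos (real (Suc n) * t)"
    using cos_add[of "real (Suc n) * t" t] cos_diff[of "real (Suc n) * t" t]
    by (simp add: algebra_simps)
  then show ?case using 3 by simp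
qed auto

lemma poly_chebyshev_T_joukowski:
  assumes "w \<noteq> 0"
  shows "poly (chebyshev_T n) ((w + 1 / w) / 2) = (w ^ n + (1 / w) ^ n) / 2"
proof (induction n rule: chebyshev_T.induct)
  case (3 n)
  have e1: "w ^ Suc (Suc n) + (1 / w) ^ Suc (Suc n) + (w ^ n + (1 / w) ^ n)
      = (w + 1 / w) * (w ^ Suc n + (1 / w) ^ Suc n)"
    using assms by (simp add: field_simps)
  have "poly (chebyshev_T (Suc (Suc n))) ((w + 1 / w) / 2)
      = (w + 1 / w) * poly (chebyshev_T (Suc n)) ((w + 1 / w) / 2) - poly (chebyshev_T n) ((w + 1 / w) / 2)"
    by simp
  then show ?case unfolding 3 times_divide_eq_right e1[symmetric]
    by (simp add: add_divide_distrib)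
qed auto

text \<open>Among the polynomials of degree \<open>n\<close> bounded by \<open>M\<close> on \<open>[-1, 1]\<close>, \<open>M T\<^bsub>n\<^esub>\<close> grows fastest. If \<open>D\<close> exceeded
it at \<open>x0 > 1\<close>, subtracting the multiple of \<open>D\<close> that cancels \<open>T\<^bsub>n\<^esub>\<close> at \<open>x0\<close> would leave \<open>n\<close> sign changes
between the extremal points of \<open>T\<^bsub>n\<^esub>\<close> and one more zero at \<open>x0\<close>.\<close>

lemma bernstein_walsh_interval:
  fixes D :: "real poly"
  assumes D: "degree D \<le> n" "\<And>x. x \<in> {-1..1} \<Longrightarrow> \<bar>poly D x\<bar> \<le> M" and w: "1 \<le> w"
  shows "\<bar>poly D ((w + 1 / w) / 2)\<bar> \<le> M * w ^ n"
proof (rule ccontr)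
  define x0 where "x0 = (w + 1 / w) / 2"
  assume "\<not> \<bar>poly D ((w + 1 / w) / 2)\<bar> \<le> M * w ^ n"
  then have gt: "M * w ^ n < \<bar>poly D x0\<bar>" by (simp add: x0_def)
  have M0: "0 \<le> M" using D(2)[of 0] by simp
  have wn: "1 \<le> w ^ n" using w by simp
  have T: "poly (chebyshev_T n) x0 = (w ^ n + (1 / w) ^ n) / 2"
    unfolding x0_def by (rule poly_chebyshev_T_joukowski) (use w in auto)
  have winv: "(1 / w) ^ n \<le> 1" using w by (intro power_le_one) auto
  have Tpos: "0 < poly (chebyshev_T n) x0" unfolding T using wn w by (simp add: add_pos_nonneg)
  have "M * poly (chebyshev_T n) x0 \<le> M * w ^ n" using M0 winv wn unfolding T by (intro mult_left_mono) auto
  then have gt': "M * poly (chebyshev_T n) x0 < \<bar>poly D x0\<bar>" using gt by linarith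
  then have Dnz: "poly D x0 \<noteq> 0" using M0 Tpos by (auto simp: mult_less_0_iff)
  define q where "q = poly (chebyshev_T n) x0 / poly D x0"
  have q: "M * \<bar>q\<bar> < 1" using gt' Dnz Tpos by (simp add: q_def field_simps)
  define G where "G = chebyshev_T n - smult q D"
  have degG: "degree G \<le> n" unfolding G_def
    using degree_chebyshev_T D(1) degree_smult_le[of q D] by (intro degree_diff_le) auto
  have G0: "poly G x0 = 0" using Dnz by (simp add: G_def q_def)
  define x where "x j = cos (real (n - j) * pi / n)" for j
  have incr: "x j < x (Suc j)" if "j < n" for j
  proof -
    have "real (n - j) * pi \<le> real n * pi" by (intro mult_right_mono) auto
    then have le: "real (n - j) * pi / n \<le> pi" using that by (simp add: field_simps)
    have less: "real (n - Suc j) * pi / n < real (n - j) * pi / n"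
      using that by (intro divide_strict_right_mono mult_strict_right_mono) auto
    show ?thesis unfolding x_def by (rule cos_monotone_0_pi[OF _ less le]) simp
  qed
  have alt: "(-1) ^ j * poly (smult ((-1) ^ n) G) (x j) > 0" if j: "j \<le> n" for j
  proof -
    have "poly (chebyshev_T n) (x j) = (-1) ^ (n - j)"
    proof (cases "n = 0")
      case False
      then show ?thesis unfolding x_def poly_chebyshev_T_cos using cos_npi[of "n - j"] by simp
    qed auto
    then have "(-1) ^ j * (-1) ^ n * poly (chebyshev_T n) (x j) = 1"
    proof -
      have "(-1::real) ^ j * (-1) ^ n * (-1) ^ (n - j) = (-1) ^ (j + n + (n - j))"
        by (simp only: power_add)
      also have "j + n + (n - j) = 2 * n" using j by simp
      finally show ?thesis unfolding \<open>poly (chebyshev_T n) (x j) = (-1) ^ (n - j)\<close> by simp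
    qed
    moreover have "\<bar>q * poly D (x j)\<bar> < 1"
    proof -
      have "\<bar>poly D (x j)\<bar> \<le> M" by (rule D(2)) (simp add: x_def)
      then have "\<bar>q * poly D (x j)\<bar> \<le> M * \<bar>q\<bar>"
        using mult_left_mono[of "\<bar>poly D (x j)\<bar>" M "\<bar>q\<bar>"] by (simp add: abs_mult mult.commute)
      then show ?thesis using q by linarith
    qed
    moreover have "\<bar>(-1) ^ j * (-1) ^ n * (q * poly D (x j))\<bar> = \<bar>q * poly D (x j)\<bar>"
      by (simp add: abs_mult)
    moreover have "(-1) ^ j * poly (smult ((-1) ^ n) G) (x j)
        = (-1) ^ j * (-1) ^ n * poly (chebyshev_T n) (x j) - (-1) ^ j * (-1) ^ n * (q * poly D (x j))"
      by (simp add: G_def algebra_simps)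
    ultimately show ?thesis by linarith
  qed
  have "\<exists>Z. finite Z \<and> card Z = n \<and> (\<forall>z\<in>Z. x 0 < z \<and> z < x n \<and> poly (smult ((-1) ^ n) G) z = 0)"
    using incr alt by (rule sign_changes_imp_roots)
  then obtain Z where Z: "finite Z" "card Z = n" "\<forall>z\<in>Z. z < x n \<and> poly G z = 0"
    by auto
  have "x0 \<ge> 1"
  proof -
    have "0 \<le> (w - 1)\<^sup>2 / w" using w by simp
    also have "(w - 1)\<^sup>2 / w = w + 1 / w - 2" using w by (simp add: power2_eq_square field_simps)
    finally show ?thesis by (simp add: x0_def)
  qed
  moreover have "x n \<le> 1" by (simp add: x_def)
  ultimately have "x0 \<notin> Z" using Z(3) by force
  then have card: "card (insert x0 Z) = Suc n" using Z by simp
  have "G = 0"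
    by (rule poly_eq_if_eq_on[of "insert x0 Z"]) (use Z card degG G0 in auto)
  then show False using alt[of 0] by simp
qed

text \<open>The numerator in the error of best approximation to \<open>1 / (x - c)\<close>, where \<open>c = (\<rho> + 1 / \<rho>) / 2\<close>. The
truncated index \<open>m - 1\<close> makes it meaningful for \<open>m \<ge> 1\<close> only.\<close>

definition alt_poly :: "real \<Rightarrow> nat \<Rightarrow> real poly" where
  "alt_poly \<rho> m = chebyshev_T (Suc m) - smult (2 * \<rho>) (chebyshev_T m) + smult (\<rho>\<^sup>2) (chebyshev_T (m - 1))"

text \<open>A continuous argument of \<open>v ^ (m + 1) (1 - \<rho> / v) / (1 - \<rho> v)\<close> at \<open>v = exp (\<i> \<theta>)\<close>, a power times a Blaschke
factor.\<close>

definition alt_phase :: "real \<Rightarrow> nat \<Rightarrow> real \<Rightarrow> real" where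
  "alt_phase \<rho> m \<theta> = real (Suc m) * \<theta> + 2 * arctan (\<rho> * sin \<theta> / (1 - \<rho> * cos \<theta>))"

lemma degree_alt_poly: "degree (alt_poly \<rho> m) \<le> Suc m"
  unfolding alt_poly_def
  using degree_chebyshev_T[of "Suc m"] degree_chebyshev_T[of m] degree_chebyshev_T[of "m - 1"]
    degree_smult_le[of "2 * \<rho>" "chebyshev_T m"] degree_smult_le[of "\<rho>\<^sup>2" "chebyshev_T (m - 1)"]
  by (intro degree_add_le degree_diff_le) auto

lemma rho_cos_less: "0 < \<rho> \<Longrightarrow> \<rho> < 1 \<Longrightarrow> \<rho> * cos \<theta> < (1::real)"
  using mult_left_mono[OF cos_le_one, of \<rho> \<theta>] by linarith

text \<open>With \<open>v = exp (\<i> \<theta>)\<close> the left side is the real part of \<open>v ^ (m + 1) (1 - \<rho> / v)\<^sup>2\<close>, a number of modulus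
\<open>\<bar>1 - \<rho> / v\<bar>\<^sup>2 = 1 - 2 \<rho> cos \<theta> + \<rho>\<^sup>2\<close>. The proof does this computation in real terms, writing
\<open>1 - \<rho> / v = u + \<i> s\<close> with argument \<open>A\<close>.\<close>

lemma poly_alt_poly_cos:
  assumes \<rho>: "0 < \<rho>" "\<rho> < 1" and m: "1 \<le> m"
  shows "poly (alt_poly \<rho> m) (cos \<theta>) = (1 - 2 * \<rho> * cos \<theta> + \<rho>\<^sup>2) * cos (alt_phase \<rho> m \<theta>)"
proof -
  define u s where "u = 1 - \<rho> * cos \<theta>" and "s = \<rho> * sin \<theta>"
  define C S where "C = cos (real (Suc m) * \<theta>)" and "S = sin (real (Suc m) * \<theta>)"
  define A where "A = arctan (s / u)"
  have u: "u > 0" using rho_cos_less[OF \<rho>] by (simp add: u_def)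
  then have nz: "u\<^sup>2 + s\<^sup>2 > 0" by (simp add: add_pos_nonneg)
  have sc: "(sin \<theta>)\<^sup>2 = 1 - (cos \<theta>)\<^sup>2" by (simp add: sin_squared_eq)
  have us: "u\<^sup>2 + s\<^sup>2 = 1 - 2 * \<rho> * cos \<theta> + \<rho>\<^sup>2"
    by (simp add: u_def s_def power2_diff power_mult_distrib sc algebra_simps)
  have q: "1 + (s / u)\<^sup>2 = (u\<^sup>2 + s\<^sup>2) / u\<^sup>2" using u by (simp add: field_simps)
  have cosA: "(cos A)\<^sup>2 = u\<^sup>2 / (u\<^sup>2 + s\<^sup>2)"
  proof -
    have "(cos A)\<^sup>2 = 1 / (1 + (s / u)\<^sup>2)"
      unfolding A_def cos_arctan power_divide[of _ "sqrt _"] by (simp add: add_nonneg_nonneg)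
    then show ?thesis unfolding q using nz u by (simp add: field_simps)
  qed
  have sinA: "(sin A)\<^sup>2 = s\<^sup>2 / (u\<^sup>2 + s\<^sup>2)"
  proof -
    have "(sin A)\<^sup>2 = (s / u)\<^sup>2 / (1 + (s / u)\<^sup>2)"
      unfolding A_def sin_arctan power_divide[of _ "sqrt _"] by (simp add: add_nonneg_nonneg)
    then show ?thesis unfolding q using nz u by (simp add: field_simps)
  qed
  have tanA: "sin A = s / u * cos A"
    by (simp add: A_def sin_arctan cos_arctan)
  have c2: "(u\<^sup>2 + s\<^sup>2) * cos (2 * A) = u\<^sup>2 - s\<^sup>2"
    unfolding cos_double cosA sinA using nz by (simp flip: diff_divide_distrib)
  have "2 * sin A * cos A = 2 * (s / u) * (cos A)\<^sup>2"
    by (simp add: tanA power2_eq_square)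
  then have s2: "(u\<^sup>2 + s\<^sup>2) * sin (2 * A) = 2 * u * s"
    using nz u unfolding sin_double cosA by (simp add: field_simps power2_eq_square)
  have "(1 - 2 * \<rho> * cos \<theta> + \<rho>\<^sup>2) * cos (alt_phase \<rho> m \<theta>) = (u\<^sup>2 + s\<^sup>2) * cos (real (Suc m) * \<theta> + 2 * A)"
    unfolding us by (simp add: alt_phase_def A_def u_def s_def)
  also have "\<dots> = C * ((u\<^sup>2 + s\<^sup>2) * cos (2 * A)) - S * ((u\<^sup>2 + s\<^sup>2) * sin (2 * A))"
    unfolding cos_add C_def[symmetric] S_def[symmetric] by (simp add: algebra_simps)
  also have "\<dots> = C * (u\<^sup>2 - s\<^sup>2) - S * (2 * u * s)" by (simp only: c2 s2)
  also have "\<dots> = C - 2 * \<rho> * (C * cos \<theta> + S * sin \<theta>) + \<rho>\<^sup>2 * (C * cos (2 * \<theta>) + S * sin (2 * \<theta>))"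
    unfolding u_def s_def cos_double sin_double by (simp add: power2_eq_square algebra_simps)
  also have "C * cos \<theta> + S * sin \<theta> = cos (real m * \<theta>)"
    using cos_diff[of "real (Suc m) * \<theta>" \<theta>] by (simp add: C_def S_def algebra_simps)
  also have "C * cos (2 * \<theta>) + S * sin (2 * \<theta>) = cos (real (m - 1) * \<theta>)"
    using cos_diff[of "real (Suc m) * \<theta>" "2 * \<theta>"] m by (simp add: C_def S_def algebra_simps of_nat_diff)
  finally show ?thesis
    by (simp add: alt_poly_def poly_chebyshev_T_cos C_def del: chebyshev_T.simps)
qed

lemma poly_alt_poly_joukowski:
  assumes w: "w \<noteq> 0" and m: "1 \<le> m"
  shows "poly (alt_poly \<rho> m) ((w + 1 / w) / 2)
     = (w ^ Suc m * (1 - \<rho> / w)\<^sup>2 + (1 / w) ^ Suc m * (1 - \<rho> * w)\<^sup>2) / 2"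
proof -
  obtain k where k: "m = Suc k" using m by (cases m) auto
  show ?thesis unfolding alt_poly_def poly_add poly_diff poly_smult poly_chebyshev_T_joukowski[OF w] k
    using w by (simp add: power2_eq_square field_simps)
qed

text \<open>The angles are chosen one after another by the intermediate value theorem, which gives their order
for free.\<close>

lemma alternation_angles:
  assumes \<rho>: "0 < \<rho>" "\<rho> < 1"
  shows "\<exists>\<theta>::nat \<Rightarrow> real. (\<forall>j\<le>Suc m. 0 \<le> \<theta> j \<and> \<theta> j \<le> pi \<and> alt_phase \<rho> m (\<theta> j) = real j * pi)
      \<and> (\<forall>j\<le>m. \<theta> j < \<theta> (Suc j))"
proof -
  have nz: "1 - \<rho> * cos t \<noteq> 0" for t using rho_cos_less[OF \<rho>, of t] by simp
  have cont: "continuous_on A (alt_phase \<rho> m)" for A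
    unfolding alt_phase_def by (intro continuous_intros) (use nz in auto)
  have "\<exists>\<theta>::nat \<Rightarrow> real. \<forall>j. (j \<le> Suc m \<longrightarrow> 0 \<le> \<theta> j \<and> \<theta> j \<le> pi \<and> alt_phase \<rho> m (\<theta> j) = real j * pi)
      \<and> (j \<le> m \<longrightarrow> \<theta> j < \<theta> (Suc j))"
  proof (rule dependent_nat_choice)
    show "\<exists>x. 0 \<le> Suc m \<longrightarrow> 0 \<le> x \<and> x \<le> pi \<and> alt_phase \<rho> m x = real 0 * pi"
      by (rule exI[of _ 0]) (simp add: alt_phase_def)
  next
    fix x j
    assume x: "j \<le> Suc m \<longrightarrow> 0 \<le> x \<and> x \<le> pi \<and> alt_phase \<rho> m x = real j * pi"
    show "\<exists>y. (Suc j \<le> Suc m \<longrightarrow> 0 \<le> y \<and> y \<le> pi \<and> alt_phase \<rho> m y = real (Suc j) * pi)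
        \<and> (j \<le> m \<longrightarrow> x < y)"
    proof (cases "j \<le> m")
      case True
      have "alt_phase \<rho> m pi = real (Suc m) * pi" by (simp add: alt_phase_def)
      moreover have "real (Suc j) * pi \<le> real (Suc m) * pi"
        using True by (intro mult_right_mono) auto
      moreover have "real j * pi \<le> real (Suc j) * pi" by simp
      ultimately obtain y where y: "x \<le> y" "y \<le> pi" "alt_phase \<rho> m y = real (Suc j) * pi"
        using IVT'[of "alt_phase \<rho> m" x "real (Suc j) * pi" pi] x True cont by auto
      have "x \<noteq> y" using y(3) x True by auto
      then show ?thesis using y x True by (intro exI[of _ y]) auto
    qed auto
  qed
  then show ?thesis by blast
qed

section \<open>Transplantation to the interval between a squared and 1\<close>

lemma sq_less_one: "0 < a \<Longrightarrow> a < 1 \<Longrightarrow> a\<^sup>2 < (1::real)"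
  using power_strict_mono[of a 1 2] by simp

text \<open>Maps \<open>[a\<^sup>2, 1]\<close> onto \<open>[-1, 1]\<close>, reversing the orientation, and \<open>0\<close> to the pole
\<open>c = (1 + a\<^sup>2) / (1 - a\<^sup>2)\<close> belonging to \<open>\<rho> = (1 - a) / (1 + a)\<close>.\<close>

definition ivl_map :: "real \<Rightarrow> real poly" where
  "ivl_map a = [:(1 + a\<^sup>2) / (1 - a\<^sup>2), - 2 / (1 - a\<^sup>2):]"

text \<open>The conformal map of the exterior of \<open>[a\<^sup>2, 1]\<close> onto the exterior of the unit disc, on the real
half-line to the left of the interval.\<close>

definition outer_map :: "real \<Rightarrow> real \<Rightarrow> real" where
  "outer_map a y = (sqrt (1 - y) + sqrt (a\<^sup>2 - y))\<^sup>2 / (1 - a\<^sup>2)"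

definition node_poly :: "real \<Rightarrow> nat \<Rightarrow> real poly" where
  "node_poly a m = pcompose (alt_poly ((1 - a) / (1 + a)) m) (ivl_map a)"

lemma poly_ivl_map: "poly (ivl_map a) y = (1 + a\<^sup>2 - 2 * y) / (1 - a\<^sup>2)"
  by (simp add: ivl_map_def diff_divide_distrib)

lemma degree_node_poly: "degree (node_poly a m) \<le> Suc m"
proof -
  have "degree (node_poly a m) \<le> degree (alt_poly ((1 - a) / (1 + a)) m) * degree (ivl_map a)"
    unfolding node_poly_def by (rule degree_pcompose_le)
  also have "\<dots> \<le> Suc m * 1"
    by (intro mult_le_mono degree_alt_poly) (simp add: ivl_map_def)
  finally show ?thesis by simp
qed

lemma outer_map_ivl_map:
  fixes a :: real
  assumes a: "0 < a" "a < 1" and y: "y \<le> a\<^sup>2"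
  shows "(outer_map a y + 1 / outer_map a y) / 2 = poly (ivl_map a) y"
    and "1 \<le> outer_map a y"
proof -
  have a2: "a\<^sup>2 < 1" by (rule sq_less_one[OF a])
  define p q where "p = sqrt (1 - y)" and "q = sqrt (a\<^sup>2 - y)"
  have sq: "p\<^sup>2 = 1 - y" "q\<^sup>2 = a\<^sup>2 - y" using y a2 by (auto simp: p_def q_def)
  have p: "p > 0" and q: "q \<ge> 0" using y a2 by (auto simp: p_def q_def)
  have "(p + q) * (p - q) = 1 - a\<^sup>2" using sq by (simp add: power2_eq_square algebra_simps)
  then have "(p + q)\<^sup>2 * (p - q)\<^sup>2 = (1 - a\<^sup>2)\<^sup>2" by (metis power_mult_distrib)
  then have inv: "1 / outer_map a y = (p - q)\<^sup>2 / (1 - a\<^sup>2)"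
    using a2 p q unfolding outer_map_def p_def[symmetric] q_def[symmetric]
    by (simp add: frac_eq_eq mult.commute power2_eq_square[of "1 - a\<^sup>2"])
  have "outer_map a y + 1 / outer_map a y = ((p + q)\<^sup>2 + (p - q)\<^sup>2) / (1 - a\<^sup>2)"
    unfolding inv by (simp add: outer_map_def p_def q_def add_divide_distrib)
  also have "(p + q)\<^sup>2 + (p - q)\<^sup>2 = 2 * (p\<^sup>2 + q\<^sup>2)" by (simp add: power2_eq_square algebra_simps)
  also have "2 * (p\<^sup>2 + q\<^sup>2) / (1 - a\<^sup>2) = 2 * poly (ivl_map a) y"
    unfolding sq poly_ivl_map by (simp add: algebra_simps)
  finally show "(outer_map a y + 1 / outer_map a y) / 2 = poly (ivl_map a) y" by simp
  have "1 - a\<^sup>2 \<le> (p + q)\<^sup>2"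
  proof -
    have "1 - a\<^sup>2 \<le> p\<^sup>2" using sq y by simp
    also have "\<dots> \<le> (p + q)\<^sup>2" using p q by (intro power_mono) auto
    finally show ?thesis .
  qed
  then show "1 \<le> outer_map a y" using a2 by (simp add: outer_map_def p_def q_def)
qed

lemma outer_map_0:
  fixes a :: real
  assumes a: "0 < a" "a < 1"
  shows "outer_map a 0 = (1 + a) / (1 - a)"
proof -
  have "1 - a\<^sup>2 = (1 + a) * (1 - a)" by (simp add: power2_eq_square algebra_simps)
  then show ?thesis using a by (simp add: outer_map_def power2_eq_square)
qed

lemma outer_map_antimono:
  fixes a :: real
  assumes "a < 1" "0 < a" "y \<le> z" "z \<le> a\<^sup>2"
  shows "outer_map a z \<le> outer_map a y"
proof -
  have a2: "a\<^sup>2 < 1" using assms sq_less_one by blast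
  have "sqrt (1 - z) + sqrt (a\<^sup>2 - z) \<le> sqrt (1 - y) + sqrt (a\<^sup>2 - y)"
    using assms by (intro add_mono) auto
  then show ?thesis unfolding outer_map_def using a2 assms
    by (intro divide_right_mono power_mono) auto
qed

lemma bernstein_walsh_gap:
  fixes a :: real
  assumes a: "0 < a" "a < 1" and D: "degree D \<le> n" "\<And>y. y \<in> {a\<^sup>2..1} \<Longrightarrow> \<bar>poly D y\<bar> \<le> M"
    and y: "0 \<le> y" "y \<le> a\<^sup>2"
  shows "\<bar>poly D y\<bar> \<le> M * ((1 + a) / (1 - a)) ^ n"
proof -
  have a2: "a\<^sup>2 < 1" using a by (rule sq_less_one)
  define A where "A = [:(1 + a\<^sup>2) / 2, - (1 - a\<^sup>2) / 2:]"
  define w where "w = outer_map a y"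
  have w: "(w + 1 / w) / 2 = poly (ivl_map a) y" "1 \<le> w"
    using outer_map_ivl_map[OF a y(2)] by (simp_all add: w_def)
  have M: "0 \<le> M" using D(2)[of 1] a2 by simp
  have "degree (pcompose D A) \<le> degree D * degree A" by (rule degree_pcompose_le)
  also have "\<dots> \<le> n * 1" using D(1) by (intro mult_le_mono) (auto simp: A_def)
  finally have deg: "degree (pcompose D A) \<le> n" by simp
  have "\<bar>poly (pcompose D A) x\<bar> \<le> M" if "x \<in> {-1..1}" for x
  proof -
    have "(1 - a\<^sup>2) * x \<le> (1 - a\<^sup>2) * 1" "(1 - a\<^sup>2) * (-1) \<le> (1 - a\<^sup>2) * x"
      using that a2 by (intro mult_left_mono; simp)+
    then have "poly A x \<in> {a\<^sup>2..1}" by (simp add: A_def field_simps)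
    then show ?thesis using D(2) by (simp add: poly_pcompose)
  qed
  from bernstein_walsh_interval[OF deg this w(2)]
  have "\<bar>poly D (poly A (poly (ivl_map a) y))\<bar> \<le> M * w ^ n"
    by (simp add: poly_pcompose w(1))
  also have "poly A (poly (ivl_map a) y) = y"
    using a2 by (simp add: A_def poly_ivl_map field_simps)
  also have "M * w ^ n \<le> M * ((1 + a) / (1 - a)) ^ n"
    using outer_map_antimono[OF a(2,1) y] w(2) M unfolding outer_map_0[OF a] w_def
    by (intro mult_left_mono power_mono) auto
  finally show ?thesis .
qed

text \<open>For the pole at \<open>0\<close> the factor \<open>1 - 2 \<rho> cos \<theta> + \<rho>\<^sup>2\<close> becomes a multiple of \<open>y\<close>, so the quotient by \<open>y\<close>
is a pure cosine.\<close>

lemma poly_node_poly_cos: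
  fixes a :: real
  assumes a: "0 < a" "a < 1" and m: "1 \<le> m" and y: "y = (1 + a\<^sup>2 - (1 - a\<^sup>2) * cos \<theta>) / 2"
  shows "poly (node_poly a m) y = 4 * y / (1 + a)\<^sup>2 * cos (alt_phase ((1 - a) / (1 + a)) m \<theta>)"
proof -
  define \<rho> where "\<rho> = (1 - a) / (1 + a)"
  have a2: "a\<^sup>2 < 1" by (rule sq_less_one[OF a])
  have \<rho>: "0 < \<rho>" "\<rho> < 1" using a by (auto simp: \<rho>_def)
  have "1 + a\<^sup>2 - 2 * y = (1 - a\<^sup>2) * cos \<theta>" by (simp add: y field_simps)
  then have "poly (ivl_map a) y = cos \<theta>" using a2 by (simp add: poly_ivl_map)
  moreover have "1 - 2 * \<rho> * cos \<theta> + \<rho>\<^sup>2 = 4 * y / (1 + a)\<^sup>2"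
  proof -
    have "\<rho> * (1 + a) = 1 - a" using a by (simp add: \<rho>_def)
    then have "(1 - 2 * \<rho> * cos \<theta> + \<rho>\<^sup>2) * (1 + a)\<^sup>2 = (1 + a)\<^sup>2 - 2 * (1 - a) * (1 + a) * cos \<theta> + (1 - a)\<^sup>2"
      by (simp add: power2_eq_square algebra_simps) algebra
    also have "\<dots> = 4 * y" by (simp add: y power2_eq_square algebra_simps)
    finally show ?thesis using a by (simp add: field_simps)
  qed
  ultimately show ?thesis
    using poly_alt_poly_cos[OF \<rho> m, of \<theta>] by (simp add: node_poly_def poly_pcompose \<rho>_def)
qed

lemma abs_node_poly_le:
  fixes a :: real
  assumes a: "0 < a" "a < 1" and m: "1 \<le> m" and y: "y \<in> {a\<^sup>2..1}"
  shows "\<bar>poly (node_poly a m) y\<bar> \<le> 4 * y / (1 + a)\<^sup>2"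
proof -
  have a2: "a\<^sup>2 < 1" by (rule sq_less_one[OF a])
  define x where "x = (1 + a\<^sup>2 - 2 * y) / (1 - a\<^sup>2)"
  have "-1 \<le> x" "x \<le> 1" using y a2 by (auto simp: x_def field_simps)
  then have "y = (1 + a\<^sup>2 - (1 - a\<^sup>2) * cos (arccos x)) / 2"
    using a2 by (simp add: x_def field_simps)
  from poly_node_poly_cos[OF a m this]
  have "\<bar>poly (node_poly a m) y\<bar> = 4 * y / (1 + a)\<^sup>2 * \<bar>cos (alt_phase ((1 - a) / (1 + a)) m (arccos x))\<bar>"
    using order_trans[OF zero_le_power2, of a y] y by (simp add: abs_mult)
  also have "\<dots> \<le> 4 * y / (1 + a)\<^sup>2 * 1"
    using y order_trans[OF zero_le_power2, of a y] by (intro mult_left_mono) auto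
  finally show ?thesis by simp
qed

lemma node_poly_alternates:
  fixes a :: real
  assumes a: "0 < a" "a < 1" and m: "1 \<le> m"
  shows "\<exists>y::nat \<Rightarrow> real. (\<forall>j\<le>Suc m. y j \<in> {a\<^sup>2..1} \<and>
      poly (node_poly a m) (y j) = (-1) ^ j * (4 * y j / (1 + a)\<^sup>2)) \<and> (\<forall>j<Suc m. y j < y (Suc j))"
proof -
  have a2: "a\<^sup>2 < 1" by (rule sq_less_one[OF a])
  have \<rho>: "0 < (1 - a) / (1 + a)" "(1 - a) / (1 + a) < 1" using a by auto
  obtain \<theta> :: "nat \<Rightarrow> real" where \<theta>: "\<And>j. j \<le> Suc m \<Longrightarrow> 0 \<le> \<theta> j \<and> \<theta> j \<le> pi \<and>
      alt_phase ((1 - a) / (1 + a)) m (\<theta> j) = real j * pi" "\<And>j. j \<le> m \<Longrightarrow> \<theta> j < \<theta> (Suc j)"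
    using alternation_angles[OF \<rho>, of m] by auto
  define y where "y j = (1 + a\<^sup>2 - (1 - a\<^sup>2) * cos (\<theta> j)) / 2" for j
  show ?thesis
  proof (intro exI[of _ y] conjI allI impI)
    fix j assume j: "j \<le> Suc m"
    have "(1 - a\<^sup>2) * cos (\<theta> j) \<le> (1 - a\<^sup>2) * 1" "(1 - a\<^sup>2) * (-1) \<le> (1 - a\<^sup>2) * cos (\<theta> j)"
      using a2 by (intro mult_left_mono; simp)+
    then show "y j \<in> {a\<^sup>2..1}" by (simp add: y_def)
    show "poly (node_poly a m) (y j) = (-1) ^ j * (4 * y j / (1 + a)\<^sup>2)"
      using poly_node_poly_cos[OF a m y_def] \<theta>(1)[OF j] by (simp add: cos_npi)
  next
    fix j assume j: "j < Suc m"
    have "cos (\<theta> (Suc j)) < cos (\<theta> j)"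
      using \<theta>(1)[of j] \<theta>(1)[of "Suc j"] \<theta>(2)[of j] j by (intro cos_monotone_0_pi) auto
    then show "y j < y (Suc j)" using a2 by (simp add: y_def)
  qed
qed

lemma node_poly_nodes:
  fixes a :: real
  assumes a: "0 < a" "a < 1" and m: "1 \<le> m"
  shows "\<exists>Z. finite Z \<and> card Z = Suc m \<and> (\<forall>z\<in>Z. 0 < z \<and> poly (node_poly a m) z = 0)"
proof -
  obtain y :: "nat \<Rightarrow> real" where y: "\<And>j. j \<le> Suc m \<Longrightarrow> y j \<in> {a\<^sup>2..1} \<and>
      poly (node_poly a m) (y j) = (-1) ^ j * (4 * y j / (1 + a)\<^sup>2)" "\<And>j. j < Suc m \<Longrightarrow> y j < y (Suc j)"
    using node_poly_alternates[OF assms] by blast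
  have pos: "0 < y j" if "j \<le> Suc m" for j
    using y(1)[OF that] a by (simp add: less_le_trans[of 0 "a\<^sup>2"])
  have "(-1) ^ j * poly (node_poly a m) (y j) > 0" if "j \<le> Suc m" for j
    using y(1)[OF that] pos[OF that] a by (simp flip: power_add)
  with y(2) have "\<exists>Z. finite Z \<and> card Z = Suc m \<and>
      (\<forall>z\<in>Z. y 0 < z \<and> z < y (Suc m) \<and> poly (node_poly a m) z = 0)"
    by (rule sign_changes_imp_roots)
  then show ?thesis using pos[of 0] by (meson le0 less_trans)
qed

lemma poly_node_poly_outer:
  fixes a :: real
  assumes a: "0 < a" "a < 1" and m: "1 \<le> m" and y: "y \<le> a\<^sup>2"
  shows "poly (node_poly a m) y = (outer_map a y ^ Suc m * (1 - (1 - a) / (1 + a) / outer_map a y)\<^sup>2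
      + (1 / outer_map a y) ^ Suc m * (1 - (1 - a) / (1 + a) * outer_map a y)\<^sup>2) / 2"
proof -
  have "outer_map a y \<noteq> 0" using outer_map_ivl_map(2)[OF a y] by linarith
  from poly_alt_poly_joukowski[OF this m] show ?thesis
    by (simp add: node_poly_def poly_pcompose outer_map_ivl_map(1)[OF a y])
qed

section \<open>Stieltjes representation of powers and of their interpolation error\<close>

text \<open>Transfers results obtained by change of variables for the gauge integral back to Borel-Lebesgue
set integrals.\<close>

lemma set_integrable_lborel_if_absolutely_integrable:
  fixes f :: "real \<Rightarrow> real"
  assumes "f absolutely_integrable_on S" "S \<in> sets borel" "f \<in> borel_measurable borel"
  shows "set_integrable lborel S f" "(LINT x:S|lborel. f x) = integral S f"
proof -
  show 1: "set_integrable lborel S f"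
    using assms unfolding set_integrable_def
    by (subst (asm) integrable_completion) auto
  then show "(LINT x:S|lborel. f x) = integral S f"
    by (rule set_borel_integral_eq_integral)
qed

lemma Gamma_reflection_real: "Gamma s * Gamma (1 - s) = pi / sin (pi * s)" for s :: real
proof -
  have "Gamma (1 - complex_of_real s) = complex_of_real (Gamma (1 - s))"
    by (metis Gamma_complex_of_real of_real_1 of_real_diff)
  then have "complex_of_real (Gamma s * Gamma (1 - s)) = complex_of_real (pi / sin (pi * s))"
    using Gamma_reflection_complex[of "complex_of_real s"]
    by (simp add: Gamma_complex_of_real sin_of_real flip: of_real_mult)
  then show ?thesis by (rule of_real_eq_iff[THEN iffD1])
qed

text \<open>The substitution \<open>u = \<mu>\<^sup>2 / (1 + \<mu>\<^sup>2)\<close> turns the Beta integral for \<open>(s, 1 - s)\<close> into this one, and the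
reflection formula evaluates it.\<close>

lemma stieltjes_kernel_integral:
  assumes s: "0 < s" "s < (1::real)"
  shows "set_integrable lborel {0<..} (\<lambda>\<mu>. 2 * \<mu> powr (2 * s - 1) / (1 + \<mu>\<^sup>2))"
    and "(LINT \<mu>:{0<..}|lborel. 2 * \<mu> powr (2 * s - 1) / (1 + \<mu>\<^sup>2)) = pi / sin (pi * s)"
proof -
  define f where "f u = u powr (s - 1) * (1 - u) powr ((1 - s) - 1)" for u :: real
  define g where "g \<mu> = \<mu>\<^sup>2 / (1 + \<mu>\<^sup>2)" for \<mu> :: real
  define g' where "g' \<mu> = 2 * \<mu> / (1 + \<mu>\<^sup>2)\<^sup>2" for \<mu> :: real
  have pos: "1 + \<mu>\<^sup>2 > (0::real)" for \<mu> :: real by (simp add: add_pos_nonneg)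
  have der: "(g has_field_derivative g' x) (at x within {0<..})" for x
  proof -
    have "((\<lambda>\<mu>. \<mu>\<^sup>2) has_field_derivative 2 * x) (at x within {0<..})"
      and "((\<lambda>\<mu>. 1 + \<mu>\<^sup>2) has_field_derivative 2 * x) (at x within {0<..})"
      by (auto intro!: derivative_eq_intros)
    then have "(g has_field_derivative (2 * x * (1 + x\<^sup>2) - x\<^sup>2 * (2 * x)) / ((1 + x\<^sup>2) * (1 + x\<^sup>2)))
        (at x within {0<..})"
      unfolding g_def using pos[of x] by (intro DERIV_divide) auto
    moreover have "2 * x * (1 + x\<^sup>2) - x\<^sup>2 * (2 * x) = 2 * x" by (simp add: algebra_simps)
    ultimately show ?thesis by (simp add: g'_def power2_eq_square)
  qed
  have g1: "1 - g x = 1 / (1 + x\<^sup>2)" for x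
  proof -
    have "1 + x\<^sup>2 \<noteq> 0" using pos[of x] by linarith
    then have "1 - g x = ((1 + x\<^sup>2) - x\<^sup>2) / (1 + x\<^sup>2)" unfolding g_def diff_divide_distrib by simp
    then show ?thesis by simp
  qed
  have inj: "inj_on g {0<..}"
  proof (rule inj_onI)
    fix x y :: real assume xy: "x \<in> {0<..}" "y \<in> {0<..}" "g x = g y"
    have "1 / (1 + x\<^sup>2) = 1 / (1 + y\<^sup>2)" by (simp only: g1[symmetric] xy(3))
    then have "inverse (1 + x\<^sup>2) = inverse (1 + y\<^sup>2)" by (simp only: inverse_eq_divide)
    then have "1 + x\<^sup>2 = 1 + y\<^sup>2" by (rule inverse_eq_imp_eq)
    then have "x\<^sup>2 = y\<^sup>2" by simp
    then show "x = y" using xy by (simp add: power2_eq_iff_nonneg)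
  qed
  have img: "g ` {0<..} = {0<..<1}"
  proof
    show "g ` {0<..} \<subseteq> {0<..<1}"
    proof (rule image_subsetI)
      fix x :: real assume "x \<in> {0<..}"
      then have "g x > 0" using pos[of x] by (simp add: g_def)
      moreover have "1 - g x > 0" unfolding g1 using pos[of x] by simp
      ultimately show "g x \<in> {0<..<1}" by simp
    qed
    show "{0<..<1} \<subseteq> g ` {0<..}"
    proof
      fix u :: real assume u: "u \<in> {0<..<1}"
      then have "u = g (sqrt (u / (1 - u)))" by (simp add: g_def field_simps)
      moreover have "sqrt (u / (1 - u)) \<in> {0<..}" using u by simp
      ultimately show "u \<in> g ` {0<..}" by blast
    qed
  qed
  have meas: "f \<in> borel_measurable borel" unfolding f_def by measurable
  have "set_integrable lborel {0..1} f" unfolding f_def using s by (intro integrable_Beta) auto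
  then have "f absolutely_integrable_on {0..1}"
    unfolding set_integrable_def using meas by (subst integrable_completion) auto
  then have abs: "f absolutely_integrable_on {0<..<1}"
    by (rule set_integrable_subset) auto
  have "(f has_integral Beta s (1 - s)) {0..1}"
    unfolding f_def using s by (intro has_integral_Beta_real) auto
  then have "(f has_integral Beta s (1 - s)) {0<..<1}" by (simp add: has_integral_Icc_iff_Ioo)
  then have int: "integral {0<..<1} f = pi / sin (pi * s)"
    by (simp add: integral_unique Beta_def Gamma_reflection_real)
  have eq: "\<bar>g' x\<bar> * f (g x) = 2 * x powr (2 * s - 1) / (1 + x\<^sup>2)" if x: "x \<in> {0<..}" for x
  proof -
    have x0: "x > 0" using x by simp
    define q where "q = 1 + x\<^sup>2"
    have q: "q > 0" using pos by (simp add: q_def)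
    have "f (g x) = (x\<^sup>2 / q) powr (s - 1) * (1 / q) powr (- s)"
      unfolding f_def g1 by (simp add: g_def q_def)
    also have "\<dots> = ((x powr 2) powr (s - 1) / q powr (s - 1)) * q powr s"
      using x0 q by (simp add: powr_divide powr_minus_divide powr_realpow)
    also have "\<dots> = x powr (2 * s - 2) * q"
      using q by (simp add: powr_powr powr_diff algebra_simps)
    finally have "\<bar>g' x\<bar> * f (g x) = 2 * (x powr 1 * x powr (2 * s - 2)) * q / q\<^sup>2"
      using x0 q by (simp add: g'_def q_def)
    also have "x powr 1 * x powr (2 * s - 2) = x powr (2 * s - 1)"
      unfolding powr_add[symmetric] by simp
    also have "2 * x powr (2 * s - 1) * q / q\<^sup>2 = 2 * x powr (2 * s - 1) / q"
      using q by (simp add: power2_eq_square)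
    finally show ?thesis unfolding q_def .
  qed
  from has_absolute_integral_change_of_variables_1'[of "{0<..}" g g' f "pi / sin (pi * s)"]
  have "(\<lambda>x. \<bar>g' x\<bar> * f (g x)) absolutely_integrable_on {0<..} \<and>
      integral {0<..} (\<lambda>x. \<bar>g' x\<bar> * f (g x)) = pi / sin (pi * s)"
    using der inj abs int unfolding img by auto
  moreover have "(\<lambda>x. \<bar>g' x\<bar> * f (g x)) absolutely_integrable_on {0<..} \<longleftrightarrow>
      (\<lambda>\<mu>. 2 * \<mu> powr (2 * s - 1) / (1 + \<mu>\<^sup>2)) absolutely_integrable_on {0<..}"
    using eq by (intro set_integrable_cong) auto
  moreover have "integral {0<..} (\<lambda>x. \<bar>g' x\<bar> * f (g x)) = integral {0<..} (\<lambda>\<mu>. 2 * \<mu> powr (2 * s - 1) / (1 + \<mu>\<^sup>2))"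
    using eq by (intro integral_cong) auto
  ultimately have fin: "(\<lambda>\<mu>. 2 * \<mu> powr (2 * s - 1) / (1 + \<mu>\<^sup>2)) absolutely_integrable_on {0<..}"
    "integral {0<..} (\<lambda>\<mu>. 2 * \<mu> powr (2 * s - 1) / (1 + \<mu>\<^sup>2)) = pi / sin (pi * s)" by auto
  have "(\<lambda>\<mu>. 2 * \<mu> powr (2 * s - 1) / (1 + \<mu>\<^sup>2)) \<in> borel_measurable borel" by measurable
  from set_integrable_lborel_if_absolutely_integrable[OF fin(1) _ this] fin(2)
  show "set_integrable lborel {0<..} (\<lambda>\<mu>. 2 * \<mu> powr (2 * s - 1) / (1 + \<mu>\<^sup>2))"
    and "(LINT \<mu>:{0<..}|lborel. 2 * \<mu> powr (2 * s - 1) / (1 + \<mu>\<^sup>2)) = pi / sin (pi * s)" by auto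
qed

lemma gaussian_moment:
  assumes s: "0 < (s::real)"
  shows "(LINT \<mu>:{0<..}|lborel. 2 * \<mu> powr (2 * s + 1) * exp (- \<mu>\<^sup>2)) = Gamma (s + 1)"
proof -
  define f where "f t = t powr ((s + 1) - 1) / exp t" for t :: real
  have der: "((\<lambda>\<mu>. \<mu>\<^sup>2) has_field_derivative 2 * x) (at x within {0<..})" for x :: real
    by (auto intro!: derivative_eq_intros)
  have inj: "inj_on (\<lambda>\<mu>::real. \<mu>\<^sup>2) {0<..}"
    by (rule inj_onI) (auto simp: power2_eq_iff_nonneg)
  have img: "(\<lambda>\<mu>::real. \<mu>\<^sup>2) ` {0<..} = {0<..}"
  proof
    show "{0<..} \<subseteq> (\<lambda>\<mu>::real. \<mu>\<^sup>2) ` {0<..}"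
    proof
      fix u :: real assume "u \<in> {0<..}"
      then show "u \<in> (\<lambda>\<mu>::real. \<mu>\<^sup>2) ` {0<..}" by (intro image_eqI[of _ _ "sqrt u"]) auto
    qed
  qed auto
  have "(f has_integral Gamma (s + 1)) {0..}"
    unfolding f_def by (rule Gamma_integral_real) (use s in simp)
  then have hi: "(f has_integral Gamma (s + 1)) {0<..}"
    by (subst has_integral_spike_set_eq[of "{0<..}" "{0..}"]) (auto intro: negligible_subset[of "{0}"])
  have abs: "f absolutely_integrable_on {0<..}"
    using hi by (intro nonnegative_absolutely_integrable_1) (auto simp: f_def has_integral_integrable)
  have eq: "\<bar>2 * x\<bar> * f (x\<^sup>2) = 2 * x powr (2 * s + 1) * exp (- x\<^sup>2)" if x: "x \<in> {0<..}" for x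
  proof -
    have x0: "x > 0" using x by simp
    have "(x\<^sup>2) powr s = x powr (2 * s)" using x0 by (simp add: powr_powr flip: powr_numeral)
    then show ?thesis using x0 by (simp add: f_def powr_add exp_minus field_simps)
  qed
  from has_absolute_integral_change_of_variables_1'[of "{0<..}" "\<lambda>\<mu>. \<mu>\<^sup>2" "\<lambda>\<mu>. 2 * \<mu>" f "Gamma (s + 1)"]
  have "(\<lambda>x. \<bar>2 * x\<bar> * f (x\<^sup>2)) absolutely_integrable_on {0<..} \<and>
      integral {0<..} (\<lambda>x. \<bar>2 * x\<bar> * f (x\<^sup>2)) = Gamma (s + 1)"
    using der inj abs hi unfolding img by (auto simp: integral_unique)
  moreover have "(\<lambda>x. \<bar>2 * x\<bar> * f (x\<^sup>2)) absolutely_integrable_on {0<..} \<longleftrightarrow>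
      (\<lambda>x. 2 * x powr (2 * s + 1) * exp (- x\<^sup>2)) absolutely_integrable_on {0<..}"
    using eq by (intro set_integrable_cong) auto
  moreover have "integral {0<..} (\<lambda>x. \<bar>2 * x\<bar> * f (x\<^sup>2)) = integral {0<..} (\<lambda>x. 2 * x powr (2 * s + 1) * exp (- x\<^sup>2))"
    using eq by (intro integral_cong) auto
  ultimately have fin: "(\<lambda>x. 2 * x powr (2 * s + 1) * exp (- x\<^sup>2)) absolutely_integrable_on {0<..}"
    "integral {0<..} (\<lambda>x. 2 * x powr (2 * s + 1) * exp (- x\<^sup>2)) = Gamma (s + 1)" by auto
  have "(\<lambda>x. 2 * x powr (2 * s + 1) * exp (- x\<^sup>2)) \<in> borel_measurable borel" by measurable
  from set_integrable_lborel_if_absolutely_integrable[OF fin(1) _ this] fin(2)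
  show ?thesis by auto
qed

lemma set_integral_scale:
  fixes f :: "real \<Rightarrow> real"
  assumes c: "0 < c"
  shows "set_integrable lborel {0<..} (\<lambda>x. f (c * x)) \<longleftrightarrow> set_integrable lborel {0<..} f"
    and "(LINT x:{0<..}|lborel. f x) = c * (LINT x:{0<..}|lborel. f (c * x))"
proof -
  have ind: "indicator {0<..} (c * x) = (indicator {0<..} x :: real)" for x
    using c by (simp add: indicator_def zero_less_mult_iff)
  show "set_integrable lborel {0<..} (\<lambda>x. f (c * x)) \<longleftrightarrow> set_integrable lborel {0<..} f"
    using lborel_integrable_real_affine_iff[of c "\<lambda>x. indicator {0<..} x *\<^sub>R f x" 0] c
    by (simp add: set_integrable_def ind)
  show "(LINT x:{0<..}|lborel. f x) = c * (LINT x:{0<..}|lborel. f (c * x))"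
    using lborel_integral_real_affine[of c "\<lambda>x. indicator {0<..} x *\<^sub>R f x" 0] c
    by (simp add: set_lebesgue_integral_def ind)
qed

text \<open>The representation of the power \<open>y powr (s - 1)\<close> as a superposition of Cauchy kernels, by homogeneity
from the case \<open>y = 1\<close>.\<close>

lemma stieltjes_power_integral:
  assumes s: "0 < s" "s < (1::real)" and y: "0 < y"
  shows "set_integrable lborel {0<..} (\<lambda>\<mu>. 2 * \<mu> powr (2 * s - 1) / (y + \<mu>\<^sup>2))"
    and "(LINT \<mu>:{0<..}|lborel. 2 * \<mu> powr (2 * s - 1) / (y + \<mu>\<^sup>2)) = pi / sin (pi * s) * y powr (s - 1)"
proof -
  define K where "K \<mu> = 2 * \<mu> powr (2 * s - 1) / (y + \<mu>\<^sup>2)" for \<mu>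
  have eq: "K (sqrt y * \<mu>) = y powr (s - 3 / 2) * (2 * \<mu> powr (2 * s - 1) / (1 + \<mu>\<^sup>2))" if "\<mu> \<in> {0<..}" for \<mu>
  proof -
    have "K (sqrt y * \<mu>) = 2 * (y powr (1/2) * \<mu>) powr (2 * s - 1) / (y * (1 + \<mu>\<^sup>2))"
      using y by (simp add: K_def power_mult_distrib powr_half_sqrt algebra_simps)
    also have "(y powr (1/2) * \<mu>) powr (2 * s - 1) = y powr (s - 1/2) * \<mu> powr (2 * s - 1)"
      using that y by (simp add: powr_mult powr_powr algebra_simps)
    also have "2 * (y powr (s - 1/2) * \<mu> powr (2 * s - 1)) / (y * (1 + \<mu>\<^sup>2))
        = (y powr (s - 1/2) / y powr 1) * (2 * \<mu> powr (2 * s - 1) / (1 + \<mu>\<^sup>2))"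
      using y by simp
    also have "y powr (s - 1/2) / y powr 1 = y powr (s - 3 / 2)"
      unfolding powr_diff[symmetric] by simp
    finally show ?thesis .
  qed
  have "set_integrable lborel {0<..} (\<lambda>\<mu>. K (sqrt y * \<mu>))
      \<longleftrightarrow> set_integrable lborel {0<..} (\<lambda>\<mu>. y powr (s - 3 / 2) * (2 * \<mu> powr (2 * s - 1) / (1 + \<mu>\<^sup>2)))"
    using eq by (intro set_integrable_cong) auto
  moreover have "set_integrable lborel {0<..} (\<lambda>\<mu>. y powr (s - 3 / 2) * (2 * \<mu> powr (2 * s - 1) / (1 + \<mu>\<^sup>2)))"
    by (rule set_integrable_mult_right) (rule stieltjes_kernel_integral(1)[OF s])
  ultimately have "set_integrable lborel {0<..} (\<lambda>\<mu>. K (sqrt y * \<mu>))"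
    by blast
  then show "set_integrable lborel {0<..} (\<lambda>\<mu>. 2 * \<mu> powr (2 * s - 1) / (y + \<mu>\<^sup>2))"
    using set_integral_scale(1)[of "sqrt y" K] y unfolding K_def[abs_def] by simp
  have "(LINT \<mu>:{0<..}|lborel. K \<mu>) = sqrt y * (LINT \<mu>:{0<..}|lborel. K (sqrt y * \<mu>))"
    using y by (intro set_integral_scale(2)) simp
  also have "(LINT \<mu>:{0<..}|lborel. K (sqrt y * \<mu>))
      = (LINT \<mu>:{0<..}|lborel. y powr (s - 3 / 2) * (2 * \<mu> powr (2 * s - 1) / (1 + \<mu>\<^sup>2)))"
    using eq by (intro set_lebesgue_integral_cong) auto
  also have "\<dots> = y powr (s - 3 / 2) * (pi / sin (pi * s))"
    unfolding set_integral_mult_right stieltjes_kernel_integral(2)[OF s] ..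
  also have "sqrt y * (y powr (s - 3 / 2) * (pi / sin (pi * s))) = y powr (1/2) * y powr (s - 3/2) * (pi / sin (pi * s))"
    using y by (simp add: powr_half_sqrt)
  also have "y powr (1/2) * y powr (s - 3/2) = y powr (s - 1)"
    unfolding powr_add[symmetric] by simp
  finally show "(LINT \<mu>:{0<..}|lborel. 2 * \<mu> powr (2 * s - 1) / (y + \<mu>\<^sup>2)) = pi / sin (pi * s) * y powr (s - 1)"
    by (simp add: K_def)
qed

text \<open>The interpolation error of \<open>y ^ (k + 1) / (y + t)\<close> at the zeros of \<open>\<omega>\<close>. Subtracting from the numerator
the multiple of \<open>\<omega>\<close> that makes it vanish at \<open>y = -t\<close> leaves, after division by \<open>y + t\<close>, a polynomial of degree at
most \<open>m\<close> with the same values at the nodes; this is the interpolant.\<close>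

lemma lagrange_cauchy_kernel:
  fixes \<omega> :: "real poly"
  assumes Z: "finite Z" "card Z = Suc m" "\<And>z. z \<in> Z \<Longrightarrow> 0 < z \<and> poly \<omega> z = 0"
    and \<omega>: "degree \<omega> \<le> Suc m" and k: "k \<le> m" and t: "0 < t" "poly \<omega> (- t) \<noteq> 0" and y: "0 < y"
  shows "(- t) ^ Suc k * poly \<omega> y / (poly \<omega> (- t) * (y + t))
    = y ^ Suc k / (y + t) - (\<Sum>z\<in>Z. poly (lagrange_basis Z z) y * (z ^ Suc k / (z + t)))"
proof -
  define c where "c = (- t) ^ Suc k / poly \<omega> (- t)"
  \<comment> \<open>The coefficient \<open>c\<close> is chosen so that \<open>N\<close> vanishes at \<open>-t\<close>.\<close>
  define N where "N = monom 1 (Suc k) - smult c \<omega>"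
  have "poly N (- t) = 0" using t by (simp add: N_def c_def poly_monom)
  then have "[:t, 1:] dvd N" by (simp add: poly_eq_0_iff_dvd)
  then obtain R where R: "N = [:t, 1:] * R" by (elim dvdE)
  have degN: "degree N \<le> Suc m" unfolding N_def
    using \<omega> k degree_smult_le[of c \<omega>] degree_monom_le[of "1::real" "Suc k"] by (intro degree_diff_le) auto
  have degR: "degree R < card Z"
  proof (cases "R = 0")
    case False
    then have "degree N = Suc (degree R)" unfolding R by (subst degree_mult_eq) auto
    then show ?thesis using degN Z(2) by simp
  qed (use Z in simp)
  have Rx: "poly R x = (x ^ Suc k - c * poly \<omega> x) / (x + t)" if "0 < x" for x
  proof -
    have "x ^ Suc k - c * poly \<omega> x = (x + t) * poly R x"
      using arg_cong[OF R, of "\<lambda>p. poly p x"] by (simp add: N_def poly_monom algebra_simps)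
    then show ?thesis using that t(1) by simp
  qed
  have "(y ^ Suc k - c * poly \<omega> y) / (y + t) = poly (\<Sum>z\<in>Z. smult (poly R z) (lagrange_basis Z z)) y"
    using lagrange_interpolation[OF Z(1) degR] Rx[OF y] by simp
  also have "\<dots> = (\<Sum>z\<in>Z. poly (lagrange_basis Z z) y * (z ^ Suc k / (z + t)))"
    unfolding poly_sum poly_smult using Rx Z(3) by (intro sum.cong) (auto simp: mult.commute)
  finally have "y ^ Suc k / (y + t) - c * poly \<omega> y / (y + t)
      = (\<Sum>z\<in>Z. poly (lagrange_basis Z z) y * (z ^ Suc k / (z + t)))"
    by (simp only: diff_divide_distrib)
  moreover have "(- t) ^ Suc k * poly \<omega> y / (poly \<omega> (- t) * (y + t)) = c * poly \<omega> y / (y + t)"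
    unfolding c_def by simp
  ultimately show ?thesis by linarith
qed

lemma set_integral_sum:
  fixes f :: "'i \<Rightarrow> 'a \<Rightarrow> real"
  assumes "\<And>i. i \<in> I \<Longrightarrow> set_integrable M A (f i)"
  shows "set_integrable M A (\<lambda>x. \<Sum>i\<in>I. f i x)"
    and "(LINT x:A|M. (\<Sum>i\<in>I. f i x)) = (\<Sum>i\<in>I. LINT x:A|M. f i x)"
  using assms unfolding set_integrable_def set_lebesgue_integral_def scaleR_sum_right
  by (auto intro!: Bochner_Integration.integral_sum)

text \<open>Integrate the preceding identity against the density that represents \<open>y powr (s - k - 1)\<close>. Extracting
\<open>y ^ (k + 1)\<close> first is what lets exponents beyond \<open>1\<close> be handled by the convergent kernel integral with
exponent \<open>s - k\<close> between \<open>0\<close> and \<open>1\<close>.\<close>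

lemma power_interpolation_error:
  fixes \<omega> :: "real poly" and s :: real
  assumes s: "real k < s" "s < real k + 1" "k \<le> m"
    and Z: "finite Z" "card Z = Suc m" "\<And>z. z \<in> Z \<Longrightarrow> 0 < z \<and> poly \<omega> z = 0"
    and \<omega>: "degree \<omega> \<le> Suc m" "\<And>t. 0 < t \<Longrightarrow> poly \<omega> (- t) \<noteq> 0" and y: "0 < y"
  shows "y powr s - poly (\<Sum>z\<in>Z. smult (z powr s) (lagrange_basis Z z)) y
    = - (sin (pi * s) / pi) * poly \<omega> y *
      (LINT \<mu>:{0<..}|lborel. 2 * \<mu> powr (2 * s + 1) / (poly \<omega> (- \<mu>\<^sup>2) * (y + \<mu>\<^sup>2)))"
proof -
  define r where "r = s - real k"
  have r: "0 < r" "r < 1" using s by (auto simp: r_def)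
  define K where "K x \<mu> = 2 * \<mu> powr (2 * r - 1) / (x + \<mu>\<^sup>2)" for x \<mu> :: real
  have K: "set_integrable lborel {0<..} (K x)" "(LINT \<mu>:{0<..}|lborel. K x \<mu>) = pi / sin (pi * r) * x powr (r - 1)"
    if "0 < x" for x
    using stieltjes_power_integral[OF r that] unfolding K_def[abs_def] by auto
  define J where "J = (LINT \<mu>:{0<..}|lborel. 2 * \<mu> powr (2 * s + 1) / (poly \<omega> (- \<mu>\<^sup>2) * (y + \<mu>\<^sup>2)))"
  have pw: "x ^ Suc k * x powr (r - 1) = x powr s" if "0 < x" for x
  proof -
    have "x ^ Suc k * x powr (r - 1) = x powr (real (Suc k) + (r - 1))"
      using that unfolding powr_add by (simp only: powr_realpow)
    then show ?thesis by (simp add: r_def)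
  qed
  have eq: "(- 1) ^ Suc k * poly \<omega> y * (2 * \<mu> powr (2 * s + 1) / (poly \<omega> (- \<mu>\<^sup>2) * (y + \<mu>\<^sup>2)))
      = y ^ Suc k * K y \<mu> - (\<Sum>z\<in>Z. poly (lagrange_basis Z z) y * z ^ Suc k * K z \<mu>)"
    if \<mu>: "\<mu> \<in> {0<..}" for \<mu>
  proof -
    have t: "0 < \<mu>\<^sup>2" using \<mu> by simp
    have "\<mu> powr (2 * r - 1) * (\<mu>\<^sup>2) ^ Suc k = \<mu> powr (2 * r - 1) * \<mu> powr (real (2 * Suc k))"
      using \<mu> by (subst powr_realpow) (simp_all only: power_mult greaterThan_iff)
    also have "\<dots> = \<mu> powr (2 * s + 1)"
      unfolding powr_add[symmetric] by (simp add: r_def algebra_simps)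
    finally have "2 * \<mu> powr (2 * s + 1) = 2 * \<mu> powr (2 * r - 1) * (\<mu>\<^sup>2) ^ Suc k" by simp
    then have "(- 1) ^ Suc k * poly \<omega> y * (2 * \<mu> powr (2 * s + 1) / (poly \<omega> (- \<mu>\<^sup>2) * (y + \<mu>\<^sup>2)))
        = 2 * \<mu> powr (2 * r - 1) * ((- (\<mu>\<^sup>2)) ^ Suc k * poly \<omega> y / (poly \<omega> (- \<mu>\<^sup>2) * (y + \<mu>\<^sup>2)))"
      by (subst (2) power_minus) simp
    also have "\<dots> = 2 * \<mu> powr (2 * r - 1) * (y ^ Suc k / (y + \<mu>\<^sup>2)
        - (\<Sum>z\<in>Z. poly (lagrange_basis Z z) y * (z ^ Suc k / (z + \<mu>\<^sup>2))))"
      by (subst lagrange_cauchy_kernel[OF Z \<omega>(1) s(3) t \<omega>(2)[OF t] y]) auto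
    also have "\<dots> = y ^ Suc k * K y \<mu> - (\<Sum>z\<in>Z. poly (lagrange_basis Z z) y * z ^ Suc k * K z \<mu>)"
      unfolding right_diff_distrib sum_distrib_left K_def by (intro arg_cong2[of _ _ _ _ minus] sum.cong) auto
    finally show ?thesis .
  qed
  have "(- 1) ^ Suc k * poly \<omega> y * J
      = (LINT \<mu>:{0<..}|lborel. (- 1) ^ Suc k * poly \<omega> y * (2 * \<mu> powr (2 * s + 1) / (poly \<omega> (- \<mu>\<^sup>2) * (y + \<mu>\<^sup>2))))"
    unfolding J_def by (rule set_integral_mult_right[symmetric])
  also have "\<dots> = (LINT \<mu>:{0<..}|lborel. y ^ Suc k * K y \<mu> - (\<Sum>z\<in>Z. poly (lagrange_basis Z z) y * z ^ Suc k * K z \<mu>))"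
    using eq by (intro set_lebesgue_integral_cong) auto
  also have "\<dots> = (LINT \<mu>:{0<..}|lborel. y ^ Suc k * K y \<mu>)
      - (LINT \<mu>:{0<..}|lborel. (\<Sum>z\<in>Z. poly (lagrange_basis Z z) y * z ^ Suc k * K z \<mu>))"
    using K(1) y Z by (intro set_integral_diff set_integral_sum set_integrable_mult_right) auto
  also have "(LINT \<mu>:{0<..}|lborel. (\<Sum>z\<in>Z. poly (lagrange_basis Z z) y * z ^ Suc k * K z \<mu>))
      = (\<Sum>z\<in>Z. (LINT \<mu>:{0<..}|lborel. poly (lagrange_basis Z z) y * z ^ Suc k * K z \<mu>))"
    using K(1) Z by (intro set_integral_sum) auto
  also have "(LINT \<mu>:{0<..}|lborel. y ^ Suc k * K y \<mu>) = pi / sin (pi * r) * y powr s"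
    unfolding set_integral_mult_right K(2)[OF y] pw[OF y, symmetric] by (simp only: mult_ac)
  also have "(\<Sum>z\<in>Z. (LINT \<mu>:{0<..}|lborel. poly (lagrange_basis Z z) y * z ^ Suc k * K z \<mu>))
      = (\<Sum>z\<in>Z. pi / sin (pi * r) * (z powr s * poly (lagrange_basis Z z) y))"
  proof (rule sum.cong[OF refl])
    fix z assume "z \<in> Z"
    then have z: "0 < z" using Z(3) by auto
    show "(LINT \<mu>:{0<..}|lborel. poly (lagrange_basis Z z) y * z ^ Suc k * K z \<mu>)
        = pi / sin (pi * r) * (z powr s * poly (lagrange_basis Z z) y)"
      unfolding set_integral_mult_right K(2)[OF z] pw[OF z, symmetric] by (simp only: mult_ac)
  qed
  also have "pi / sin (pi * r) * y powr s - (\<Sum>z\<in>Z. pi / sin (pi * r) * (z powr s * poly (lagrange_basis Z z) y))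
      = pi / sin (pi * r) * (y powr s - poly (\<Sum>z\<in>Z. smult (z powr s) (lagrange_basis Z z)) y)"
    by (simp add: right_diff_distrib poly_sum sum_distrib_left)
  finally have main: "(- 1) ^ Suc k * poly \<omega> y * J
      = pi / sin (pi * r) * (y powr s - poly (\<Sum>z\<in>Z. smult (z powr s) (lagrange_basis Z z)) y)" .
  have sr: "0 < sin (pi * r)" using r by (intro sin_gt_zero) auto
  have "sin (pi * s) = (- 1) ^ k * sin (pi * r)"
  proof -
    have "pi * s = pi * r + pi * real k" by (simp add: r_def algebra_simps)
    then show ?thesis by (simp add: sin_add sin_npi2 cos_npi2 mult.commute)
  qed
  then have "- (sin (pi * s) / pi) * poly \<omega> y * J = sin (pi * r) / pi * ((- 1) ^ Suc k * poly \<omega> y * J)"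
    by simp
  also have "\<dots> = y powr s - poly (\<Sum>z\<in>Z. smult (z powr s) (lagrange_basis Z z)) y"
    unfolding main using sr by simp
  finally show ?thesis by (simp add: J_def)
qed

section \<open>Asymptotics of the node polynomial\<close>

text \<open>If uniform convergence failed, choosing a bad point for each bad index would give a sequence
contradicting the assumption.\<close>

lemma uniform_limit_sequentiallyI:
  fixes f :: "nat \<Rightarrow> 'a \<Rightarrow> real"
  assumes "\<And>u. (\<And>m. u m \<in> K) \<Longrightarrow> (\<lambda>m. f m (u m) - g (u m)) \<longlonglongrightarrow> 0"
  shows "uniform_limit K f g sequentially"
proof (cases "K = {}")
  case False
  then obtain k where k: "k \<in> K" by blast
  show ?thesis
  proof (rule uniform_limitI)
    fix e :: real assume e: "0 < e"
    define u where "u m = (if \<exists>x\<in>K. \<not> dist (f m x) (g x) < e then SOME x. x \<in> K \<and> \<not> dist (f m x) (g x) < e else k)" for m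
    have bad: "u m \<in> K \<and> \<not> dist (f m (u m)) (g (u m)) < e" if "\<exists>x\<in>K. \<not> dist (f m x) (g x) < e" for m
    proof -
      have "\<exists>x. x \<in> K \<and> \<not> dist (f m x) (g x) < e" using that by blast
      from someI_ex[OF this] show ?thesis using that by (simp add: u_def)
    qed
    have "u m \<in> K" for m
      using bad[of m] k by (cases "\<exists>x\<in>K. \<not> dist (f m x) (g x) < e") (auto simp: u_def)
    then have "(\<lambda>m. f m (u m) - g (u m)) \<longlonglongrightarrow> 0" by (rule assms)
    then have "\<forall>\<^sub>F m in sequentially. dist (f m (u m) - g (u m)) 0 < e"
      using e by (rule tendstoD)
    then show "\<forall>\<^sub>F m in sequentially. \<forall>x\<in>K. dist (f m x) (g x) < e"
      by eventually_elim (use bad in \<open>auto simp: dist_real_def\<close>)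
  qed
qed simp

text \<open>The value of the exterior map at the branch point \<open>0\<close>, that is \<open>1 / \<rho>\<close>.\<close>

definition outer_rate :: "real \<Rightarrow> real" where
  "outer_rate a = (1 + a) / (1 - a)"

text \<open>The leading part of the node polynomial at \<open>0\<close>: there the recessive term of
\<open>poly_node_poly_outer\<close> vanishes, so this is its exact value.\<close>

definition node_scale :: "real \<Rightarrow> nat \<Rightarrow> real" where
  "node_scale a m = outer_rate a ^ Suc m * (1 - (1 / outer_rate a)\<^sup>2)\<^sup>2 / 2"

lemma outer_rate_gt_1: "0 < a \<Longrightarrow> a < 1 \<Longrightarrow> 1 < outer_rate a"
  by (simp add: outer_rate_def)

lemma inverse_outer_rate: "1 / outer_rate a = (1 - a) / (1 + a)"
  by (simp add: outer_rate_def)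

lemma node_scale_pos:
  assumes "0 < a" "a < 1" shows "0 < node_scale a m"
proof -
  have "1 / outer_rate a < 1" "0 < 1 / outer_rate a" using outer_rate_gt_1[OF assms] by auto
  then have "(1 / outer_rate a)\<^sup>2 < 1" using sq_less_one by blast
  then show ?thesis using outer_rate_gt_1[OF assms] by (simp add: node_scale_def)
qed

lemma node_poly_over_scale:
  assumes a: "0 < a" "a < 1" and m: "1 \<le> m" and y: "y \<le> a\<^sup>2"
  defines "w \<equiv> outer_rate a" and "W \<equiv> outer_map a y"
  shows "poly (node_poly a m) y / node_scale a m =
    ((W / w) ^ Suc m * (1 - 1 / (w * W))\<^sup>2 + (1 / (w * W)) ^ Suc m * (1 - W / w)\<^sup>2) / (1 - (1 / w)\<^sup>2)\<^sup>2"
proof -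
  have w: "w > 1" using outer_rate_gt_1[OF a] by (simp add: w_def)
  define v where "v = 1 / w"
  have v: "0 < v" "v < 1" using w by (auto simp: v_def)
  have nz: "(1 - v\<^sup>2)\<^sup>2 \<noteq> 0" using sq_less_one[OF v] by simp
  have W: "W \<ge> 1" using outer_map_ivl_map(2)[OF a y] by (simp add: W_def)
  have "poly (node_poly a m) y = (W ^ Suc m * (1 - v / W)\<^sup>2 + (1 / W) ^ Suc m * (1 - v * W)\<^sup>2) / 2"
    unfolding poly_node_poly_outer[OF a m y] W_def v_def w_def inverse_outer_rate by simp
  then have "poly (node_poly a m) y / node_scale a m
      = ((W ^ Suc m * (1 - v / W)\<^sup>2 + (1 / W) ^ Suc m * (1 - v * W)\<^sup>2) * (1 / w ^ Suc m)) / (1 - v\<^sup>2)\<^sup>2"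
    by (simp add: node_scale_def v_def w_def)
  also have "(W ^ Suc m * (1 - v / W)\<^sup>2 + (1 / W) ^ Suc m * (1 - v * W)\<^sup>2) * (1 / w ^ Suc m)
      = (W / w) ^ Suc m * (1 - v / W)\<^sup>2 + (1 / (w * W)) ^ Suc m * (1 - v * W)\<^sup>2"
    unfolding power_divide power_mult_distrib distrib_right by simp
  finally show ?thesis by (simp add: v_def)
qed

lemma outer_map_over_rate:
  assumes "0 < a" "a < 1"
  shows "outer_map a y / outer_rate a = ((sqrt (1 - y) + sqrt (a\<^sup>2 - y)) / (1 + a))\<^sup>2"
proof -
  have "(1 - a\<^sup>2) * outer_rate a = (1 + a)\<^sup>2"
    using assms by (simp add: outer_rate_def power2_eq_square field_simps)
  then have "outer_map a y / outer_rate a = (sqrt (1 - y) + sqrt (a\<^sup>2 - y))\<^sup>2 / (1 + a)\<^sup>2"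
    unfolding outer_map_def by simp
  then show ?thesis by (simp add: power_divide)
qed

text \<open>A crude linear minorant is enough: at \<open>t = a \<mu>\<^sup>2 / m\<close> its power \<open>m + 1\<close> exceeds, up to a constant,
any fixed power of \<open>1 + \<mu>\<^sup>2\<close> once \<open>m\<close> is large.\<close>

lemma outer_map_growth:
  assumes a: "0 < a" "a < 1" and t: "0 \<le> t"
  shows "1 + t / 2 \<le> outer_map a (- t) / outer_rate a"
proof -
  have "a = sqrt (1 * a\<^sup>2)" using a by simp
  also have "\<dots> \<le> sqrt ((1 + t) * (a\<^sup>2 + t))"
    using t a by (intro real_sqrt_le_mono mult_mono) auto
  finally have q: "a \<le> sqrt (1 + t) * sqrt (a\<^sup>2 + t)" by (simp add: real_sqrt_mult)
  have "(sqrt (1 + t) + sqrt (a\<^sup>2 + t))\<^sup>2 = (1 + t) + (a\<^sup>2 + t) + 2 * (sqrt (1 + t) * sqrt (a\<^sup>2 + t))"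
    using t a by (simp add: power2_sum add_nonneg_nonneg)
  then have "(1 + a)\<^sup>2 + 2 * t \<le> (sqrt (1 + t) + sqrt (a\<^sup>2 + t))\<^sup>2"
    using q by (simp add: power2_sum)
  moreover have "(1 + a)\<^sup>2 * (1 + t / 2) \<le> (1 + a)\<^sup>2 + 2 * t"
  proof -
    have "(1 + a)\<^sup>2 \<le> 2\<^sup>2" using a by (intro power_mono) auto
    then have "(1 + a)\<^sup>2 * (t / 2) \<le> 4 * (t / 2)" using t by (intro mult_right_mono) auto
    then show ?thesis by (simp add: distrib_left)
  qed
  ultimately have "(1 + t / 2) * (1 + a)\<^sup>2 \<le> (sqrt (1 + t) + sqrt (a\<^sup>2 + t))\<^sup>2" by (simp add: mult.commute)
  then show ?thesis
    unfolding outer_map_over_rate[OF a] using a by (simp add: power_divide pos_le_divide_eq)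
qed

lemma node_poly_lower_bound:
  assumes a: "0 < a" "a < 1" and m: "1 \<le> m" and t: "0 \<le> t"
  shows "(1 + t / 2) ^ Suc m \<le> poly (node_poly a m) (- t) / node_scale a m"
proof -
  define w W where "w = outer_rate a" and "W = outer_map a (- t)"
  have w: "w > 1" using outer_rate_gt_1[OF a] by (simp add: w_def)
  have g: "1 + t / 2 \<le> W / w" using outer_map_growth[OF a t] by (simp add: W_def w_def)
  then have Ww: "w \<le> W" using t w by (simp add: field_simps) (smt (verit) mult_nonneg_nonneg)
  have v2: "(1 / w)\<^sup>2 < 1" using w by (intro sq_less_one) auto
  have "1 / (w * W) \<le> 1 / (w * w)" using w Ww by (intro divide_left_mono mult_left_mono) auto
  then have "(1 - (1 / w)\<^sup>2)\<^sup>2 \<le> (1 - 1 / (w * W))\<^sup>2"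
    using v2 by (intro power_mono) (auto simp: power2_eq_square)
  then have "(1 + t / 2) ^ Suc m * (1 - (1 / w)\<^sup>2)\<^sup>2 \<le> (W / w) ^ Suc m * (1 - 1 / (w * W))\<^sup>2"
    using t w Ww by (intro mult_mono power_mono[OF g]) auto
  also have "\<dots> \<le> (W / w) ^ Suc m * (1 - 1 / (w * W))\<^sup>2 + (1 / (w * W)) ^ Suc m * (1 - W / w)\<^sup>2"
    using w Ww by simp
  finally have "(1 + t / 2) ^ Suc m \<le> ((W / w) ^ Suc m * (1 - 1 / (w * W))\<^sup>2
      + (1 / (w * W)) ^ Suc m * (1 - W / w)\<^sup>2) / (1 - (1 / w)\<^sup>2)\<^sup>2"
    using v2 by (subst pos_le_divide_eq) auto
  moreover have "- t \<le> a\<^sup>2" using t zero_le_power2[of a] by linarith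
  ultimately show ?thesis
    using node_poly_over_scale[OF a m] by (simp only: w_def W_def)
qed

lemma outer_map_deriv_0:
  assumes a: "0 < a" "a < 1"
  shows "((\<lambda>y. ln (outer_map a y / outer_rate a)) has_real_derivative - 1 / a) (at 0)"
proof -
  have F: "((\<lambda>y. (sqrt (1 - y) + sqrt (a\<^sup>2 - y)) / (1 + a)) has_real_derivative - 1 / (2 * a)) (at 0)"
  proof -
    have "((\<lambda>y. sqrt (1 - y)) has_real_derivative - 1 / 2) (at 0)"
      by (auto intro!: derivative_eq_intros)
    moreover have "((\<lambda>y. sqrt (a\<^sup>2 - y)) has_real_derivative - 1 / (2 * a)) (at 0)"
      using a by (auto intro!: derivative_eq_intros simp: field_simps)
    ultimately have "((\<lambda>y. (sqrt (1 - y) + sqrt (a\<^sup>2 - y)) / (1 + a)) has_real_derivative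
        (- 1 / 2 + - 1 / (2 * a)) / (1 + a)) (at 0)"
      by (intro DERIV_cdivide DERIV_add)
    moreover have "- 1 / 2 + - 1 / (2 * a) = (- 1 / (2 * a)) * (1 + a)" using a by (simp add: field_simps)
    ultimately show ?thesis using a by simp
  qed
  define G where "G y = (sqrt (1 - y) + sqrt (a\<^sup>2 - y)) / (1 + a)" for y
  have G0: "G 0 = 1" using a by (simp add: G_def)
  have "((\<lambda>y. (G y)\<^sup>2) has_real_derivative - 1 / a) (at 0)"
    using DERIV_power[OF F[folded G_def], of 2] G0 a by (simp add: G_def)
  from DERIV_chain2[OF DERIV_ln this] G0
  have "((\<lambda>y. ln ((G y)\<^sup>2)) has_real_derivative - 1 / a) (at 0)" by simp
  then show ?thesis unfolding outer_map_over_rate[OF a] G_def .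
qed

text \<open>The logarithm of the exterior map has slope \<open>- 1 / a\<close> at \<open>0\<close>, so its power \<open>m + 1\<close> at distance
\<open>a u / m\<close> tends to \<open>exp (- u)\<close> after normalisation, while the recessive term is exponentially small.
Allowing an arbitrary bounded sequence \<open>u\<close> encodes local uniformity in \<open>u\<close>; positive \<open>u\<close> serve the
point of evaluation, negative \<open>u\<close> the integration variable.\<close>

lemma node_poly_limit:
  assumes a: "0 < a" "a < 1" and u: "bounded (range u)"
  shows "(\<lambda>m. poly (node_poly a m) (a * u m / real m) / node_scale a m - exp (- u m)) \<longlonglongrightarrow> 0"
proof -
  define w where "w = outer_rate a"
  define y where "y m = a * u m / real m" for m
  define W where "W m = outer_map a (y m)" for m
  define c where "c = (1 - (1 / w)\<^sup>2)\<^sup>2"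
  have w: "w > 1" using outer_rate_gt_1[OF a] by (simp add: w_def)
  have "(1 / w)\<^sup>2 < 1" using w by (intro sq_less_one) auto
  then have c: "c > 0" by (simp add: c_def)
  obtain U where U: "\<And>m. \<bar>u m\<bar> \<le> U" using u by (auto simp: bounded_iff)
  have inv: "(\<lambda>m. 1 / real m) \<longlonglongrightarrow> 0" using lim_1_over_n by simp
  have bnd_null: "(\<lambda>m. u m * e m) \<longlonglongrightarrow> 0" if "e \<longlonglongrightarrow> 0" for e
  proof (rule Lim_null_comparison)
    show "(\<lambda>m. U * \<bar>e m\<bar>) \<longlonglongrightarrow> 0" using tendsto_mult_right_zero[OF tendsto_rabs_zero[OF that]] .
    show "\<forall>\<^sub>F m in sequentially. norm (u m * e m) \<le> U * \<bar>e m\<bar>"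
      using U by (intro always_eventually allI) (simp add: abs_mult mult_right_mono)
  qed
  have y0: "y \<longlonglongrightarrow> 0"
    using bnd_null[OF tendsto_mult_right_zero[OF inv, of a]] by (simp add: y_def[abs_def] mult.commute)
  have isC: "isCont (outer_map a) 0" unfolding outer_map_def[abs_def] using sq_less_one[OF a]
    by (intro continuous_intros) auto
  have Wlim: "W \<longlonglongrightarrow> w"
    using isCont_tendsto_compose[OF isC y0] outer_map_0[OF a] by (simp add: W_def[abs_def] w_def outer_rate_def)
  \<comment> \<open>The Caratheodory form of the derivative avoids dividing by \<open>y m\<close>, which may vanish.\<close>
  obtain g where g: "\<And>z. ln (outer_map a z / w) - ln (outer_map a 0 / w) = g z * (z - 0)"
    "isCont g 0" "g 0 = - 1 / a"
    using outer_map_deriv_0[OF a] unfolding w_def[symmetric] CARAT_DERIV by blast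
  have "outer_map a 0 / w = 1" using outer_map_0[OF a] a by (simp add: w_def outer_rate_def)
  then have g1: "ln (outer_map a z / w) = g z * z" for z using g(1)[of z] by simp
  define d where "d m = real (Suc m) * ln (W m / w) + u m" for m
  have ev: "\<forall>\<^sub>F m in sequentially. 1 \<le> m \<and> y m \<le> a\<^sup>2"
  proof -
    have "0 < a\<^sup>2" using a by simp
    from order_tendstoD(2)[OF y0 this] eventually_ge_at_top[of 1] show ?thesis
      by eventually_elim simp
  qed
  have dlim: "d \<longlonglongrightarrow> 0"
  proof -
    have "(\<lambda>m. a * (1 + 1 / real m) * g (y m) + 1) \<longlonglongrightarrow> a * (1 + 0) * g 0 + 1"
      by (intro tendsto_intros isCont_tendsto_compose[OF g(2) y0] inv)
    then have "(\<lambda>m. a * (1 + 1 / real m) * g (y m) + 1) \<longlonglongrightarrow> 0" using g(3) a by simp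
    then have "(\<lambda>m. u m * (a * (1 + 1 / real m) * g (y m) + 1)) \<longlonglongrightarrow> 0" by (rule bnd_null)
    moreover have "\<forall>\<^sub>F m in sequentially. u m * (a * (1 + 1 / real m) * g (y m) + 1) = d m"
      using eventually_ge_at_top[of 1]
      by eventually_elim (simp add: d_def W_def g1 y_def field_simps)
    ultimately show ?thesis by (rule Lim_transform_eventually)
  qed
  have winv: "1 / w < 1" "0 < 1 / w" using w by auto
  define r where "r m = exp (d m) * (1 - 1 / (w * W m))\<^sup>2 / c - 1" for m
  have rlim: "r \<longlonglongrightarrow> 0"
  proof -
    have "r \<longlonglongrightarrow> exp 0 * (1 - 1 / (w * w))\<^sup>2 / c - 1"
      unfolding r_def[abs_def] using dlim Wlim w c by (intro tendsto_intros) auto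
    moreover have "(1 - 1 / (w * w))\<^sup>2 = c" by (simp add: c_def power2_eq_square[of "1 / w"])
    ultimately show ?thesis using c by simp
  qed
  define e where "e m = (1 / (w * W m)) ^ Suc m * (1 - W m / w)\<^sup>2 / c" for m
  have e_lim: "e \<longlonglongrightarrow> 0"
  proof (rule Lim_null_comparison)
    have "(\<lambda>m. (1 / w) ^ m) \<longlonglongrightarrow> 0" using winv by (intro LIMSEQ_power_zero) auto
    then have "(\<lambda>m. (1 / w) ^ Suc m) \<longlonglongrightarrow> 0" by (rule LIMSEQ_Suc)
    then have "(\<lambda>m. (1 / w) ^ Suc m * ((1 - W m / w)\<^sup>2 / c)) \<longlonglongrightarrow> 0 * ((1 - w / w)\<^sup>2 / c)"
      using Wlim w c by (intro tendsto_intros) auto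
    then show "(\<lambda>m. (1 / w) ^ Suc m * ((1 - W m / w)\<^sup>2 / c)) \<longlonglongrightarrow> 0" by simp
    show "\<forall>\<^sub>F m in sequentially. norm (e m) \<le> (1 / w) ^ Suc m * ((1 - W m / w)\<^sup>2 / c)"
      using ev
    proof eventually_elim
      case (elim m)
      then have W1: "1 \<le> W m" using outer_map_ivl_map(2)[OF a, of "y m"] by (simp add: W_def)
      then have "1 / (w * W m) \<le> 1 / w" using w by (simp add: field_simps)
      then have "(1 / (w * W m)) ^ Suc m \<le> (1 / w) ^ Suc m" using w W1 by (intro power_mono) auto
      then have "(1 / (w * W m)) ^ Suc m * ((1 - W m / w)\<^sup>2 / c) \<le> (1 / w) ^ Suc m * ((1 - W m / w)\<^sup>2 / c)"
        using c by (intro mult_right_mono) auto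
      moreover have "0 \<le> e m" unfolding e_def using c w W1 by simp
      ultimately show ?case by (simp add: e_def)
    qed
  qed
  have "(\<lambda>m. exp (- u m) * r m + e m) \<longlonglongrightarrow> 0"
  proof -
    have "(\<lambda>m. exp (- u m) * r m) \<longlonglongrightarrow> 0"
    proof (rule Lim_null_comparison)
      show "(\<lambda>m. exp U * \<bar>r m\<bar>) \<longlonglongrightarrow> 0" using tendsto_mult_right_zero[OF tendsto_rabs_zero[OF rlim]] .
      have "- u m \<le> U" for m using U[of m] by linarith
      then show "\<forall>\<^sub>F m in sequentially. norm (exp (- u m) * r m) \<le> exp U * \<bar>r m\<bar>"
        by (intro always_eventually allI) (simp add: abs_mult mult_right_mono)
    qed
    then show ?thesis using tendsto_add[OF _ e_lim] by fastforce
  qed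
  moreover have "\<forall>\<^sub>F m in sequentially. exp (- u m) * r m + e m
      = poly (node_poly a m) (a * u m / real m) / node_scale a m - exp (- u m)"
    using ev
  proof eventually_elim
    case (elim m)
    then have m: "1 \<le> m" and ym: "y m \<le> a\<^sup>2" by auto
    have W1: "1 \<le> W m" using outer_map_ivl_map(2)[OF a ym] by (simp add: W_def)
    have "(W m / w) ^ Suc m = exp (real (Suc m) * ln (W m / w))"
      using W1 w by (simp only: exp_of_nat_mult) (simp add: exp_ln)
    then have pw: "(W m / w) ^ Suc m = exp (- u m) * exp (d m)"
      by (simp add: d_def flip: exp_add)
    have "poly (node_poly a m) (y m) / node_scale a m
        = ((W m / w) ^ Suc m * (1 - 1 / (w * W m))\<^sup>2 + (1 / (w * W m)) ^ Suc m * (1 - W m / w)\<^sup>2) / c"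
      using node_poly_over_scale[OF a m ym] by (simp only: W_def w_def c_def)
    also have "\<dots> = exp (- u m) * (r m + 1) + e m"
      unfolding pw by (simp add: r_def e_def add_divide_distrib del: power_Suc)
    finally show ?case by (simp add: y_def algebra_simps)
  qed
  ultimately show ?thesis by (rule Lim_transform_eventually)
qed

section \<open>The rescaled interpolation error and its dominated limits\<close>

text \<open>Keep the terms of order \<open>0\<close> and \<open>N\<close> of the binomial expansion on the right. The bound is uniform in
\<open>m\<close>, which dominated convergence needs.\<close>

lemma power_dominated_by_exponential_approximant:
  assumes a: "0 < a" and N: "1 \<le> N" "N \<le> m" and q: "0 \<le> (q::real)"
  shows "(1 + q) ^ N \<le> 2 ^ N * (1 + (2 * real N / a) ^ N) * (1 + a * q / real m / 2) ^ Suc m"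
proof -
  define x where "x = a * q / 2"
  have x: "0 \<le> x" using a q by (simp add: x_def)
  have m: "0 < real m" using N by simp
  have "1 + (x / real N) ^ N \<le> 1 + real (m choose N) * (x / real m) ^ N"
  proof -
    have "(x / real N) ^ N = (real m / real N) ^ N * (x / real m) ^ N"
      using m by (simp flip: power_mult_distrib)
    also have "\<dots> \<le> real (m choose N) * (x / real m) ^ N"
      using binomial_ge_n_over_k_pow_k[OF N(2), where 'a = real] x m by (intro mult_right_mono) auto
    finally show ?thesis by simp
  qed
  also have "\<dots> \<le> (\<Sum>k\<le>m. real (m choose k) * (x / real m) ^ k)"
  proof -
    have "(\<Sum>k\<in>{0, N}. real (m choose k) * (x / real m) ^ k) \<le> (\<Sum>k\<le>m. real (m choose k) * (x / real m) ^ k)"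
      using x m N by (intro sum_mono2) auto
    then show ?thesis using N by simp
  qed
  also have "\<dots> = (1 + x / real m) ^ m"
    using binomial_ring[of "x / real m" 1 m] by (simp add: add.commute)
  also have "\<dots> \<le> (1 + x / real m) ^ Suc m"
    using x m by (intro power_increasing) auto
  finally have low: "1 + (x / real N) ^ N \<le> (1 + x / real m) ^ Suc m" .
  have "(1 + q) ^ N \<le> (2 * max 1 q) ^ N" using q by (intro power_mono) auto
  also have "\<dots> = 2 ^ N * max 1 q ^ N" by (rule power_mult_distrib)
  also have "\<dots> \<le> 2 ^ N * (1 + q ^ N)"
  proof (rule mult_left_mono)
    show "max 1 q ^ N \<le> 1 + q ^ N" using q by (cases "q \<le> 1") (auto simp: max_def)
  qed simp
  also have "q ^ N = (2 * real N / a) ^ N * (x / real N) ^ N"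
    using a N by (simp add: x_def flip: power_mult_distrib)
  also have "2 ^ N * (1 + (2 * real N / a) ^ N * (x / real N) ^ N)
      \<le> 2 ^ N * ((1 + (2 * real N / a) ^ N) * (1 + (x / real N) ^ N))"
    using a x by (intro mult_left_mono) (auto simp: algebra_simps)
  also have "\<dots> \<le> 2 ^ N * ((1 + (2 * real N / a) ^ N) * (1 + x / real m) ^ Suc m)"
    using low a by (intro mult_left_mono) (auto simp: add_nonneg_nonneg)
  finally show ?thesis by (simp add: x_def mult_ac del: power_Suc)
qed

text \<open>The majorant is a multiple of the kernel whose integrability was shown above, since
\<open>\<mu> powr (2 s + 1) = \<mu> powr (2 (s - k) - 1) (\<mu>\<^sup>2) ^ (k + 1)\<close>; this dictates the exponent \<open>k + 2\<close>.\<close>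

lemma set_integrable_moment:
  assumes s: "real k < s" "s < real k + 1"
    and g: "g \<in> borel_measurable borel" "\<And>\<mu>. 0 < \<mu> \<Longrightarrow> \<bar>g \<mu>\<bar> \<le> C / (1 + \<mu>\<^sup>2) ^ (k + 2)"
  shows "\<And>\<mu>. 0 < \<mu> \<Longrightarrow> \<bar>2 * \<mu> powr (2 * s + 1) * g \<mu>\<bar> \<le> C * (2 * \<mu> powr (2 * (s - real k) - 1) / (1 + \<mu>\<^sup>2))"
    and "set_integrable lborel {0<..} (\<lambda>\<mu>. C * (2 * \<mu> powr (2 * (s - real k) - 1) / (1 + \<mu>\<^sup>2)))"
    and "set_integrable lborel {0<..} (\<lambda>\<mu>. 2 * \<mu> powr (2 * s + 1) * g \<mu>)"
proof -
  define r where "r = s - real k"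
  have r: "0 < r" "r < 1" using s by (auto simp: r_def)
  have C: "0 \<le> C"
  proof (rule ccontr)
    assume "\<not> 0 \<le> C"
    then have "C / (1 + 1\<^sup>2) ^ (k + 2) < 0" by (intro divide_neg_pos) auto
    then show False using g(2)[of 1] by linarith
  qed
  show bd: "\<bar>2 * \<mu> powr (2 * s + 1) * g \<mu>\<bar> \<le> C * (2 * \<mu> powr (2 * (s - real k) - 1) / (1 + \<mu>\<^sup>2))"
    if \<mu>: "0 < \<mu>" for \<mu>
  proof -
    define p where "p = \<mu> powr (2 * r - 1)"
    define q where "q = 1 + \<mu>\<^sup>2"
    have q: "q > 0" using \<mu> by (simp add: q_def add_pos_nonneg)
    have "\<mu> powr (2 * s + 1) = p * \<mu> powr (real (2 * Suc k))"
      unfolding p_def powr_add[symmetric] by (simp add: r_def algebra_simps)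
    also have "\<dots> = p * (\<mu>\<^sup>2) ^ Suc k"
      using \<mu> by (subst powr_realpow) (simp_all only: power_mult)
    also have "\<dots> \<le> p * q ^ Suc k"
      unfolding p_def q_def by (intro mult_left_mono power_mono) auto
    finally have "\<mu> powr (2 * s + 1) * \<bar>g \<mu>\<bar> \<le> (p * q ^ Suc k) * (C / q ^ (k + 2))"
      using g(2)[OF \<mu>] q by (intro mult_mono) (auto simp: q_def p_def)
    also have "\<dots> = C * (p / q)" using q by simp
    finally have 1: "\<mu> powr (2 * s + 1) * \<bar>g \<mu>\<bar> \<le> C * (p / q)" .
    have 2: "\<bar>2 * \<mu> powr (2 * s + 1) * g \<mu>\<bar> = 2 * (\<mu> powr (2 * s + 1) * \<bar>g \<mu>\<bar>)"
      by (simp add: abs_mult)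
    have 3: "C * (2 * p / q) = 2 * (C * (p / q))" by simp
    have "\<bar>2 * \<mu> powr (2 * s + 1) * g \<mu>\<bar> \<le> C * (2 * p / q)"
      unfolding 2 3 using 1 by (rule mult_left_mono) simp
    then show ?thesis by (simp only: p_def q_def r_def)
  qed
  show int: "set_integrable lborel {0<..} (\<lambda>\<mu>. C * (2 * \<mu> powr (2 * (s - real k) - 1) / (1 + \<mu>\<^sup>2)))"
    by (rule set_integrable_mult_right) (rule stieltjes_kernel_integral(1)[OF r, unfolded r_def])
  show "set_integrable lborel {0<..} (\<lambda>\<mu>. 2 * \<mu> powr (2 * s + 1) * g \<mu>)"
  proof (rule set_integrable_bound[OF int])
    have [measurable]: "g \<in> borel_measurable lborel" using g(1) by simp
    show "set_borel_measurable lborel {0<..} (\<lambda>\<mu>. 2 * \<mu> powr (2 * s + 1) * g \<mu>)"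
      unfolding set_borel_measurable_def by measurable
    show "AE x in lborel. x \<in> {0<..} \<longrightarrow> norm (2 * x powr (2 * s + 1) * g x)
        \<le> norm (C * (2 * x powr (2 * (s - real k) - 1) / (1 + x\<^sup>2)))"
    proof (intro AE_I2 impI)
      fix x :: real assume "x \<in> {0<..}"
      then have "0 < x" by simp
      from bd[OF this] show "norm (2 * x powr (2 * s + 1) * g x) \<le> norm (C * (2 * x powr (2 * (s - real k) - 1) / (1 + x\<^sup>2)))"
        unfolding real_norm_def by linarith
    qed
  qed
qed

lemma tendsto_moment:
  assumes s: "real k < s" "s < real k + 1"
    and g: "\<And>m. g m \<in> borel_measurable borel" "h \<in> borel_measurable borel"
      "\<And>m \<mu>. M \<le> m \<Longrightarrow> 0 < \<mu> \<Longrightarrow> \<bar>g m \<mu>\<bar> \<le> C / (1 + \<mu>\<^sup>2) ^ (k + 2)"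
    and lim: "\<And>\<mu>. 0 < \<mu> \<Longrightarrow> (\<lambda>m. g m \<mu>) \<longlonglongrightarrow> h \<mu>"
  shows "(\<lambda>m. LINT \<mu>:{0<..}|lborel. 2 * \<mu> powr (2 * s + 1) * g m \<mu>)
    \<longlonglongrightarrow> (LINT \<mu>:{0<..}|lborel. 2 * \<mu> powr (2 * s + 1) * h \<mu>)"
proof -
  have [measurable]: "\<And>m. g m \<in> borel_measurable lborel" "h \<in> borel_measurable lborel" using g by auto
  note I = set_integrable_moment[OF s g(1) g(3)]
  have "(\<lambda>m. LINT \<mu>:{0<..}|lborel. 2 * \<mu> powr (2 * s + 1) * g (m + M) \<mu>)
    \<longlonglongrightarrow> (LINT \<mu>:{0<..}|lborel. 2 * \<mu> powr (2 * s + 1) * h \<mu>)"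
    unfolding set_lebesgue_integral_def
  proof (rule integral_dominated_convergence[where
        w = "\<lambda>\<mu>. indicator {0<..} \<mu> *\<^sub>R (C * (2 * \<mu> powr (2 * (s - real k) - 1) / (1 + \<mu>\<^sup>2)))"])
    show "integrable lborel (\<lambda>\<mu>. indicator {0<..} \<mu> *\<^sub>R (C * (2 * \<mu> powr (2 * (s - real k) - 1) / (1 + \<mu>\<^sup>2))))"
      using I(2)[of M] by (simp add: set_integrable_def)
    show "AE x in lborel. (\<lambda>m. indicator {0<..} x *\<^sub>R (2 * x powr (2 * s + 1) * g (m + M) x))
        \<longlonglongrightarrow> indicator {0<..} x *\<^sub>R (2 * x powr (2 * s + 1) * h x)"
    proof (intro AE_I2)
      fix x :: real
      show "(\<lambda>m. indicator {0<..} x *\<^sub>R (2 * x powr (2 * s + 1) * g (m + M) x))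
        \<longlonglongrightarrow> indicator {0<..} x *\<^sub>R (2 * x powr (2 * s + 1) * h x)"
      proof (cases "0 < x")
        case True
        show ?thesis using LIMSEQ_ignore_initial_segment[OF lim[OF True], of M] by (intro tendsto_intros)
      qed simp
    qed
    show "AE x in lborel. norm (indicator {0<..} x *\<^sub>R (2 * x powr (2 * s + 1) * g (m + M) x))
        \<le> indicator {0<..} x *\<^sub>R (C * (2 * x powr (2 * (s - real k) - 1) / (1 + x\<^sup>2)))" for m
      using I(1)[of "m + M"] by (intro AE_I2) (simp add: indicator_def)
  qed measurable
  then show ?thesis by (rule LIMSEQ_offset)
qed

text \<open>The substitution of \<open>\<mu> sqrt (a / m)\<close> for \<open>\<mu>\<close> makes the integrand converge, and both occurrences of the
node polynomial are normalised by its value at \<open>0\<close>.\<close>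

lemma scaled_interpolation_error:
  fixes a s :: real
  assumes a: "0 < a" "a < 1" and s: "real k < s" "s < real k + 1" and m: "1 \<le> m" "k \<le> m"
  shows "\<exists>L. degree L \<le> m \<and> (\<forall>y>0. y powr s - poly L y =
    - (sin (pi * s) / pi) * (poly (node_poly a m) y / node_scale a m) * (a / real m) powr (s + 1) *
      (LINT \<mu>:{0<..}|lborel. 2 * \<mu> powr (2 * s + 1) *
         (node_scale a m / poly (node_poly a m) (- (a * \<mu>\<^sup>2 / real m)) / (y + a * \<mu>\<^sup>2 / real m))))"
proof -
  obtain Z where Z: "finite Z" "card Z = Suc m" "\<And>z. z \<in> Z \<Longrightarrow> 0 < z \<and> poly (node_poly a m) z = 0"
    using node_poly_nodes[OF a m(1)] by blast
  define L where "L = (\<Sum>z\<in>Z. smult (z powr s) (lagrange_basis Z z))"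
  have Zne: "Z \<noteq> {}" using Z by auto
  have "degree L \<le> m" using degree_sum_lagrange_basis[OF Z(1) Zne] Z(2) by (simp add: L_def less_Suc_eq_le)
  define c where "c = sqrt (a / real m)"
  have am: "0 < a / real m" using a m by simp
  then have c: "0 < c" "c\<^sup>2 = a / real m" by (auto simp: c_def)
  have K: "node_scale a m \<noteq> 0" using node_scale_pos[OF a, of m] by simp
  have nz: "poly (node_poly a m) (- t) \<noteq> 0" if "0 < t" for t
  proof -
    have "(1 + t / 2) ^ Suc m > 0" using that by (intro zero_less_power) simp
    moreover have "(1 + t / 2) ^ Suc m \<le> poly (node_poly a m) (- t) / node_scale a m"
      using node_poly_lower_bound[OF a m(1)] that by simp
    ultimately have "0 < poly (node_poly a m) (- t) / node_scale a m" by linarith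
    then show ?thesis by auto
  qed
  have "y powr s - poly L y = - (sin (pi * s) / pi) * (poly (node_poly a m) y / node_scale a m) * (a / real m) powr (s + 1) *
      (LINT \<mu>:{0<..}|lborel. 2 * \<mu> powr (2 * s + 1) *
         (node_scale a m / poly (node_poly a m) (- (a * \<mu>\<^sup>2 / real m)) / (y + a * \<mu>\<^sup>2 / real m)))" if y: "0 < y" for y
  proof -
    define f where "f \<mu> = 2 * \<mu> powr (2 * s + 1) / (poly (node_poly a m) (- \<mu>\<^sup>2) * (y + \<mu>\<^sup>2))" for \<mu>
    define G where "G \<mu> = node_scale a m / poly (node_poly a m) (- (a * \<mu>\<^sup>2 / real m)) / (y + a * \<mu>\<^sup>2 / real m)" for \<mu>
    have fG: "c * f (c * \<mu>) = (a / real m) powr (s + 1) / node_scale a m * (2 * \<mu> powr (2 * s + 1) * G \<mu>)"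
      if \<mu>: "\<mu> \<in> {0<..}" for \<mu>
    proof -
      have "c * (c * \<mu>) powr (2 * s + 1) = (c powr 1 * c powr (2 * s + 1)) * \<mu> powr (2 * s + 1)"
        using c \<mu> by (simp add: powr_mult)
      also have "c powr 1 * c powr (2 * s + 1) = (c powr 2) powr (s + 1)"
        unfolding powr_add[symmetric] powr_powr by (simp add: algebra_simps)
      also have "c powr 2 = a / real m" using c by (simp add: powr_realpow)
      finally have 1: "c * (c * \<mu>) powr (2 * s + 1) = (a / real m) powr (s + 1) * \<mu> powr (2 * s + 1)" .
      have 2: "(c * \<mu>)\<^sup>2 = a * \<mu>\<^sup>2 / real m" by (simp add: power_mult_distrib c(2))
      have "c * f (c * \<mu>) = 2 * (c * (c * \<mu>) powr (2 * s + 1)) / (poly (node_poly a m) (- (c * \<mu>)\<^sup>2) * (y + (c * \<mu>)\<^sup>2))"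
        by (simp add: f_def)
      then show ?thesis unfolding 1 2 using K by (simp add: G_def)
    qed
    have "(LINT \<mu>:{0<..}|lborel. f \<mu>) = (LINT \<mu>:{0<..}|lborel. c * f (c * \<mu>))"
      using set_integral_scale(2)[OF c(1), of f] by simp
    also have "\<dots> = (LINT \<mu>:{0<..}|lborel. (a / real m) powr (s + 1) / node_scale a m * (2 * \<mu> powr (2 * s + 1) * G \<mu>))"
      using fG by (intro set_lebesgue_integral_cong) auto
    finally have "(LINT \<mu>:{0<..}|lborel. f \<mu>) = (a / real m) powr (s + 1) / node_scale a m *
        (LINT \<mu>:{0<..}|lborel. 2 * \<mu> powr (2 * s + 1) * G \<mu>)" by simp
    then show ?thesis
      using power_interpolation_error[OF s m(2) Z degree_node_poly nz y]
      by (simp add: L_def f_def G_def mult_ac)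
  qed
  then show ?thesis using \<open>degree L \<le> m\<close> by blast
qed

lemma borel_measurable_poly [measurable]: "poly P \<in> borel_measurable (borel :: real measure)"
  by (intro borel_measurable_continuous_onI continuous_intros)

locale gapped_power =
  fixes a s :: real and k :: nat
  assumes a: "0 < a" "a < 1" and s: "real k < s" "s < real k + 1"
begin

definition gapped :: "real set" where "gapped = {-1..-a} \<union> {a..1}"

text \<open>Tends to \<open>exp (- \<mu>\<^sup>2)\<close> as \<open>m\<close> grows.\<close>

definition kern :: "nat \<Rightarrow> real \<Rightarrow> real" where
  "kern m \<mu> = node_scale a m / poly (node_poly a m) (- (a * \<mu>\<^sup>2 / real m))"

definition moment :: "(real \<Rightarrow> real) \<Rightarrow> real" where
  "moment g = (LINT \<mu>:{0<..}|lborel. 2 * \<mu> powr (2 * s + 1) * g \<mu>)"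

text \<open>The common size of the alternating interpolation error, up to the factor \<open>moment (kern m)\<close>.\<close>

definition amplitude :: "nat \<Rightarrow> real" where
  "amplitude m = \<bar>sin (pi * s)\<bar> / pi * (a / real m) powr (s + 1) * (4 / ((1 + a)\<^sup>2 * node_scale a m))"

lemma s_pos: "0 < s" using s by linarith

lemma sin_nz: "sin (pi * s) \<noteq> 0"
proof
  assume "sin (pi * s) = 0"
  then obtain i where "pi * s = of_int i * pi" using sin_zero_iff_int2 by blast
  then have "s = of_int i" by simp
  then have "int k < i" "i < int k + 1" using s by linarith+
  then show False by linarith
qed

lemma kern_measurable [measurable]: "kern m \<in> borel_measurable borel"
  unfolding kern_def[abs_def] by measurable

lemma kern_nonneg: "0 \<le> kern m \<mu>" if "1 \<le> m"
proof -
  have t: "0 \<le> a * \<mu>\<^sup>2 / real m" using a by simp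
  have "0 \<le> (1 + a * \<mu>\<^sup>2 / real m / 2) ^ Suc m" using t by (intro zero_le_power add_nonneg_nonneg) auto
  then have "0 \<le> poly (node_poly a m) (- (a * \<mu>\<^sup>2 / real m)) / node_scale a m"
    using node_poly_lower_bound[OF a that t] by linarith
  then show ?thesis using node_scale_pos[OF a, of m] by (simp add: kern_def zero_le_divide_iff)
qed

definition kern_bound :: real where
  "kern_bound = 2 ^ (k + 2) * (1 + (2 * real (k + 2) / a) ^ (k + 2))"

lemma kern_le:
  assumes m: "k + 2 \<le> m"
  shows "kern m \<mu> \<le> kern_bound / (1 + \<mu>\<^sup>2) ^ (k + 2)"
proof -
  define t where "t = a * \<mu>\<^sup>2 / real m"
  have t: "0 \<le> t" using a by (simp add: t_def)
  have pos: "0 < (1 + t / 2) ^ Suc m" using t by (intro zero_less_power) linarith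
  have q: "0 < (1 + \<mu>\<^sup>2) ^ (k + 2)" by (intro zero_less_power) (simp add: add_pos_nonneg)
  have "kern m \<mu> = 1 / (poly (node_poly a m) (- t) / node_scale a m)"
    by (simp add: kern_def t_def)
  also have "\<dots> \<le> 1 / (1 + t / 2) ^ Suc m"
    using node_poly_lower_bound[OF a, of m t] m t pos by (intro divide_left_mono mult_pos_pos) linarith+
  also have "\<dots> \<le> kern_bound / (1 + \<mu>\<^sup>2) ^ (k + 2)"
  proof -
    have "(1 + \<mu>\<^sup>2) ^ (k + 2) \<le> kern_bound * (1 + t / 2) ^ Suc m"
      unfolding kern_bound_def t_def
      using power_dominated_by_exponential_approximant[OF a(1) _ m, of "\<mu>\<^sup>2"] by simp
    moreover have "1 / P \<le> C / Q" if "0 < P" "0 < Q" "Q \<le> C * P" for P Q C :: real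
      using that by (simp add: field_simps)
    ultimately show ?thesis using pos q by blast
  qed
  finally show ?thesis .
qed

lemma kern_limit: "(\<lambda>m. kern m \<mu>) \<longlonglongrightarrow> exp (- \<mu>\<^sup>2)"
proof -
  have "(\<lambda>m. poly (node_poly a m) (a * (- \<mu>\<^sup>2) / real m) / node_scale a m - exp (- (- \<mu>\<^sup>2))) \<longlonglongrightarrow> 0"
    by (rule node_poly_limit[OF a]) auto
  then have "(\<lambda>m. poly (node_poly a m) (- (a * \<mu>\<^sup>2 / real m)) / node_scale a m) \<longlonglongrightarrow> exp (\<mu>\<^sup>2)"
    by (simp add: LIM_zero_iff)
  then have "(\<lambda>m. inverse (poly (node_poly a m) (- (a * \<mu>\<^sup>2 / real m)) / node_scale a m)) \<longlonglongrightarrow> inverse (exp (\<mu>\<^sup>2))"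
    by (rule tendsto_inverse) simp
  then show ?thesis by (simp add: kern_def exp_minus)
qed

lemma gauss_le: "exp (- \<mu>\<^sup>2) \<le> kern_bound / (1 + \<mu>\<^sup>2) ^ (k + 2)"
proof (rule tendsto_upperbound[OF kern_limit])
  show "\<forall>\<^sub>F m in sequentially. kern m \<mu> \<le> kern_bound / (1 + \<mu>\<^sup>2) ^ (k + 2)"
    using eventually_ge_at_top[of "k + 2"] by eventually_elim (rule kern_le)
qed simp

lemma moment_mono:
  assumes "g \<in> borel_measurable borel" "h \<in> borel_measurable borel"
    and "\<And>\<mu>. 0 < \<mu> \<Longrightarrow> 0 \<le> g \<mu> \<and> g \<mu> \<le> h \<mu> \<and> h \<mu> \<le> C / (1 + \<mu>\<^sup>2) ^ (k + 2)"
  shows "0 \<le> moment g" "moment g \<le> moment h"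
proof -
  have g: "\<bar>g \<mu>\<bar> \<le> C / (1 + \<mu>\<^sup>2) ^ (k + 2)" and h: "\<bar>h \<mu>\<bar> \<le> C / (1 + \<mu>\<^sup>2) ^ (k + 2)" if "0 < \<mu>" for \<mu>
    using assms(3)[OF that] by linarith+
  show "moment g \<le> moment h" unfolding moment_def
    using set_integrable_moment(3)[OF s assms(1) g] set_integrable_moment(3)[OF s assms(2) h] assms(3)
    by (intro set_integral_mono mult_left_mono) auto
  show "0 \<le> moment g" unfolding moment_def set_lebesgue_integral_def
    using assms(3) by (intro integral_nonneg_AE AE_I2) (auto simp: indicator_def)
qed

lemma moment_tendsto:
  assumes "\<And>m. g m \<in> borel_measurable borel" "h \<in> borel_measurable borel"
    and "\<And>m \<mu>. M \<le> m \<Longrightarrow> 0 < \<mu> \<Longrightarrow> \<bar>g m \<mu>\<bar> \<le> C / (1 + \<mu>\<^sup>2) ^ (k + 2)"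
    and "\<And>\<mu>. 0 < \<mu> \<Longrightarrow> (\<lambda>m. g m \<mu>) \<longlonglongrightarrow> h \<mu>"
  shows "(\<lambda>m. moment (g m)) \<longlonglongrightarrow> moment h"
  unfolding moment_def using tendsto_moment[OF s assms] .

lemma moment_gauss: "moment (\<lambda>\<mu>. exp (- \<mu>\<^sup>2)) = Gamma (s + 1)"
  unfolding moment_def by (rule gaussian_moment[OF s_pos])

lemma moment_kern_limit: "(\<lambda>m. moment (kern m)) \<longlonglongrightarrow> Gamma (s + 1)"
  unfolding moment_gauss[symmetric]
proof (rule moment_tendsto)
  show "\<bar>kern m \<mu>\<bar> \<le> kern_bound / (1 + \<mu>\<^sup>2) ^ (k + 2)" if "k + 2 \<le> m" for m \<mu>
    using kern_le[OF that, of \<mu>] kern_nonneg[of m \<mu>] that by simp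
  show "(\<lambda>m. kern m \<mu>) \<longlonglongrightarrow> exp (- \<mu>\<^sup>2)" for \<mu> by (rule kern_limit)
qed measurable

lemma damping_bounds:
  assumes "0 < y"
  shows "0 \<le> y / (y + a * \<mu>\<^sup>2 / real m)" "y / (y + a * \<mu>\<^sup>2 / real m) \<le> 1"
proof -
  have "0 \<le> a * \<mu>\<^sup>2 / real m" using a by simp
  then show "0 \<le> y / (y + a * \<mu>\<^sup>2 / real m)" "y / (y + a * \<mu>\<^sup>2 / real m) \<le> 1"
    using assms by (auto simp: divide_le_eq)
qed

lemma moment_damped_limit: "(\<lambda>m. moment (\<lambda>\<mu>. kern m \<mu> * (a\<^sup>2 / (a\<^sup>2 + a * \<mu>\<^sup>2 / real m)))) \<longlonglongrightarrow> Gamma (s + 1)"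
  unfolding moment_gauss[symmetric]
proof (rule moment_tendsto)
  have a2: "0 < a\<^sup>2" using a by simp
  show "\<bar>kern m \<mu> * (a\<^sup>2 / (a\<^sup>2 + a * \<mu>\<^sup>2 / real m))\<bar> \<le> kern_bound / (1 + \<mu>\<^sup>2) ^ (k + 2)" if m: "k + 2 \<le> m" for m \<mu>
  proof -
    have K: "0 \<le> kern m \<mu>" using kern_nonneg[of m \<mu>] m by simp
    have "kern m \<mu> * (a\<^sup>2 / (a\<^sup>2 + a * \<mu>\<^sup>2 / real m)) \<le> kern m \<mu> * 1"
      using damping_bounds[OF a2, of \<mu> m] K by (intro mult_left_mono)
    then show ?thesis
      using kern_le[OF m, of \<mu>] abs_of_nonneg[OF mult_nonneg_nonneg[OF K damping_bounds(1)[OF a2, of \<mu> m]]]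
      by linarith
  qed
  show "(\<lambda>m. kern m \<mu> * (a\<^sup>2 / (a\<^sup>2 + a * \<mu>\<^sup>2 / real m))) \<longlonglongrightarrow> exp (- \<mu>\<^sup>2)" for \<mu>
  proof -
    have "(\<lambda>m. a * \<mu>\<^sup>2 * (1 / real m)) \<longlonglongrightarrow> a * \<mu>\<^sup>2 * 0" using lim_1_over_n by (intro tendsto_intros)
    then have "(\<lambda>m. a * \<mu>\<^sup>2 / real m) \<longlonglongrightarrow> 0" by simp
    then have "(\<lambda>m. kern m \<mu> * (a\<^sup>2 / (a\<^sup>2 + a * \<mu>\<^sup>2 / real m))) \<longlonglongrightarrow> exp (- \<mu>\<^sup>2) * (a\<^sup>2 / (a\<^sup>2 + 0))"
      using kern_limit a2 by (intro tendsto_intros) auto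
    then show ?thesis using a2 by simp
  qed
qed measurable

definition stieltjes :: "nat \<Rightarrow> real \<Rightarrow> real" where
  "stieltjes m y = moment (\<lambda>\<mu>. kern m \<mu> / (y + a * \<mu>\<^sup>2 / real m))"

text \<open>The factor \<open>y / (y + t)\<close> increases with \<open>y\<close> and stays below \<open>1\<close>, so its effect on the interval is
squeezed between the value at the endpoint \<open>a\<^sup>2\<close> and the undamped moment.\<close>

lemma stieltjes_bounds:
  assumes m: "k + 2 \<le> m" and y: "a\<^sup>2 \<le> y"
  shows "moment (\<lambda>\<mu>. kern m \<mu> * (a\<^sup>2 / (a\<^sup>2 + a * \<mu>\<^sup>2 / real m))) \<le> y * stieltjes m y"
    and "y * stieltjes m y \<le> moment (kern m)"
proof -
  have a2: "0 < a\<^sup>2" using a by simp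
  then have y0: "0 < y" using y by linarith
  have eq: "y * stieltjes m y = moment (\<lambda>\<mu>. kern m \<mu> * (y / (y + a * \<mu>\<^sup>2 / real m)))"
    unfolding stieltjes_def moment_def set_integral_mult_right[symmetric]
    by (intro set_lebesgue_integral_cong) auto
  have K: "0 \<le> kern m \<mu>" for \<mu> using kern_nonneg[of m \<mu>] m by simp
  have le: "kern m \<mu> * (y / (y + a * \<mu>\<^sup>2 / real m)) \<le> kern m \<mu>" for \<mu>
    using mult_left_mono[OF damping_bounds(2)[OF y0, of \<mu> m] K[of \<mu>]] by simp
  show "y * stieltjes m y \<le> moment (kern m)"
    unfolding eq
  proof (rule moment_mono(2))
    show "0 \<le> kern m \<mu> * (y / (y + a * \<mu>\<^sup>2 / real m)) \<and>
        kern m \<mu> * (y / (y + a * \<mu>\<^sup>2 / real m)) \<le> kern m \<mu> \<and> kern m \<mu> \<le> kern_bound / (1 + \<mu>\<^sup>2) ^ (k + 2)" for \<mu>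
      using K damping_bounds(1)[OF y0, of \<mu> m] le kern_le[OF m] by (intro conjI mult_nonneg_nonneg)
  qed measurable
  show "moment (\<lambda>\<mu>. kern m \<mu> * (a\<^sup>2 / (a\<^sup>2 + a * \<mu>\<^sup>2 / real m))) \<le> y * stieltjes m y"
    unfolding eq
  proof (rule moment_mono(2))
    fix \<mu> :: real
    have t: "0 \<le> a * \<mu>\<^sup>2 / real m" using a by simp
    have "a\<^sup>2 * (y + a * \<mu>\<^sup>2 / real m) \<le> y * (a\<^sup>2 + a * \<mu>\<^sup>2 / real m)"
      using mult_right_mono[OF y t] by (simp only: distrib_left mult.commute[of y "a\<^sup>2"])
    then have "a\<^sup>2 / (a\<^sup>2 + a * \<mu>\<^sup>2 / real m) \<le> y / (y + a * \<mu>\<^sup>2 / real m)"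
    proof -
      have A: "0 < a\<^sup>2 + a * \<mu>\<^sup>2 / real m" and B: "0 < y + a * \<mu>\<^sup>2 / real m"
        using a2 y0 t by linarith+
      show ?thesis
        unfolding pos_divide_le_eq[OF A] times_divide_eq_left pos_le_divide_eq[OF B]
        using \<open>a\<^sup>2 * (y + a * \<mu>\<^sup>2 / real m) \<le> y * (a\<^sup>2 + a * \<mu>\<^sup>2 / real m)\<close> .
    qed
    then have "kern m \<mu> * (a\<^sup>2 / (a\<^sup>2 + a * \<mu>\<^sup>2 / real m)) \<le> kern m \<mu> * (y / (y + a * \<mu>\<^sup>2 / real m))"
      using K by (rule mult_left_mono)
    moreover have "0 \<le> kern m \<mu> * (a\<^sup>2 / (a\<^sup>2 + a * \<mu>\<^sup>2 / real m))"
      using K damping_bounds(1)[OF a2, of \<mu> m] by (rule mult_nonneg_nonneg)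
    ultimately show "0 \<le> kern m \<mu> * (a\<^sup>2 / (a\<^sup>2 + a * \<mu>\<^sup>2 / real m)) \<and>
        kern m \<mu> * (a\<^sup>2 / (a\<^sup>2 + a * \<mu>\<^sup>2 / real m)) \<le> kern m \<mu> * (y / (y + a * \<mu>\<^sup>2 / real m)) \<and>
        kern m \<mu> * (y / (y + a * \<mu>\<^sup>2 / real m)) \<le> kern_bound / (1 + \<mu>\<^sup>2) ^ (k + 2)"
      using le[of \<mu>] kern_le[OF m, of \<mu>] by linarith
  qed measurable
qed

lemma stieltjes_nonneg:
  assumes "1 \<le> m" "0 < y" shows "0 \<le> stieltjes m y"
  unfolding stieltjes_def moment_def set_lebesgue_integral_def
proof (intro integral_nonneg_AE AE_I2)
  fix \<mu> :: real
  have "0 \<le> a * \<mu>\<^sup>2 / real m" using a by simp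
  then have "0 \<le> kern m \<mu> / (y + a * \<mu>\<^sup>2 / real m)"
    using kern_nonneg[OF assms(1), of \<mu>] assms(2) by (intro divide_nonneg_nonneg) auto
  then show "0 \<le> indicator {0<..} \<mu> *\<^sub>R (2 * \<mu> powr (2 * s + 1) * (kern m \<mu> / (y + a * \<mu>\<^sup>2 / real m)))"
    by (intro scaleR_nonneg_nonneg mult_nonneg_nonneg) auto
qed

text \<open>The error formula is all that is needed from interpolation at the zeros of the node polynomial.\<close>

definition is_interpolant :: "nat \<Rightarrow> real poly \<Rightarrow> bool" where
  "is_interpolant m L \<longleftrightarrow> degree L \<le> m \<and> (\<forall>y>0. y powr s - poly L y =
    - (sin (pi * s) / pi) * (poly (node_poly a m) y / node_scale a m) * (a / real m) powr (s + 1) * stieltjes m y)"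

lemma interpolant_exists:
  assumes "k + 2 \<le> m" shows "\<exists>L. is_interpolant m L"
  using scaled_interpolation_error[OF a s, of m] assms
  unfolding is_interpolant_def stieltjes_def moment_def kern_def by auto

lemma interpolant_error_le:
  assumes m: "k + 2 \<le> m" and L: "is_interpolant m L" and y: "y \<in> {a\<^sup>2..1}"
  shows "\<bar>y powr s - poly L y\<bar> \<le> amplitude m * moment (kern m)"
proof -
  have m1: "1 \<le> m" using m by simp
  have "0 < a\<^sup>2" using a by simp
  moreover have "a\<^sup>2 \<le> y" using y by simp
  ultimately have y0: "0 < y" by linarith
  have K: "0 < node_scale a m" by (rule node_scale_pos[OF a])
  have "\<bar>y powr s - poly L y\<bar> = \<bar>sin (pi * s)\<bar> / pi * (\<bar>poly (node_poly a m) y\<bar> / node_scale a m)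
      * (a / real m) powr (s + 1) * stieltjes m y"
    using L y0 K stieltjes_nonneg[OF m1 y0] unfolding is_interpolant_def by (simp add: abs_mult)
  also have "\<dots> \<le> \<bar>sin (pi * s)\<bar> / pi * ((4 * y / (1 + a)\<^sup>2) / node_scale a m)
      * (a / real m) powr (s + 1) * stieltjes m y"
    using abs_node_poly_le[OF a m1 y] K stieltjes_nonneg[OF m1 y0]
    by (intro mult_right_mono mult_left_mono divide_right_mono) auto
  also have "\<dots> = amplitude m * (y * stieltjes m y)" by (simp add: amplitude_def)
  also have "\<dots> \<le> amplitude m * moment (kern m)"
    using stieltjes_bounds(2)[OF m] y K by (intro mult_left_mono) (auto simp: amplitude_def)
  finally show ?thesis .
qed

section \<open>The approximation error on the two intervals\<close>

lemma compact_gapped: "compact gapped"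
  unfolding gapped_def by (intro compact_Un) auto

lemma infinite_gapped: "infinite gapped"
proof -
  have "infinite {a..1}" using a by (simp add: infinite_Icc_iff)
  then show ?thesis unfolding gapped_def by simp
qed

lemma gapped_nonempty: "gapped \<noteq> {}" using infinite_gapped by auto

lemma uminus_gapped: "x \<in> gapped \<Longrightarrow> - x \<in> gapped"
  by (auto simp: gapped_def)

lemma continuous_on_abs_powr: "continuous_on gapped (\<lambda>x. \<bar>x\<bar> powr (2 * s))"
  using a by (intro continuous_intros) (auto simp: gapped_def)

lemma square_gapped:
  assumes "x \<in> gapped" shows "x\<^sup>2 \<in> {a\<^sup>2..1}" "\<bar>x\<bar> powr (2 * s) = (x\<^sup>2) powr s"
proof -
  have x: "a \<le> \<bar>x\<bar>" "\<bar>x\<bar> \<le> 1" using assms a by (auto simp: gapped_def)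
  have "a\<^sup>2 \<le> \<bar>x\<bar>\<^sup>2" "\<bar>x\<bar>\<^sup>2 \<le> 1\<^sup>2" using x a by (intro power_mono; simp)+
  then show "x\<^sup>2 \<in> {a\<^sup>2..1}" by simp
  have "0 < \<bar>x\<bar>" using x a by linarith
  then have "x\<^sup>2 = \<bar>x\<bar> powr 2" by (simp add: powr_realpow)
  then show "\<bar>x\<bar> powr (2 * s) = (x\<^sup>2) powr s" by (simp only: powr_powr)
qed

lemma sqrt_in_gapped:
  assumes "y \<in> {a\<^sup>2..1}" shows "sqrt y \<in> gapped"
proof -
  have "sqrt (a\<^sup>2) \<le> sqrt y" "sqrt y \<le> sqrt 1" using assms by (auto simp only: real_sqrt_le_iff atLeastAtMost_iff)
  then show ?thesis using a by (simp add: gapped_def)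
qed

lemma approx_error_gapped:
  "approx_error n (2 * s) a = min_uniform_error gapped (\<lambda>x. \<bar>x\<bar> powr (2 * s)) n"
  unfolding approx_error_def gapped_def ..

lemma best_poly_gapped:
  "best_poly m (2 * s) a = best_approx_poly gapped (\<lambda>x. \<bar>x\<bar> powr (2 * s)) (2 * m)"
  unfolding best_poly_def gapped_def ..

lemma even_part_error_le:
  assumes D: "\<And>x. poly D (x\<^sup>2) = (poly Q x + poly Q (- x)) / 2" and y: "y \<in> {a\<^sup>2..1}"
  shows "\<bar>y powr s - poly D y\<bar> \<le> uniform_error gapped (\<lambda>x. \<bar>x\<bar> powr (2 * s)) Q"
proof -
  define x where "x = sqrt y"
  have x: "x \<in> gapped" "- x \<in> gapped" using sqrt_in_gapped[OF y] uminus_gapped by (auto simp: x_def)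
  have "0 \<le> y" using y order_trans[OF zero_le_power2, of a y] by simp
  then have x2: "x\<^sup>2 = y" by (simp add: x_def)
  have fx: "\<bar>x\<bar> powr (2 * s) = y powr s" using square_gapped(2)[OF x(1)] x2 by simp
  define E where "E = uniform_error gapped (\<lambda>x. \<bar>x\<bar> powr (2 * s)) Q"
  have "\<bar>y powr s - poly Q x\<bar> \<le> E" "\<bar>y powr s - poly Q (- x)\<bar> \<le> E"
    using error_le_uniform_error[OF compact_gapped continuous_on_abs_powr x(1), of Q]
      error_le_uniform_error[OF compact_gapped continuous_on_abs_powr x(2), of Q]
    unfolding fx abs_minus_cancel E_def by simp_all
  moreover have "poly D y = (poly Q x + poly Q (- x)) / 2" using D[of x] x2 by simp
  ultimately show ?thesis unfolding E_def[symmetric] by (simp add: abs_le_iff field_simps)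
qed

lemma approx_error_upper:
  assumes m: "k + 2 \<le> m"
  shows "approx_error (2 * m) (2 * s) a \<le> amplitude m * moment (kern m)"
proof -
  obtain L where L: "is_interpolant m L" using interpolant_exists[OF m] by blast
  define Q where "Q = pcompose L [:0, 0, 1:]"
  have Q: "poly Q x = poly L (x\<^sup>2)" for x by (simp add: Q_def poly_pcompose power2_eq_square)
  have "degree L \<le> m" using L by (simp add: is_interpolant_def)
  moreover have "degree Q \<le> degree L * degree [:0, 0, 1 :: real:]"
    unfolding Q_def by (rule degree_pcompose_le)
  ultimately have "degree Q \<le> 2 * m" by simp
  then have "approx_error (2 * m) (2 * s) a \<le> uniform_error gapped (\<lambda>x. \<bar>x\<bar> powr (2 * s)) Q"
    unfolding approx_error_gapped
    by (rule min_uniform_error_le[OF compact_gapped continuous_on_abs_powr gapped_nonempty])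
  also have "\<dots> \<le> amplitude m * moment (kern m)"
  proof (rule uniform_error_le[OF gapped_nonempty])
    fix x assume x: "x \<in> gapped"
    show "\<bar>\<bar>x\<bar> powr (2 * s) - poly Q x\<bar> \<le> amplitude m * moment (kern m)"
      unfolding Q square_gapped(2)[OF x]
      by (rule interpolant_error_le[OF m L square_gapped(1)[OF x]])
  qed
  finally show ?thesis .
qed

text \<open>The interpolation error alternates with the node polynomial, so the de la Vallee Poussin bound
applies to the even part of any competitor.\<close>

lemma approx_error_lower:
  assumes m: "k + 2 \<le> m"
  shows "amplitude m * moment (\<lambda>\<mu>. kern m \<mu> * (a\<^sup>2 / (a\<^sup>2 + a * \<mu>\<^sup>2 / real m))) \<le> approx_error (2 * m) (2 * s) a"
  unfolding approx_error_gapped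
proof (rule le_min_uniform_error)
  fix Q :: "real poly" assume Q: "degree Q \<le> 2 * m"
  have m1: "1 \<le> m" using m by simp
  obtain L where L: "is_interpolant m L" using interpolant_exists[OF m] by blast
  obtain D where D: "degree D \<le> m" "\<And>x. poly D (x\<^sup>2) = (poly Q x + poly Q (- x)) / 2"
    using even_part_of_poly[OF Q] by blast
  obtain y :: "nat \<Rightarrow> real" where y: "\<And>j. j \<le> Suc m \<Longrightarrow> y j \<in> {a\<^sup>2..1} \<and>
      poly (node_poly a m) (y j) = (-1) ^ j * (4 * y j / (1 + a)\<^sup>2)" "\<And>j. j < Suc m \<Longrightarrow> y j < y (Suc j)"
    using node_poly_alternates[OF a m1] by blast
  define I where "I = moment (\<lambda>\<mu>. kern m \<mu> * (a\<^sup>2 / (a\<^sup>2 + a * \<mu>\<^sup>2 / real m)))"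
  \<comment> \<open>The sign of the prefactor in the interpolation error at the first alternation point.\<close>
  define \<sigma> where "\<sigma> = - sgn (sin (pi * s))"
  have \<sigma>: "\<bar>\<sigma>\<bar> = 1" using sin_nz by (simp add: \<sigma>_def abs_sgn_eq)
  have K: "0 < node_scale a m" by (rule node_scale_pos[OF a])
  have "amplitude m * I \<le> (- 1) ^ j * (\<sigma> * (y j powr s - poly L (y j)))" if j: "j \<le> Suc m" for j
  proof -
    have "0 < a\<^sup>2" using a by simp
    moreover have yj: "a\<^sup>2 \<le> y j" using y(1)[OF j] by simp
    ultimately have y0: "0 < y j" by linarith
    have "y j powr s - poly L (y j) = - (sin (pi * s) / pi) * (poly (node_poly a m) (y j) / node_scale a m)
        * (a / real m) powr (s + 1) * stieltjes m (y j)"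
      using L y0 unfolding is_interpolant_def by blast
    also have "poly (node_poly a m) (y j) = (-1) ^ j * (4 * y j / (1 + a)\<^sup>2)" using y(1)[OF j] by blast
    finally have "(- 1) ^ j * (\<sigma> * (y j powr s - poly L (y j)))
        = ((- 1) ^ j * (- 1) ^ j) * (\<sigma> * (- sin (pi * s))) / pi * (4 * y j / (1 + a)\<^sup>2 / node_scale a m)
        * (a / real m) powr (s + 1) * stieltjes m (y j)" by simp
    also have "(- 1) ^ j * (- 1) ^ j = (1::real)" by (simp flip: power_mult_distrib)
    also have "\<sigma> * (- sin (pi * s)) = \<bar>sin (pi * s)\<bar>" by (simp add: \<sigma>_def sgn_if abs_if)
    finally have eq: "(- 1) ^ j * (\<sigma> * (y j powr s - poly L (y j))) = amplitude m * (y j * stieltjes m (y j))"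
      by (simp add: amplitude_def)
    show ?thesis unfolding eq I_def using K
      by (intro mult_left_mono stieltjes_bounds(1)[OF m yj]) (auto simp: amplitude_def)
  qed
  then have "\<exists>j\<le>Suc m. amplitude m * I \<le> \<bar>y j powr s - poly D (y j)\<bar>"
    using L y(2) by (intro alternation_imp_error_ge[OF D(1), where \<sigma> = \<sigma> and L = L]) (auto simp: is_interpolant_def \<sigma>)
  then obtain j where "j \<le> Suc m" "amplitude m * I \<le> \<bar>y j powr s - poly D (y j)\<bar>" by blast
  then show "amplitude m * moment (\<lambda>\<mu>. kern m \<mu> * (a\<^sup>2 / (a\<^sup>2 + a * \<mu>\<^sup>2 / real m)))
      \<le> uniform_error gapped (\<lambda>x. \<bar>x\<bar> powr (2 * s)) Q"
    using even_part_error_le[OF D(2), of "y j"] y(1)[of j] unfolding I_def by fastforce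
qed

definition error_const :: real where
  "error_const = a powr (s - 1) * ((1 + a)\<^sup>2 / 2) * (\<bar>sin (pi * s)\<bar> / pi)"

lemma amplitude_asymptotics:
  assumes m: "1 \<le> m"
  shows "outer_rate a ^ Suc m * real m powr (s + 1) * amplitude m = error_const"
proof -
  define w where "w = outer_rate a"
  have w: "w > 1" using outer_rate_gt_1[OF a] by (simp add: w_def)
  have "1 - (1 / w)\<^sup>2 = 4 * a / (1 + a)\<^sup>2"
  proof -
    have "1 - (1 / w)\<^sup>2 = (1 + a)\<^sup>2 / (1 + a)\<^sup>2 - (1 - a)\<^sup>2 / (1 + a)\<^sup>2"
      using a unfolding w_def inverse_outer_rate power_divide[of "1 - a"] by simp
    also have "\<dots> = ((1 + a)\<^sup>2 - (1 - a)\<^sup>2) / (1 + a)\<^sup>2" by (rule diff_divide_distrib[symmetric])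
    also have "(1 + a)\<^sup>2 - (1 - a)\<^sup>2 = 4 * a" by (simp add: power2_eq_square algebra_simps)
    finally show ?thesis .
  qed
  then have K: "node_scale a m = w ^ Suc m * (4 * a / (1 + a)\<^sup>2)\<^sup>2 / 2"
    unfolding node_scale_def w_def[symmetric] by simp
  have "a powr (s + 1) = a powr (s - 1) * a powr 2" unfolding powr_add[symmetric] by (simp add: add.commute)
  then have as: "a powr (s + 1) = a powr (s - 1) * a\<^sup>2" using a by (simp add: powr_realpow)
  have "real m powr (s + 1) * (a / real m) powr (s + 1) = a powr (s - 1) * a\<^sup>2"
    unfolding as[symmetric] using a m by (simp flip: powr_mult)
  then have "outer_rate a ^ Suc m * real m powr (s + 1) * amplitude m
      = \<bar>sin (pi * s)\<bar> / pi * (a powr (s - 1) * a\<^sup>2) * (w ^ Suc m * (4 / ((1 + a)\<^sup>2 * node_scale a m)))"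
    unfolding amplitude_def w_def by (simp add: mult_ac)
  also have "w ^ Suc m * (4 / ((1 + a)\<^sup>2 * node_scale a m)) = (1 + a)\<^sup>2 / (2 * a\<^sup>2)"
  proof -
    have "W * (4 / (q * (W * (4 * a / q)\<^sup>2 / 2))) = q / (2 * a\<^sup>2)" if "0 < W" "0 < q" for W q :: real
      using that a by (simp add: power2_eq_square field_simps)
    then show ?thesis unfolding K using w a by simp
  qed
  also have "\<bar>sin (pi * s)\<bar> / pi * (a powr (s - 1) * a\<^sup>2) * ((1 + a)\<^sup>2 / (2 * a\<^sup>2)) = error_const"
    unfolding error_const_def using a by (simp add: mult_ac)
  finally show ?thesis .
qed

lemma error_const_Gamma:
  "error_const * Gamma (s + 1) = a powr (s - 1) * ((1 + a)\<^sup>2 / (2 * \<bar>Gamma (- s)\<bar>))"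
proof -
  have G: "Gamma (s + 1) > 0" using s_pos by (intro Gamma_real_pos) simp
  have "Gamma (- s) * Gamma (s + 1) = - (pi / sin (pi * s))"
    using Gamma_reflection_real[of "- s"] by (simp add: add.commute)
  then have "\<bar>Gamma (- s)\<bar> * Gamma (s + 1) = pi / \<bar>sin (pi * s)\<bar>"
    using G by (metis abs_divide abs_minus_cancel abs_mult abs_of_pos pi_gt_zero)
  then have "pi / (\<bar>sin (pi * s)\<bar> * Gamma (s + 1)) = \<bar>Gamma (- s)\<bar> * Gamma (s + 1) / Gamma (s + 1)"
    by simp
  then have "\<bar>Gamma (- s)\<bar> = pi / (\<bar>sin (pi * s)\<bar> * Gamma (s + 1))" using G by simp
  then show ?thesis using G sin_nz by (simp add: error_const_def)
qed

lemma approx_error_limit: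
  "(\<lambda>m. outer_rate a ^ Suc m * real m powr (s + 1) * approx_error (2 * m) (2 * s) a)
     \<longlonglongrightarrow> error_const * Gamma (s + 1)"
proof (rule tendsto_sandwich[where f = "\<lambda>m. error_const * moment (\<lambda>\<mu>. kern m \<mu> * (a\<^sup>2 / (a\<^sup>2 + a * \<mu>\<^sup>2 / real m)))"
      and h = "\<lambda>m. error_const * moment (kern m)"])
  show "(\<lambda>m. error_const * moment (kern m)) \<longlonglongrightarrow> error_const * Gamma (s + 1)"
    by (intro tendsto_intros moment_kern_limit)
  show "(\<lambda>m. error_const * moment (\<lambda>\<mu>. kern m \<mu> * (a\<^sup>2 / (a\<^sup>2 + a * \<mu>\<^sup>2 / real m)))) \<longlonglongrightarrow> error_const * Gamma (s + 1)"
    by (intro tendsto_intros moment_damped_limit)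
  have w: "0 \<le> outer_rate a ^ Suc m * real m powr (s + 1)" for m
    using outer_rate_gt_1[OF a] by simp
  show "\<forall>\<^sub>F m in sequentially. outer_rate a ^ Suc m * real m powr (s + 1) * approx_error (2 * m) (2 * s) a
      \<le> error_const * moment (kern m)"
    using eventually_ge_at_top[of "k + 2"]
  proof eventually_elim
    case (elim m)
    then have m: "1 \<le> m" by simp
    show ?case unfolding amplitude_asymptotics[OF m, symmetric] mult.assoc[of _ "amplitude m"]
      using approx_error_upper[OF elim] w by (rule mult_left_mono)
  qed
  show "\<forall>\<^sub>F m in sequentially. error_const * moment (\<lambda>\<mu>. kern m \<mu> * (a\<^sup>2 / (a\<^sup>2 + a * \<mu>\<^sup>2 / real m)))
      \<le> outer_rate a ^ Suc m * real m powr (s + 1) * approx_error (2 * m) (2 * s) a"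
    using eventually_ge_at_top[of "k + 2"]
  proof eventually_elim
    case (elim m)
    then have m: "1 \<le> m" by simp
    show ?case unfolding amplitude_asymptotics[OF m, symmetric] mult.assoc[of _ "amplitude m"]
      using approx_error_lower[OF elim] w by (rule mult_left_mono)
  qed
qed

section \<open>The best polynomial near the origin\<close>

text \<open>By uniqueness the best polynomial coincides with its reflection.\<close>

lemma best_poly_even:
  "\<exists>D. degree D \<le> m \<and> (\<forall>x. poly (best_poly m (2 * s) a) x = poly D (x\<^sup>2)) \<and>
     (\<forall>y\<in>{a\<^sup>2..1}. \<bar>y powr s - poly D y\<bar> \<le> approx_error (2 * m) (2 * s) a)"
proof -
  define f where "f x = \<bar>x\<bar> powr (2 * s)" for x :: real
  have f: "continuous_on gapped f" unfolding f_def[abs_def] by (rule continuous_on_abs_powr)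
  define P where "P = best_approx_poly gapped f (2 * m)"
  define Q where "Q = pcompose P [:0, -1:]"
  have Qx: "poly Q x = poly P (- x)" for x by (simp add: Q_def poly_pcompose)
  note P = best_approx_poly_best[OF compact_gapped f infinite_gapped, of "2 * m", folded P_def]
  have degQ: "degree Q \<le> 2 * m" using P(1) degree_pcompose_le[of P "[:0, -1:]"] by (simp add: Q_def)
  have "uniform_error gapped f Q \<le> uniform_error gapped f P"
  proof (rule uniform_error_le[OF gapped_nonempty])
    fix x assume "x \<in> gapped"
    then show "\<bar>f x - poly Q x\<bar> \<le> uniform_error gapped f P"
      using error_le_uniform_error[OF compact_gapped f uminus_gapped, of x P] by (simp add: Qx f_def)
  qed
  then have "uniform_error gapped f Q = min_uniform_error gapped f (2 * m)"
    using min_uniform_error_le[OF compact_gapped f gapped_nonempty degQ] P(2) by simp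
  then have "P = Q"
    using best_approx_poly_eqI[OF compact_gapped f infinite_gapped degQ] by (simp add: P_def)
  then have ev: "poly P (- x) = poly P x" for x using Qx[of x] by simp
  obtain D where D: "degree D \<le> m" "\<And>x. poly D (x\<^sup>2) = (poly P x + poly P (- x)) / 2"
    using even_part_of_poly[OF P(1)] by blast
  have "\<bar>y powr s - poly D y\<bar> \<le> approx_error (2 * m) (2 * s) a" if "y \<in> {a\<^sup>2..1}" for y
    using even_part_error_le[OF D(2) that] P(2) unfolding approx_error_gapped f_def by simp
  then show ?thesis
    unfolding best_poly_gapped using D ev by (intro exI[of _ D]) (simp add: P_def f_def[abs_def])
qed

definition limit_fun :: "real \<Rightarrow> real" where
  "limit_fun l = l powr (2 * s) + sin (pi * s) / pi * (exp (- l\<^sup>2) * moment (\<lambda>\<mu>. exp (- \<mu>\<^sup>2) / (l\<^sup>2 + \<mu>\<^sup>2)))"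

lemma moment_eq_integral:
  "(LINT \<mu>:{0..}|lborel. \<mu> powr (2 * s) * exp (- (l\<^sup>2 + \<mu>\<^sup>2)) * (2 * \<mu> / (l\<^sup>2 + \<mu>\<^sup>2)))
     = exp (- l\<^sup>2) * moment (\<lambda>\<mu>. exp (- \<mu>\<^sup>2) / (l\<^sup>2 + \<mu>\<^sup>2))"
  unfolding moment_def set_integral_mult_right[symmetric] unfolding set_lebesgue_integral_def
proof (rule Bochner_Integration.integral_cong[OF refl])
  fix \<mu> :: real
  show "indicator {0..} \<mu> *\<^sub>R (\<mu> powr (2 * s) * exp (- (l\<^sup>2 + \<mu>\<^sup>2)) * (2 * \<mu> / (l\<^sup>2 + \<mu>\<^sup>2)))
      = indicator {0<..} \<mu> *\<^sub>R (exp (- l\<^sup>2) * (2 * \<mu> powr (2 * s + 1) * (exp (- \<mu>\<^sup>2) / (l\<^sup>2 + \<mu>\<^sup>2))))"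
  proof (cases "0 < \<mu>")
    case True
    then have "\<mu> powr (2 * s + 1) = \<mu> powr (2 * s) * \<mu>" by (simp add: powr_add)
    moreover have "exp (- (l\<^sup>2 + \<mu>\<^sup>2)) = exp (- l\<^sup>2) * exp (- \<mu>\<^sup>2)" by (simp flip: exp_add)
    ultimately show ?thesis using True by simp
  qed (auto simp: indicator_def)
qed

text \<open>The error bound is of order \<open>outer_rate a ^ (- m) / m powr (s + 1)\<close>, so the growth of polynomials across the gap
and the magnification \<open>(m / a) powr s\<close> leave a factor \<open>1 / m\<close>.\<close>

lemma gap_difference_null:
  "(\<lambda>m. (real m / a) powr s * (2 * (amplitude m * moment (kern m)) * outer_rate a ^ m)) \<longlonglongrightarrow> 0"
proof -
  define w where "w = outer_rate a"
  have w: "w > 1" using outer_rate_gt_1[OF a] by (simp add: w_def)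
  have "(\<lambda>m. 2 * error_const / (w * a powr s) * moment (kern m) * (1 / real m))
      \<longlonglongrightarrow> 2 * error_const / (w * a powr s) * Gamma (s + 1) * 0"
    using lim_1_over_n by (intro tendsto_intros moment_kern_limit)
  then have "(\<lambda>m. 2 * error_const / (w * a powr s) * moment (kern m) * (1 / real m)) \<longlonglongrightarrow> 0" by simp
  moreover have "\<forall>\<^sub>F m in sequentially. 2 * error_const / (w * a powr s) * moment (kern m) * (1 / real m)
      = (real m / a) powr s * (2 * (amplitude m * moment (kern m)) * outer_rate a ^ m)"
    using eventually_ge_at_top[of 1]
  proof eventually_elim
    case (elim m)
    have m: "0 < real m" using elim by simp
    have "error_const = w ^ Suc m * (real m powr s * real m) * amplitude m"
      using amplitude_asymptotics[OF elim] m by (simp add: w_def powr_add del: power_Suc)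
    moreover have "(real m / a) powr s = real m powr s / a powr s" using a m by (simp add: powr_divide)
    ultimately show ?case using w m a by (simp add: w_def[symmetric])
  qed
  ultimately show ?thesis by (rule Lim_transform_eventually)
qed

text \<open>The polynomial is replaced by the interpolant at the cost of \<open>gap_difference_null\<close>. For the interpolant
the error formula at \<open>y = a l\<^sup>2 / m\<close> gives the limit function with \<open>exp (- l\<^sup>2)\<close> replaced by \<open>A m\<close>
and \<open>exp (- \<mu>\<^sup>2)\<close> by \<open>kern m \<mu>\<close>. Both replacements are controlled along an arbitrary sequence of
points of \<open>K\<close>, using that \<open>K\<close> stays away from \<open>0\<close>.\<close>

lemma best_poly_limit:
  assumes K: "compact K" "K \<subseteq> {0<..}"
  shows "uniform_limit K (\<lambda>m l. (real m / a) powr s * poly (best_poly m (2 * s) a) (sqrt (a / real m) * l))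
    limit_fun sequentially"
proof (rule uniform_limit_sequentiallyI)
  fix l :: "nat \<Rightarrow> real" assume l: "\<And>m. l m \<in> K"
  have "K \<noteq> {}" using l by blast
  then obtain d where d: "d \<in> K" "\<And>x. x \<in> K \<Longrightarrow> d \<le> x"
    using compact_attains_inf[OF K(1)] by blast
  then have d0: "0 < d" using K(2) by auto
  obtain b where b: "\<And>x. x \<in> K \<Longrightarrow> x \<le> b"
    using bounded_imp_bdd_above[OF compact_imp_bounded[OF K(1)]] unfolding bdd_above_def by blast
  have l0: "0 < l m" and ld: "d\<^sup>2 \<le> (l m)\<^sup>2" and lb: "(l m)\<^sup>2 \<le> b\<^sup>2" for m
  proof -
    show l0: "0 < l m" using l K(2) by auto
    show "d\<^sup>2 \<le> (l m)\<^sup>2" using d(2)[OF l] d0 by (intro power_mono) auto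
    show "(l m)\<^sup>2 \<le> b\<^sup>2" using b[OF l] l0 by (intro power_mono) auto
  qed
  define y where "y m = a * (l m)\<^sup>2 / real m" for m
  define A where "A m = poly (node_poly a m) (y m) / node_scale a m" for m
  define X where "X m = moment (\<lambda>\<mu>. kern m \<mu> / ((l m)\<^sup>2 + \<mu>\<^sup>2))" for m
  define Y where "Y m = moment (\<lambda>\<mu>. exp (- \<mu>\<^sup>2) / ((l m)\<^sup>2 + \<mu>\<^sup>2))" for m
  define B where "B m = 2 * (amplitude m * moment (kern m)) * outer_rate a ^ m" for m
  have den: "d\<^sup>2 \<le> (l m)\<^sup>2 + \<mu>\<^sup>2" for m \<mu> using ld[of m] zero_le_power2[of \<mu>] by linarith
  have d2: "0 < d\<^sup>2" using d0 by simp
  have quot: "\<bar>g / ((l m)\<^sup>2 + \<mu>\<^sup>2)\<bar> \<le> \<bar>g\<bar> / d\<^sup>2" for g m \<mu>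
    using den[of m \<mu>] d2 by (simp add: abs_divide frac_le)
  have Alim: "(\<lambda>m. A m - exp (- (l m)\<^sup>2)) \<longlonglongrightarrow> 0"
    unfolding A_def y_def
  proof (rule node_poly_limit[OF a])
    show "bounded (range (\<lambda>m. (l m)\<^sup>2))"
      using lb by (intro boundedI[where B = "b\<^sup>2"]) auto
  qed
  have XY: "(\<lambda>m. X m - Y m) \<longlonglongrightarrow> 0"
  proof -
    have int: "set_integrable lborel {0<..} (\<lambda>\<mu>. 2 * \<mu> powr (2 * s + 1) * (g \<mu> / ((l m)\<^sup>2 + \<mu>\<^sup>2)))"
      if "g \<in> borel_measurable borel" "\<And>\<mu>. 0 \<le> g \<mu> \<and> g \<mu> \<le> kern_bound / (1 + \<mu>\<^sup>2) ^ (k + 2)" for g m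
    proof (rule set_integrable_moment(3)[OF s])
      show "(\<lambda>\<mu>. g \<mu> / ((l m)\<^sup>2 + \<mu>\<^sup>2)) \<in> borel_measurable borel" using that(1) by measurable
      show "\<bar>g \<mu> / ((l m)\<^sup>2 + \<mu>\<^sup>2)\<bar> \<le> (kern_bound / d\<^sup>2) / (1 + \<mu>\<^sup>2) ^ (k + 2)" for \<mu>
      proof -
        have "\<bar>g \<mu>\<bar> / d\<^sup>2 \<le> kern_bound / (1 + \<mu>\<^sup>2) ^ (k + 2) / d\<^sup>2"
          using that(2)[of \<mu>] d2 by (intro divide_right_mono) auto
        then show ?thesis using quot[of "g \<mu>" m \<mu>] by (simp add: mult.commute)
      qed
    qed
    have "(\<lambda>m. moment (\<lambda>\<mu>. (kern m \<mu> - exp (- \<mu>\<^sup>2)) / ((l m)\<^sup>2 + \<mu>\<^sup>2))) \<longlonglongrightarrow> moment (\<lambda>\<mu>. 0)"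
    proof (rule moment_tendsto)
      show "\<bar>(kern m \<mu> - exp (- \<mu>\<^sup>2)) / ((l m)\<^sup>2 + \<mu>\<^sup>2)\<bar> \<le> (kern_bound / d\<^sup>2) / (1 + \<mu>\<^sup>2) ^ (k + 2)"
        if m: "k + 2 \<le> m" for m \<mu>
      proof -
        have "\<bar>kern m \<mu> - exp (- \<mu>\<^sup>2)\<bar> \<le> kern_bound / (1 + \<mu>\<^sup>2) ^ (k + 2)"
          using kern_le[OF m, of \<mu>] gauss_le[of \<mu>] kern_nonneg[of m \<mu>] m exp_ge_zero[of "- \<mu>\<^sup>2"] by linarith
        then have "\<bar>kern m \<mu> - exp (- \<mu>\<^sup>2)\<bar> / d\<^sup>2 \<le> kern_bound / (1 + \<mu>\<^sup>2) ^ (k + 2) / d\<^sup>2"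
          using d2 by (intro divide_right_mono) auto
        then show ?thesis using quot[of "kern m \<mu> - exp (- \<mu>\<^sup>2)" m \<mu>] by (simp add: mult.commute)
      qed
      show "(\<lambda>m. (kern m \<mu> - exp (- \<mu>\<^sup>2)) / ((l m)\<^sup>2 + \<mu>\<^sup>2)) \<longlonglongrightarrow> 0" for \<mu>
      proof (rule Lim_null_comparison)
        have "(\<lambda>m. \<bar>kern m \<mu> - exp (- \<mu>\<^sup>2)\<bar> / d\<^sup>2) \<longlonglongrightarrow> \<bar>exp (- \<mu>\<^sup>2) - exp (- \<mu>\<^sup>2)\<bar> / d\<^sup>2"
          using d2 by (intro tendsto_intros kern_limit) auto
        then show "(\<lambda>m. \<bar>kern m \<mu> - exp (- \<mu>\<^sup>2)\<bar> / d\<^sup>2) \<longlonglongrightarrow> 0" by simp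
        show "\<forall>\<^sub>F m in sequentially. norm ((kern m \<mu> - exp (- \<mu>\<^sup>2)) / ((l m)\<^sup>2 + \<mu>\<^sup>2)) \<le> \<bar>kern m \<mu> - exp (- \<mu>\<^sup>2)\<bar> / d\<^sup>2"
          unfolding real_norm_def by (intro always_eventually allI quot)
      qed
    qed measurable
    moreover have "moment (\<lambda>\<mu>. 0) = 0" by (simp add: moment_def)
    moreover have "\<forall>\<^sub>F m in sequentially. moment (\<lambda>\<mu>. (kern m \<mu> - exp (- \<mu>\<^sup>2)) / ((l m)\<^sup>2 + \<mu>\<^sup>2)) = X m - Y m"
      using eventually_ge_at_top[of "k + 2"]
    proof eventually_elim
      case (elim m)
      have "X m - Y m = (LINT \<mu>:{0<..}|lborel. 2 * \<mu> powr (2 * s + 1) * (kern m \<mu> / ((l m)\<^sup>2 + \<mu>\<^sup>2))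
          - 2 * \<mu> powr (2 * s + 1) * (exp (- \<mu>\<^sup>2) / ((l m)\<^sup>2 + \<mu>\<^sup>2)))"
        unfolding X_def Y_def moment_def
        using kern_le[OF elim] kern_nonneg[of m] elim gauss_le
        by (intro set_integral_diff(2)[symmetric] int) auto
      then show ?case unfolding moment_def by (simp add: diff_divide_distrib right_diff_distrib)
    qed
    ultimately show ?thesis by (auto elim: Lim_transform_eventually)
  qed
  have Xbd: "\<forall>\<^sub>F m in sequentially. \<bar>X m\<bar> \<le> moment (kern m) / d\<^sup>2"
    using eventually_ge_at_top[of "k + 2"]
  proof eventually_elim
    case (elim m)
    have Kn: "0 \<le> kern m \<mu>" for \<mu> using kern_nonneg[of m \<mu>] elim by simp
    have *: "0 \<le> kern m \<mu> / ((l m)\<^sup>2 + \<mu>\<^sup>2) \<and> kern m \<mu> / ((l m)\<^sup>2 + \<mu>\<^sup>2) \<le> 1 / d\<^sup>2 * kern m \<mu>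
        \<and> 1 / d\<^sup>2 * kern m \<mu> \<le> (kern_bound / d\<^sup>2) / (1 + \<mu>\<^sup>2) ^ (k + 2)" for \<mu>
    proof (intro conjI)
      show "0 \<le> kern m \<mu> / ((l m)\<^sup>2 + \<mu>\<^sup>2)" using Kn by simp
      then show "kern m \<mu> / ((l m)\<^sup>2 + \<mu>\<^sup>2) \<le> 1 / d\<^sup>2 * kern m \<mu>" using quot[of "kern m \<mu>" m \<mu>] Kn[of \<mu>] by simp
      show "1 / d\<^sup>2 * kern m \<mu> \<le> (kern_bound / d\<^sup>2) / (1 + \<mu>\<^sup>2) ^ (k + 2)"
        using mult_left_mono[OF kern_le[OF elim, of \<mu>], of "1 / d\<^sup>2"] d2 by (simp add: mult.commute)
    qed
    have "0 \<le> X m" "X m \<le> moment (\<lambda>\<mu>. 1 / d\<^sup>2 * kern m \<mu>)"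
      unfolding X_def by (rule moment_mono[OF _ _ *]; measurable)+
    moreover have "moment (\<lambda>\<mu>. 1 / d\<^sup>2 * kern m \<mu>) = 1 / d\<^sup>2 * moment (kern m)"
      unfolding moment_def set_integral_mult_right[symmetric] by (intro set_lebesgue_integral_cong) auto
    ultimately show ?case by simp
  qed
  have main: "(\<lambda>m. A m * X m - exp (- (l m)\<^sup>2) * Y m) \<longlonglongrightarrow> 0"
  proof -
    have "(\<lambda>m. (A m - exp (- (l m)\<^sup>2)) * X m) \<longlonglongrightarrow> 0"
    proof (rule Lim_null_comparison)
      have "(\<lambda>m. \<bar>A m - exp (- (l m)\<^sup>2)\<bar> * (moment (kern m) / d\<^sup>2)) \<longlonglongrightarrow> \<bar>0\<bar> * (Gamma (s + 1) / d\<^sup>2)"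
        using d2 by (intro tendsto_intros Alim moment_kern_limit) auto
      then show "(\<lambda>m. \<bar>A m - exp (- (l m)\<^sup>2)\<bar> * (moment (kern m) / d\<^sup>2)) \<longlonglongrightarrow> 0" by simp
      show "\<forall>\<^sub>F m in sequentially. norm ((A m - exp (- (l m)\<^sup>2)) * X m) \<le> \<bar>A m - exp (- (l m)\<^sup>2)\<bar> * (moment (kern m) / d\<^sup>2)"
        using Xbd by eventually_elim (simp only: real_norm_def abs_mult mult_left_mono abs_ge_zero)
    qed
    moreover have "(\<lambda>m. exp (- (l m)\<^sup>2) * (X m - Y m)) \<longlonglongrightarrow> 0"
    proof (rule Lim_null_comparison)
      show "(\<lambda>m. \<bar>X m - Y m\<bar>) \<longlonglongrightarrow> 0" using tendsto_rabs_zero[OF XY] .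
      show "\<forall>\<^sub>F m in sequentially. norm (exp (- (l m)\<^sup>2) * (X m - Y m)) \<le> \<bar>X m - Y m\<bar>"
        by (intro always_eventually allI) (simp add: abs_mult mult_left_le_one_le)
    qed
    ultimately have "(\<lambda>m. (A m - exp (- (l m)\<^sup>2)) * X m + exp (- (l m)\<^sup>2) * (X m - Y m)) \<longlonglongrightarrow> 0 + 0"
      by (rule tendsto_add)
    then show ?thesis by (simp add: algebra_simps)
  qed
  show "(\<lambda>m. (real m / a) powr s * poly (best_poly m (2 * s) a) (sqrt (a / real m) * l m) - limit_fun (l m)) \<longlonglongrightarrow> 0"
  proof (rule Lim_null_comparison)
    have "(\<lambda>m. (real m / a) powr s * B m + \<bar>sin (pi * s) / pi\<bar> * \<bar>A m * X m - exp (- (l m)\<^sup>2) * Y m\<bar>)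
        \<longlonglongrightarrow> 0 + \<bar>sin (pi * s) / pi\<bar> * \<bar>0\<bar>"
      unfolding B_def by (intro tendsto_add[OF gap_difference_null] tendsto_mult tendsto_const tendsto_rabs main)
    then show "(\<lambda>m. (real m / a) powr s * B m + \<bar>sin (pi * s) / pi\<bar> * \<bar>A m * X m - exp (- (l m)\<^sup>2) * Y m\<bar>) \<longlonglongrightarrow> 0"
      by simp
    have "\<forall>\<^sub>F m in sequentially. b\<^sup>2 / a \<le> real m"
      using filterlim_real_sequentially unfolding filterlim_at_top by blast
    with eventually_ge_at_top[of "k + 2"]
    show "\<forall>\<^sub>F m in sequentially. norm ((real m / a) powr s * poly (best_poly m (2 * s) a) (sqrt (a / real m) * l m) - limit_fun (l m))
        \<le> (real m / a) powr s * B m + \<bar>sin (pi * s) / pi\<bar> * \<bar>A m * X m - exp (- (l m)\<^sup>2) * Y m\<bar>"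
    proof eventually_elim
      case (elim m)
      then have m: "k + 2 \<le> m" and m0: "0 < real m" by auto
      have y0: "0 < y m" using l0[of m] a m0 by (simp add: y_def)
      have ya: "y m \<le> a\<^sup>2"
      proof -
        have "(l m)\<^sup>2 \<le> a * real m" using lb[of m] elim(2) a by (simp add: field_simps)
        then show ?thesis using a m0 by (simp add: y_def field_simps power2_eq_square)
      qed
      obtain D where D: "degree D \<le> m" "\<And>x. poly (best_poly m (2 * s) a) x = poly D (x\<^sup>2)"
        "\<And>y. y \<in> {a\<^sup>2..1} \<Longrightarrow> \<bar>y powr s - poly D y\<bar> \<le> approx_error (2 * m) (2 * s) a"
        using best_poly_even by blast
      obtain L where L: "is_interpolant m L" using interpolant_exists[OF m] by blast
      have "\<bar>poly (D - L) z\<bar> \<le> 2 * (amplitude m * moment (kern m))" if z: "z \<in> {a\<^sup>2..1}" for z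
        using interpolant_error_le[OF m L z] D(3)[OF z] approx_error_upper[OF m] by simp
      moreover have "degree (D - L) \<le> m" using D(1) L by (intro degree_diff_le) (auto simp: is_interpolant_def)
      ultimately have DL: "\<bar>poly (D - L) (y m)\<bar> \<le> B m"
        unfolding B_def outer_rate_def using y0 ya by (intro bernstein_walsh_gap[OF a]) auto
      have arg: "(sqrt (a / real m) * l m)\<^sup>2 = y m"
        using a m0 by (simp add: power_mult_distrib y_def)
      have ma: "0 < real m / a" using m0 a by simp
      have ypow: "(real m / a) powr s * y m powr s = l m powr (2 * s)"
      proof -
        have "(real m / a) powr s * y m powr s = ((l m)\<^sup>2) powr s"
          using a m0 y0 by (simp add: y_def flip: powr_mult)
        also have "(l m)\<^sup>2 = l m powr 2" using l0[of m] by (simp add: powr_realpow)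
        finally show ?thesis by (simp add: powr_powr)
      qed
      have coef: "(real m / a) powr s * (a / real m) powr (s + 1) = a / real m"
        using a m0 by (simp add: powr_add mult.assoc[symmetric] flip: powr_mult)
      have St: "a / real m * stieltjes m (y m) = X m"
        unfolding stieltjes_def X_def moment_def set_integral_mult_right[symmetric]
      proof (intro set_lebesgue_integral_cong allI impI)
        fix \<mu> :: real
        have "y m + a * \<mu>\<^sup>2 / real m = a / real m * ((l m)\<^sup>2 + \<mu>\<^sup>2)" by (simp add: y_def algebra_simps)
        then show "a / real m * (2 * \<mu> powr (2 * s + 1) * (kern m \<mu> / (y m + a * \<mu>\<^sup>2 / real m)))
            = 2 * \<mu> powr (2 * s + 1) * (kern m \<mu> / ((l m)\<^sup>2 + \<mu>\<^sup>2))"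
          using a m0 by simp
      qed simp
      have "poly L (y m) = y m powr s + sin (pi * s) / pi * A m * (a / real m) powr (s + 1) * stieltjes m (y m)"
        using L y0 unfolding is_interpolant_def A_def by (simp add: algebra_simps)
      then have "(real m / a) powr s * poly L (y m) = (real m / a) powr s * y m powr s
          + sin (pi * s) / pi * A m * ((real m / a) powr s * (a / real m) powr (s + 1) * stieltjes m (y m))"
        by (simp add: algebra_simps)
      then have Leq: "(real m / a) powr s * poly L (y m) = l m powr (2 * s) + sin (pi * s) / pi * (A m * X m)"
        unfolding ypow coef St by simp
      have "(real m / a) powr s * poly (best_poly m (2 * s) a) (sqrt (a / real m) * l m) - limit_fun (l m)
          = (real m / a) powr s * poly (D - L) (y m) + ((real m / a) powr s * poly L (y m) - limit_fun (l m))"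
        unfolding D(2) arg by (simp add: algebra_simps)
      also have "(real m / a) powr s * poly L (y m) - limit_fun (l m)
          = sin (pi * s) / pi * (A m * X m - exp (- (l m)\<^sup>2) * Y m)"
        unfolding Leq limit_fun_def Y_def by (simp add: algebra_simps)
      finally have "norm ((real m / a) powr s * poly (best_poly m (2 * s) a) (sqrt (a / real m) * l m) - limit_fun (l m))
          \<le> \<bar>(real m / a) powr s * poly (D - L) (y m)\<bar> + \<bar>sin (pi * s) / pi * (A m * X m - exp (- (l m)\<^sup>2) * Y m)\<bar>"
        unfolding real_norm_def by (simp only: abs_triangle_ineq)
      also have "\<dots> \<le> (real m / a) powr s * B m + \<bar>sin (pi * s) / pi\<bar> * \<bar>A m * X m - exp (- (l m)\<^sup>2) * Y m\<bar>"
        using DL by (simp only: abs_mult) (simp add: mult_left_mono)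
      finally show ?case .
    qed
  qed
qed

end

section \<open>The asymptotic formulas\<close>

theorem theorem6p1:
  fixes a p :: real
  assumes "0 < a" "a < 1" "p > 0" "\<not> (\<exists>k::int. even k \<and> p = of_int k)"
  shows "((\<lambda>m. ((1 + a) / (1 - a)) ^ (m + 1) * real m powr (p / 2 + 1) * approx_error (2 * m) p a)
            \<longlonglongrightarrow> a powr (p / 2 - 1) * ((1 + a)\<^sup>2 / (2 * \<bar>Gamma (- (p / 2))\<bar>))) \<and>
         (\<forall>K. compact K \<and> K \<subseteq> {0<..} \<longrightarrow>
            uniform_limit K
              (\<lambda>m l. (real m / a) powr (p / 2) * poly (best_poly m p a) (sqrt (a / real m) * l))
              (\<lambda>l. l powr p + sin (pi * p / 2) / pi *
                 (LINT \<mu>:{0..}|lborel.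
                    \<mu> powr p * exp (- (l\<^sup>2 + \<mu>\<^sup>2)) * (2 * \<mu> / (l\<^sup>2 + \<mu>\<^sup>2))))
              sequentially)"
proof -
  define s where "s = p / 2"
  have p: "p = 2 * s" by (simp add: s_def)
  \<comment> \<open>The assumption on \<open>p\<close> says that \<open>s\<close> is not an integer, so it lies strictly between \<open>k\<close> and \<open>k + 1\<close>.\<close>
  define k where "k = nat \<lfloor>s\<rfloor>"
  have k: "real k = of_int \<lfloor>s\<rfloor>" using assms(3) by (simp add: k_def s_def)
  have "s \<noteq> of_int \<lfloor>s\<rfloor>"
  proof
    assume "s = of_int \<lfloor>s\<rfloor>"
    then have "p = of_int (2 * \<lfloor>s\<rfloor>)" unfolding p by simp
    then show False using assms(4) by (metis dvd_triv_left)
  qed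
  moreover have "of_int \<lfloor>s\<rfloor> \<le> s" "s < of_int \<lfloor>s\<rfloor> + 1" by linarith+
  ultimately have "real k < s" "s < real k + 1" unfolding k by linarith+
  then interpret gapped_power a s k using assms by unfold_locales auto
  have "(\<lambda>m. ((1 + a) / (1 - a)) ^ (m + 1) * real m powr (s + 1) * approx_error (2 * m) (2 * s) a)
      \<longlonglongrightarrow> a powr (s - 1) * ((1 + a)\<^sup>2 / (2 * \<bar>Gamma (- s)\<bar>))"
    using approx_error_limit unfolding error_const_Gamma by (simp add: outer_rate_def)
  moreover have "uniform_limit K (\<lambda>m l. (real m / a) powr s * poly (best_poly m (2 * s) a) (sqrt (a / real m) * l))
      (\<lambda>l. l powr (2 * s) + sin (pi * s) / pi *
        (LINT \<mu>:{0..}|lborel. \<mu> powr (2 * s) * exp (- (l\<^sup>2 + \<mu>\<^sup>2)) * (2 * \<mu> / (l\<^sup>2 + \<mu>\<^sup>2)))) sequentially"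
    if "compact K" "K \<subseteq> {0<..}" for K
    using best_poly_limit[OF that] unfolding moment_eq_integral limit_fun_def[abs_def] .
  ultimately show ?thesis unfolding p by simp
qed

end
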